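(* Let $\Sigma$ be a disk with $n>1$ punctures, and let $L$ be a link in $\Sigma\times I$. Choose a puncture $p$ of $\Sigma$, and let $A=\mathbb D^2\setminus\{p\}$ be the annulus obtained from $\Sigma$ by filling in every puncture except $p$. Then there is a spectral sequence with $E_1$ page isomorphic to $\mathrm{MKh}(L\subset\Sigma\times I)$ (with flattened grading) that converges to $\mathrm{AKh}(L\subset A\times I)$.
   Context: Setting. All links are oriented and considered up to ambient isotopy. $I=[0,1]$ and $\Sigma=\mathbb D^2\setminus\{p_1,\dots,p_n\}$ is an oriented disk with $n$ punctures. A diagram $D\subset\Sigma$ of a link $L\subset\Sigma\times I$ is a generic projection of $L$ to $\Sigma$ with crossing data; it is also a diagram in $\mathbb R^2$ and in $A$ via the inclusions. Khovanov complex over $\mathbb Q$. Order the crossings $c_1,\dots,c_N$ of $D$. The $0$-resolution (resp. $1$-resolution) of a crossing joins the two regions swept out when the overstrand is rotated counterclockwise (resp. clockwise) until it meets the understrand. For $S\in\{0,1\}^N$, $D(S)$ is the collection of circles obtained by replacing each $c_i$ by its $S_i$-resolution. Let $V=\mathbb Q\langle v_+,v_-\rangle$, with quantum degrees $+1,-1$. If $D(S)$ has $k$ circles put $\mathrm{CKh}(D(S))=V^{\otimes k}$; its generators are enhanced states $\{(C_i,s_i)\}_i$, labelings of the circles $C_i$ by signs $s_i\in\{+,-\}$. With $n_\pm$ the numbers of positive/negative crossings, $\mathrm{wr}(D)=n_+-n_-$, $|S|=\sum_iS_i$, $$\mathrm{CKh}(D)=\bigoplus_{S}\mathrm{CKh}(D(S))[|S|-n_-]\{|S|-n_-+\mathrm{wr}(D)\},$$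 where $[\cdot]$ and $\{\cdot\}$ are shifts of the homological and quantum gradings, $M[i]_m=M_{m-i}$, $M\{i\}_m=M_{m-i}$. If $S'$ is obtained from $S$ by changing one $0$ (in position $j$) to $1$, then $\partial_{S,S'}$ is the merge map ($v_+\otimes v_+\mapsto v_+$, $v_+\otimes v_-,\,v_-\otimes v_+\mapsto v_-$, $v_-\otimes v_-\mapsto 0$) or the split map ($v_+\mapsto v_+\otimes v_-+v_-\otimes v_+$, $v_-\mapsto v_-\otimes v_-$) on the affected factors and the identity on the others; $\partial=\sum(-1)^{\sum_{i<j}S_i}\partial_{S,S'}$. For a filtration $\mathcal F$ of a complex $C$ by a poset, $\mathrm{gr}(C)=\bigoplus_a\mathcal F_aC/\sum_{b<a}\mathcal F_bC$ with the induced differential. $\mathrm{MKh}$. For an enhanced state $x=\{(C_i,s_i)\}_i$ set $g^\Sigma(x)=\sum_is_i[C_i]\in H_1(\Sigma;\mathbb Z)$, circles oriented counterclockwise. Identify $H_1(\Sigma;\mathbb Z)\cong\mathbb Z^n$ via the basis of positively oriented loops around the punctures, with the product partial order. $\mathcal F^\Sigma_a$ is the span of generators $x$ with $g^\Sigma(x)\le a$ (it is preserved by $\partial$), and $\mathrm{MKh}(L\subset\Sigma\times I)=H^*(\mathrm{gr}(\mathrm{CKh}(D),\partial,\mathcal F^\Sigma))$. Its flattened grading is the $\mathbb Z$-grading $\epsilon\circ g^\Sigma$, where $\epsilon:\mathbb Z^n\to\mathbb Z$ is the sum of coordinates. $\mathrm{AKh}$. For the annulus $A$, set $k(x)=\sum_is_i[C_i]\in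 H_1(A;\mathbb Z)\cong\mathbb Z$ (circles oriented counterclockwise). The span of generators with $k(x)\le a$, $a\in\mathbb Z$, gives a $\mathbb Z$-filtration $\mathcal F^A$ of $(\mathrm{CKh}(D),\partial)$, and annular Khovanov homology is $\mathrm{AKh}(L)=H^*(\mathrm{gr}(\mathrm{CKh}(D),\partial,\mathcal F^A))$. "Converges to $H$" means that the $E_\infty$ page is isomorphic to the associated graded module of a finite filtration of $H$. *)

theory Defs
  imports "HOL-Complex_Analysis.Winding_Numbers" "HOL-Algebra.Module" "HOL-Algebra.AbelCoset"
begin

section \<open>Vector spaces over the rationals\<close>

definition rat_field :: "rat ring" where
  "rat_field = \<lparr>carrier = UNIV, mult = (*), one = 1, zero = 0, add = (+)\<rparr>"

text \<open>A rational vector space is a module over \<^const>\<open>rat_field\<close>. The module record also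
  has the ring fields \<open>mult\<close> and \<open>one\<close>, which play no role for modules and are left undefined.\<close>

type_synonym 'v qspace = "(rat, 'v) module"

definition free_space :: "'x set \<Rightarrow> ('x \<Rightarrow> rat) qspace" where
  "free_space X =
    \<lparr>carrier = {f. finite {x. f x \<noteq> 0} \<and> {x. f x \<noteq> 0} \<subseteq> X},
     mult = (\<lambda>_ _. undefined), one = undefined,
     zero = (\<lambda>_. 0), add = (\<lambda>f g x. f x + g x), smult = (\<lambda>c f x. c * f x)\<rparr>"

definition subspace_of :: "'v qspace \<Rightarrow> 'v set \<Rightarrow> 'v qspace" where
  "subspace_of M N = M\<lparr>carrier := N\<rparr>"

definition span_in :: "'v qspace \<Rightarrow> 'v set \<Rightarrow> 'v set" where
  "span_in M U = \<Inter> {N. submodule N rat_field M \<and> U \<subseteq> N}"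

text \<open>The quotient of \<open>M\<close> by a subspace \<open>N\<close>; its elements are the cosets of \<open>N\<close>.\<close>

definition quot_space :: "'v qspace \<Rightarrow> 'v set \<Rightarrow> 'v set qspace" where
  "quot_space M N =
    \<lparr>carrier = a_rcosets\<^bsub>M\<^esub> N,
     mult = (\<lambda>_ _. undefined), one = undefined,
     zero = N, add = (\<lambda>X Y. X <+>\<^bsub>M\<^esub> Y),
     smult = (\<lambda>c X. \<Union>x\<in>X. N +>\<^bsub>M\<^esub> (c \<odot>\<^bsub>M\<^esub> x))\<rparr>"

definition direct_sum :: "'j set \<Rightarrow> ('j \<Rightarrow> 'v qspace) \<Rightarrow> ('j \<Rightarrow> 'v) qspace" where
  "direct_sum J M =
    \<lparr>carrier = {f \<in> (\<Pi>\<^sub>E j\<in>J. carrier (M j)). finite {j\<in>J. f j \<noteq> \<zero>\<^bsub>M j\<^esub>}},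
     mult = (\<lambda>_ _. undefined), one = undefined,
     zero = (\<lambda>j\<in>J. \<zero>\<^bsub>M j\<^esub>), add = (\<lambda>f g. \<lambda>j\<in>J. f j \<oplus>\<^bsub>M j\<^esub> g j),
     smult = (\<lambda>c f. \<lambda>j\<in>J. c \<odot>\<^bsub>M j\<^esub> f j)\<rparr>"

definition linear_maps :: "'v qspace \<Rightarrow> 'w qspace \<Rightarrow> ('v \<Rightarrow> 'w) set" where
  "linear_maps M N = {h \<in> hom (add_monoid M) (add_monoid N).
     \<forall>c. \<forall>x\<in>carrier M. h (c \<odot>\<^bsub>M\<^esub> x) = c \<odot>\<^bsub>N\<^esub> h x}"

definition isomorphic_spaces :: "'v qspace \<Rightarrow> 'w qspace \<Rightarrow> bool" where
  "isomorphic_spaces M N \<longleftrightarrow> (\<exists>h\<in>linear_maps M N. bij_betw h (carrier M) (carrier N))"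

text \<open>The homology at \<open>M\<close> of \<open>K \<rightarrow> M \<rightarrow> N\<close> with maps \<open>f\<close> and \<open>g\<close>.\<close>

definition homology_at ::
  "'u qspace \<Rightarrow> ('u \<Rightarrow> 'v) \<Rightarrow> 'v qspace \<Rightarrow> ('v \<Rightarrow> 'w) \<Rightarrow> 'w qspace \<Rightarrow> 'v set qspace" where
  "homology_at K f M g N =
    quot_space (subspace_of M {x \<in> carrier M. g x = \<zero>\<^bsub>N\<^esub>}) (f ` carrier K)"


section \<open>Links in a thickened punctured disk\<close>

definition punctured_disk :: "complex set \<Rightarrow> complex set" where
  "punctured_disk P = cball 0 1 - P"

text \<open>A knot is an embedding of the circle \<open>\<real>/\<int>\<close>, given as a 1-periodic map on the reals, and a link
  lists its components; the parametrizations orient the components. No smoothness is imposed: a link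
  that has a diagram in the sense defined below is tame.\<close>

type_synonym link = "(real \<Rightarrow> complex \<times> real) list"

definition link_in :: "(complex \<times> real) set \<Rightarrow> link \<Rightarrow> bool" where
  "link_in M L \<longleftrightarrow>
    (\<forall>K\<in>set L. continuous_on UNIV K \<and> (\<forall>s t. K s = K t \<longleftrightarrow> s - t \<in> \<int>) \<and> range K \<subseteq> M) \<and>
    (\<forall>i<length L. \<forall>j<length L. i \<noteq> j \<longrightarrow> range (L ! i) \<inter> range (L ! j) = {})"

text \<open>At time 1 the isotopy carries \<open>L\<close> to \<open>L'\<close> as an oriented link: up to reordering the components
  and reparametrizing them by lifts of orientation-preserving homeomorphisms of \<open>\<real>/\<int>\<close>.\<close>

definition ambient_isotopic :: "(complex \<times> real) set \<Rightarrow> link \<Rightarrow> link \<Rightarrow> bool" where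
  "ambient_isotopic M L L' \<longleftrightarrow>
    (\<exists>H :: real \<Rightarrow> complex \<times> real \<Rightarrow> complex \<times> real.
       continuous_on ({0..1} \<times> M) (\<lambda>(t, x). H t x) \<and>
       (\<forall>t\<in>{0..1}. \<exists>G. homeomorphism M M (H t) G) \<and>
       (\<forall>x\<in>M. H 0 x = x) \<and>
       (\<exists>\<pi>. bij_betw \<pi> {..<length L} {..<length L'} \<and>
          (\<forall>i<length L. \<exists>\<phi> :: real \<Rightarrow> real.
             continuous_on UNIV \<phi> \<and> strict_mono \<phi> \<and> (\<forall>t. \<phi> (t + 1) = \<phi> t + 1) \<and>
             (\<forall>t. H 1 ((L ! i) t) = (L' ! \<pi> i) (\<phi> t)))))"


section \<open>Link diagrams\<close>

text \<open>The projection to the disk is \<^const>\<open>fst\<close> and the height is \<^const>\<open>snd\<close>. A crossing records its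
  centre and the radius of a small closed disk around it, in which the resolutions will take place. The
  overstrand is the passage of component \<open>over\<close> through this disk: it enters at parameter \<open>over_in\<close>,
  hits the centre at \<open>over_at\<close> and leaves at \<open>over_out\<close>. Likewise for the understrand.\<close>

record crossing =
  center :: complex
  radius :: real
  over :: nat
  over_in :: real
  over_at :: real
  over_out :: real
  under :: nat
  under_in :: real
  under_at :: real
  under_out :: real

text \<open>A diagram is a link in general position with respect to the projection, with its crossings
  \<open>c\<^sub>0, \<dots>, c\<^sub>N\<^sub>-\<^sub>1\<close> in a chosen order.\<close>

record diagram =
  dlink :: link
  crossings :: "crossing list"

definition proj_at :: "link \<Rightarrow> nat \<Rightarrow> real \<Rightarrow> complex" where
  "proj_at L k t = fst ((L ! k) t)"

definition shadow :: "diagram \<Rightarrow> complex set" where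
  "shadow D = (\<Union>K\<in>set (dlink D). fst ` range K)"

definition over_tail :: "link \<Rightarrow> crossing \<Rightarrow> complex" where
  "over_tail L c = proj_at L (over c) (over_in c)"

definition over_head :: "link \<Rightarrow> crossing \<Rightarrow> complex" where
  "over_head L c = proj_at L (over c) (over_out c)"

definition under_tail :: "link \<Rightarrow> crossing \<Rightarrow> complex" where
  "under_tail L c = proj_at L (under c) (under_in c)"

definition under_head :: "link \<Rightarrow> crossing \<Rightarrow> complex" where
  "under_head L c = proj_at L (under c) (under_out c)"

text \<open>Positive (negative) iff \<open>z\<close> lies to the left (right) of the directed overstrand; only used for
  points on the boundary circle of the crossing disk.\<close>

definition side_of_over :: "link \<Rightarrow> crossing \<Rightarrow> complex \<Rightarrow> real" where
  "side_of_over L c z = Im (cnj (over_head L c - over_tail L c) * (z - over_tail L c))"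

text \<open>The diagram meets the closed crossing disk exactly in the two passages, which meet the boundary
  circle of the disk exactly in their ends; these two passages are the only ones through the centre, and
  their four ends alternate around the boundary circle, so that the strands cross transversally.\<close>

definition is_crossing :: "link \<Rightarrow> crossing \<Rightarrow> bool" where
  "is_crossing L c \<longleftrightarrow>
    radius c > 0 \<and> over c < length L \<and> under c < length L \<and>
    over_in c < over_at c \<and> over_at c < over_out c \<and> over_out c < over_in c + 1 \<and>
    under_in c < under_at c \<and> under_at c < under_out c \<and> under_out c < under_in c + 1 \<and>
    (over c = under c \<longrightarrow>
       (\<forall>s\<in>{over_in c..over_out c}. \<forall>t\<in>{under_in c..under_out c}. s - t \<notin> \<int>)) \<and>
    (\<forall>k<length L. \<forall>t. proj_at L k t \<in> cball (center c) (radius c) \<longleftrightarrow>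
       k = over c \<and> (\<exists>m::int. t + m \<in> {over_in c..over_out c}) \<or>
       k = under c \<and> (\<exists>m::int. t + m \<in> {under_in c..under_out c})) \<and>
    (\<forall>k<length L. \<forall>t. proj_at L k t \<in> ball (center c) (radius c) \<longleftrightarrow>
       k = over c \<and> (\<exists>m::int. t + m \<in> {over_in c<..<over_out c}) \<or>
       k = under c \<and> (\<exists>m::int. t + m \<in> {under_in c<..<under_out c})) \<and>
    (\<forall>k<length L. \<forall>t. proj_at L k t = center c \<longleftrightarrow>
       k = over c \<and> t - over_at c \<in> \<int> \<or> k = under c \<and> t - under_at c \<in> \<int>) \<and>
    snd ((L ! over c) (over_at c)) > snd ((L ! under c) (under_at c)) \<and>
    side_of_over L c (under_head L c) * side_of_over L c (under_tail L c) < 0"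

text \<open>The projection of \<open>dlink D\<close> is generic: its only multiple points are the listed crossings.\<close>

definition diagram_in :: "complex set \<Rightarrow> diagram \<Rightarrow> bool" where
  "diagram_in Surf D \<longleftrightarrow>
    link_in (Surf \<times> {0..1}) (dlink D) \<and>
    (\<forall>c\<in>set (crossings D). is_crossing (dlink D) c \<and> cball (center c) (radius c) \<subseteq> Surf) \<and>
    (\<forall>i<length (crossings D). \<forall>j<length (crossings D). i \<noteq> j \<longrightarrow>
       cball (center (crossings D ! i)) (radius (crossings D ! i)) \<inter>
       cball (center (crossings D ! j)) (radius (crossings D ! j)) = {}) \<and>
    (\<forall>k<length (dlink D). \<forall>l<length (dlink D). \<forall>s t.
       proj_at (dlink D) k s = proj_at (dlink D) l t \<longrightarrow>
       k = l \<and> s - t \<in> \<int> \<or> proj_at (dlink D) k s \<in> center ` set (crossings D))"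

definition diagram_of :: "complex set \<Rightarrow> link \<Rightarrow> diagram \<Rightarrow> bool" where
  "diagram_of Surf L D \<longleftrightarrow>
    diagram_in Surf D \<and> ambient_isotopic (Surf \<times> {0..1}) L (dlink D)"

text \<open>A crossing is positive iff the understrand crosses the overstrand from right to left.\<close>

definition positive_crossing :: "link \<Rightarrow> crossing \<Rightarrow> bool" where
  "positive_crossing L c \<longleftrightarrow> side_of_over L c (under_head L c) > 0"

definition n_plus :: "diagram \<Rightarrow> nat" where
  "n_plus D = card {i. i < length (crossings D) \<and> positive_crossing (dlink D) (crossings D ! i)}"

definition n_minus :: "diagram \<Rightarrow> nat" where
  "n_minus D = card {i. i < length (crossings D) \<and> \<not> positive_crossing (dlink D) (crossings D ! i)}"

definition writhe :: "diagram \<Rightarrow> int" where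
  "writhe D = int (n_plus D) - int (n_minus D)"


section \<open>Resolutions\<close>

definition left_end :: "link \<Rightarrow> crossing \<Rightarrow> complex" where
  "left_end L c = (if positive_crossing L c then under_head L c else under_tail L c)"

definition right_end :: "link \<Rightarrow> crossing \<Rightarrow> complex" where
  "right_end L c = (if positive_crossing L c then under_tail L c else under_head L c)"

text \<open>Counterclockwise around the crossing disk one meets \<open>over_head\<close>, \<open>left_end\<close>, \<open>over_tail\<close>,
  \<open>right_end\<close>. Rotating the overstrand counterclockwise to the understrand sweeps out the region
  between \<open>over_head\<close> and \<open>left_end\<close> and the opposite region between \<open>over_tail\<close> and \<open>right_end\<close>. The
  0-resolution joins these two regions, so it consists of the two chords that cut off the other two
  regions.\<close>

definition resolution0 :: "link \<Rightarrow> crossing \<Rightarrow> complex set" where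
  "resolution0 L c = closed_segment (over_tail L c) (left_end L c) \<union>
                     closed_segment (over_head L c) (right_end L c)"

definition resolution1 :: "link \<Rightarrow> crossing \<Rightarrow> complex set" where
  "resolution1 L c = closed_segment (over_head L c) (left_end L c) \<union>
                     closed_segment (over_tail L c) (right_end L c)"

text \<open>A vertex of the cube \<open>{0,1}\<^sup>N\<close> is encoded as the set of (indices of) 1-resolved crossings.\<close>

definition resolved :: "diagram \<Rightarrow> nat set \<Rightarrow> complex set" where
  "resolved D S =
    (shadow D - (\<Union>c\<in>set (crossings D). ball (center c) (radius c))) \<union>
    (\<Union>i\<in>{..<length (crossings D)}.
       if i \<in> S then resolution1 (dlink D) (crossings D ! i)
       else resolution0 (dlink D) (crossings D ! i))"

definition circles :: "diagram \<Rightarrow> nat set \<Rightarrow> complex set set" where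
  "circles D S = components (resolved D S)"


section \<open>The Khovanov complex\<close>

text \<open>An enhanced state \<open>(S, X)\<close> is a vertex \<open>S\<close> of the cube with the set \<open>X\<close> of those circles of
  \<open>D(S)\<close> that are labelled \<open>+\<close>. It is the basis vector of the tensor power of \<open>V\<close> at \<open>S\<close> with a factor
  \<open>v\<^sub>+\<close> at each circle in \<open>X\<close> and a factor \<open>v\<^sub>-\<close> at each other circle.\<close>

type_synonym state = "nat set \<times> complex set set"
type_synonym chain = "state \<Rightarrow> rat"

definition enhanced_states :: "diagram \<Rightarrow> state set" where
  "enhanced_states D = {(S, X). S \<subseteq> {..<length (crossings D)} \<and> X \<subseteq> circles D S}"

definition label :: "state \<Rightarrow> complex set \<Rightarrow> int" where
  "label x C = (if C \<in> snd x then 1 else -1)"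

definition hom_degree :: "diagram \<Rightarrow> state \<Rightarrow> int" where
  "hom_degree D x = int (card (fst x)) - int (n_minus D)"

definition q_degree :: "diagram \<Rightarrow> state \<Rightarrow> int" where
  "q_degree D x = (\<Sum>C\<in>circles D (fst x). label x C) +
     (int (card (fst x)) - int (n_minus D) + writhe D)"

definition states_in_degree :: "diagram \<Rightarrow> int \<Rightarrow> int \<Rightarrow> state set" where
  "states_in_degree D i q = {x \<in> enhanced_states D. hom_degree D x = i \<and> q_degree D x = q}"

definition CKh :: "diagram \<Rightarrow> int \<Rightarrow> int \<Rightarrow> chain qspace" where
  "CKh D i q = free_space (states_in_degree D i q)"

text \<open>The coefficient of \<open>y\<close> in the image of \<open>x\<close> under the merge or split map between two adjacent
  vertices. The circles that avoid the changed crossing are the same subsets of the plane in both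
  resolutions; \<open>Old\<close> and \<open>New\<close> are the affected circles. In a merge, \<open>v\<^sub>+ \<otimes> v\<^sub>+ \<mapsto> v\<^sub>+\<close>, one \<open>v\<^sub>+\<close> and one
  \<open>v\<^sub>-\<close> go to \<open>v\<^sub>-\<close>, and \<open>v\<^sub>- \<otimes> v\<^sub>- \<mapsto> 0\<close>; in a split, \<open>v\<^sub>+\<close> goes to the sum of the two ways to label
  exactly one circle \<open>+\<close>, and \<open>v\<^sub>- \<mapsto> v\<^sub>- \<otimes> v\<^sub>-\<close>.\<close>

definition edge_coeff :: "diagram \<Rightarrow> state \<Rightarrow> state \<Rightarrow> rat" where
  "edge_coeff D x y =
    (let Old = circles D (fst x) - circles D (fst y);
         New = circles D (fst y) - circles D (fst x);
         old_plus = card (Old \<inter> snd x);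
         new_plus = card (New \<inter> snd y)
     in if \<forall>C \<in> circles D (fst x) \<inter> circles D (fst y). label x C = label y C
        then if card Old = 2 \<and> card New = 1
             then of_bool (old_plus = 2 \<and> new_plus = 1 \<or> old_plus = 1 \<and> new_plus = 0)
             else if card Old = 1 \<and> card New = 2
             then of_bool (old_plus = 1 \<and> new_plus = 1 \<or> old_plus = 0 \<and> new_plus = 0)
             else 0
        else 0)"

definition boundary_coeff :: "diagram \<Rightarrow> state \<Rightarrow> state \<Rightarrow> rat" where
  "boundary_coeff D x y =
    (\<Sum>j \<in> {j. j < length (crossings D) \<and> j \<notin> fst x \<and> fst y = insert j (fst x)}.
       (-1) ^ card {i \<in> fst x. i < j} * edge_coeff D x y)"

definition boundary :: "diagram \<Rightarrow> chain \<Rightarrow> chain" where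
  "boundary D f = (\<lambda>y. if y \<in> enhanced_states D
     then \<Sum>x\<in>enhanced_states D. boundary_coeff D x y * f x else 0)"


section \<open>Filtrations and associated graded complexes\<close>

text \<open>The filtration of the complex induced by a degree \<open>g\<close> on generators, with values in a poset whose
  underlying set is \<open>J\<close>, and the homology of its associated graded complex.\<close>

definition filtration ::
    "diagram \<Rightarrow> (state \<Rightarrow> 'j::order) \<Rightarrow> 'j \<Rightarrow> int \<Rightarrow> int \<Rightarrow> chain set" where
  "filtration D g a i q = carrier (free_space {x \<in> states_in_degree D i q. g x \<le> a})"

definition lower_filtration ::
    "diagram \<Rightarrow> 'j::order set \<Rightarrow> (state \<Rightarrow> 'j) \<Rightarrow> 'j \<Rightarrow> int \<Rightarrow> int \<Rightarrow> chain set" where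
  "lower_filtration D J g a i q =
     span_in (CKh D i q) (\<Union>b\<in>{b\<in>J. b < a}. filtration D g b i q)"

definition gr ::
    "diagram \<Rightarrow> 'j::order set \<Rightarrow> (state \<Rightarrow> 'j) \<Rightarrow> 'j \<Rightarrow> int \<Rightarrow> int \<Rightarrow> chain set qspace" where
  "gr D J g a i q =
     quot_space (subspace_of (CKh D i q) (filtration D g a i q)) (lower_filtration D J g a i q)"

definition gr_boundary ::
    "diagram \<Rightarrow> 'j::order set \<Rightarrow> (state \<Rightarrow> 'j) \<Rightarrow> 'j \<Rightarrow> int \<Rightarrow> int \<Rightarrow> chain set \<Rightarrow> chain set" where
  "gr_boundary D J g a i q X =
     (\<Union>f\<in>X. lower_filtration D J g a (i + 1) q +>\<^bsub>CKh D (i + 1) q\<^esub> boundary D f)"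

definition gr_homology ::
    "diagram \<Rightarrow> 'j::order set \<Rightarrow> (state \<Rightarrow> 'j) \<Rightarrow> 'j \<Rightarrow> int \<Rightarrow> int \<Rightarrow> chain set set qspace" where
  "gr_homology D J g a i q =
     homology_at (gr D J g a (i - 1) q) (gr_boundary D J g a (i - 1) q)
                 (gr D J g a i q) (gr_boundary D J g a i q) (gr D J g a (i + 1) q)"


section \<open>The two homology theories\<close>

definition counterclockwise_loop :: "complex set \<Rightarrow> (real \<Rightarrow> complex) \<Rightarrow> bool" where
  "counterclockwise_loop C \<gamma> \<longleftrightarrow>
    simple_path \<gamma> \<and> pathfinish \<gamma> = pathstart \<gamma> \<and> path_image \<gamma> = C \<and>
    (\<forall>z\<in>inside C. winding_number \<gamma> z = 1)"

text \<open>The coordinate at the puncture \<open>z\<close> of the homology class of \<open>C\<close>, oriented counterclockwise, in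
  the basis of positively oriented loops around the punctures.\<close>

definition circle_class :: "complex set \<Rightarrow> complex \<Rightarrow> int" where
  "circle_class C z = \<lfloor>Re (winding_number (SOME \<gamma>. counterclockwise_loop C \<gamma>) z)\<rfloor>"

text \<open>The group \<open>\<int>\<^sup>n\<close> is indexed by the punctures and embedded in the functions on the plane by
  extension by 0; the order of functions restricts to the product order.\<close>

definition Z_punctures :: "complex set \<Rightarrow> (complex \<Rightarrow> int) set" where
  "Z_punctures P = {b. \<forall>z. z \<notin> P \<longrightarrow> b z = 0}"

definition g_degree :: "complex set \<Rightarrow> diagram \<Rightarrow> state \<Rightarrow> complex \<Rightarrow> int" where
  "g_degree P D x =
    (\<lambda>z. if z \<in> P then \<Sum>C\<in>circles D (fst x). label x C * circle_class C z else 0)"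

definition MKh ::
    "complex set \<Rightarrow> diagram \<Rightarrow> (complex \<Rightarrow> int) \<Rightarrow> int \<Rightarrow> int \<Rightarrow> chain set set qspace" where
  "MKh P D b i q = gr_homology D (Z_punctures P) (g_degree P D) b i q"

definition MKh_flat ::
    "complex set \<Rightarrow> diagram \<Rightarrow> int \<Rightarrow> int \<Rightarrow> int \<Rightarrow> ((complex \<Rightarrow> int) \<Rightarrow> chain set set) qspace" where
  "MKh_flat P D a i q =
     direct_sum {b \<in> Z_punctures P. (\<Sum>z\<in>P. b z) = a} (\<lambda>b. MKh P D b i q)"

definition k_degree :: "complex \<Rightarrow> diagram \<Rightarrow> state \<Rightarrow> int" where
  "k_degree p D x = (\<Sum>C\<in>circles D (fst x). label x C * circle_class C p)"

definition AKh :: "complex \<Rightarrow> diagram \<Rightarrow> int \<Rightarrow> int \<Rightarrow> (int \<Rightarrow> chain set set) qspace" where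
  "AKh p D i q = direct_sum UNIV (\<lambda>a. gr_homology D UNIV (k_degree p D) a i q)"


section \<open>Spectral sequences\<close>

text \<open>Pages \<open>E r a i q\<close> for \<open>r \<ge> 1\<close>, where \<open>a\<close> is the filtration degree of an increasing filtration, \<open>i\<close> the
  homological and \<open>q\<close> the quantum degree; the differential \<open>d r\<close> lowers \<open>a\<close> by \<open>r\<close>, raises \<open>i\<close> by one
  and preserves \<open>q\<close>.\<close>

definition spectral_sequence ::
    "(nat \<Rightarrow> int \<Rightarrow> int \<Rightarrow> int \<Rightarrow> 'v qspace) \<Rightarrow> (nat \<Rightarrow> int \<Rightarrow> int \<Rightarrow> int \<Rightarrow> 'v \<Rightarrow> 'v) \<Rightarrow> bool" where
  "spectral_sequence E d \<longleftrightarrow>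
    (\<forall>r\<ge>1. \<forall>a i q.
       module rat_field (E r a i q) \<and>
       d r a i q \<in> linear_maps (E r a i q) (E r (a - int r) (i + 1) q) \<and>
       (\<forall>x\<in>carrier (E r a i q).
          d r (a - int r) (i + 1) q (d r a i q x) = \<zero>\<^bsub>E r (a - 2 * int r) (i + 2) q\<^esub>) \<and>
       isomorphic_spaces (E (Suc r) a i q)
         (homology_at (E r (a + int r) (i - 1) q) (d r (a + int r) (i - 1) q)
                      (E r a i q) (d r a i q) (E r (a - int r) (i + 1) q)))"

definition finite_filtration ::
    "(int \<Rightarrow> int \<Rightarrow> 'w qspace) \<Rightarrow> (int \<Rightarrow> int \<Rightarrow> int \<Rightarrow> 'w set) \<Rightarrow> bool" where
  "finite_filtration H Fil \<longleftrightarrow>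
    (\<forall>a i q. submodule (Fil a i q) rat_field (H i q) \<and> Fil a i q \<subseteq> Fil (a + 1) i q) \<and>
    (\<exists>lo hi. \<forall>i q. (\<forall>a<lo. Fil a i q = {\<zero>\<^bsub>H i q\<^esub>}) \<and> (\<forall>a\<ge>hi. Fil a i q = carrier (H i q)))"

text \<open>In each degree the differentials into and out of \<open>E r a i q\<close> vanish for all large \<open>r\<close>; the
  eventual value of \<open>E r a i q\<close> is then the \<open>E\<^sub>\<infinity>\<close> page.\<close>

definition converges_to ::
    "(nat \<Rightarrow> int \<Rightarrow> int \<Rightarrow> int \<Rightarrow> 'v qspace) \<Rightarrow> (nat \<Rightarrow> int \<Rightarrow> int \<Rightarrow> int \<Rightarrow> 'v \<Rightarrow> 'v) \<Rightarrow>
     (int \<Rightarrow> int \<Rightarrow> 'w qspace) \<Rightarrow> bool" where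
  "converges_to E d H \<longleftrightarrow>
    (\<exists>Fil. finite_filtration H Fil \<and>
      (\<forall>a i q. \<exists>R\<ge>1. \<forall>r\<ge>R.
         (\<forall>x\<in>carrier (E r a i q). d r a i q x = \<zero>\<^bsub>E r (a - int r) (i + 1) q\<^esub>) \<and>
         (\<forall>x\<in>carrier (E r (a + int r) (i - 1) q).
            d r (a + int r) (i - 1) q x = \<zero>\<^bsub>E r a i q\<^esub>) \<and>
         isomorphic_spaces (E r a i q)
           (quot_space (subspace_of (H i q) (Fil a i q)) (Fil (a - 1) i q))))"

end

theory Submission
  imports Defs "HOL-Library.Function_Algebras"
begin

text \<open>The part of the Khovanov differential that preserves the annular degree at \<open>p\<close> computes the annular
  homology. The remaining coordinates of the degree in \<open>\<int>\<^sup>n\<close> do not increase along it, so their sum with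
  the annular degree filters this complex, and the part of the differential that preserves the sum must
  preserve every coordinate. The spectral sequence of this filtration therefore starts at the flattened
  \<open>MKh\<close> and converges to \<open>AKh\<close>.

  The topological input is that switching the resolution of one crossing merges two circles or splits
  one, and that the classes of the three circles involved satisfy \<open>\<plusminus>[C] = \<plusminus>[C\<^sub>1] \<plusminus> [C\<^sub>2]\<close>. The former holds
  because the two arcs of the diagram outside a crossing disk cannot join opposite ports (Jordan curve
  theorem), the latter because winding numbers add up under the surgery. Since a circle has class 0 or 1 at
  each puncture, the relation turns into triangle inequalities, which make the degree non-increasing.
  Writing the coefficient of an edge as the condition that exactly one of the affected circles is an
  incoming \<open>v\<^sub>-\<close> or an outgoing \<open>v\<^sub>+\<close>, the square of the differential vanishes by a count of circles.\<close>

section \<open>Rational vector spaces and their quotients\<close>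

text \<open>Both homologies are quotients of quotients over different index posets, while the
  spectral sequence needs one complex. The remedy is to keep a single space of chains and to vary
  only the matrix: since no entry raises the degree, the associated graded differential is the
  submatrix \<open>preserving g c\<close> on the original generators. Each homology enters through a
  presentation, a linear surjection from cycles whose kernel is the set of boundaries, so no
  isomorphisms between nested quotients have to be composed. In the plane the obstacle is that
  circles are connected components of a point set. They are identified by building the resolved
  diagram as a finite disjoint system of arcs and Jordan curves. The cutting starts in the link
  itself, where strands are still disjoint, and the projection is taken only after the passages
  through the crossing disks are removed. Chords then fill these disks; as the disks are convex and
  contain no puncture, exchanging chords inside them creates no winding around a puncture.\<close>

lemma rat_field_simps [simp]:
  "carrier rat_field = UNIV" "x \<otimes>\<^bsub>rat_field\<^esub> y = x * y" "\<one>\<^bsub>rat_field\<^esub> = 1"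
  "\<zero>\<^bsub>rat_field\<^esub> = 0" "x \<oplus>\<^bsub>rat_field\<^esub> y = x + y"
  by (simp_all add: rat_field_def)

lemma cring_rat_field: "cring rat_field"
proof (rule cringI)
  show "abelian_group rat_field"
    by (rule abelian_groupI) (auto intro: exI[of _ "- x" for x :: rat] ab_left_minus)
  show "Group.comm_monoid rat_field"
    by (rule comm_monoidI) (auto simp: algebra_simps)
qed (auto simp: algebra_simps)

lemma linear_mapsI:
  assumes "\<And>x. x \<in> carrier M \<Longrightarrow> h x \<in> carrier N"
    and "\<And>x y. x \<in> carrier M \<Longrightarrow> y \<in> carrier M \<Longrightarrow> h (x \<oplus>\<^bsub>M\<^esub> y) = h x \<oplus>\<^bsub>N\<^esub> h y"
    and "\<And>c x. x \<in> carrier M \<Longrightarrow> h (c \<odot>\<^bsub>M\<^esub> x) = c \<odot>\<^bsub>N\<^esub> h x"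
  shows "h \<in> linear_maps M N"
  using assms by (auto simp: linear_maps_def hom_def)

lemma linear_mapsD:
  assumes "h \<in> linear_maps M N"
  shows "\<And>x. x \<in> carrier M \<Longrightarrow> h x \<in> carrier N"
    and "\<And>x y. x \<in> carrier M \<Longrightarrow> y \<in> carrier M \<Longrightarrow> h (x \<oplus>\<^bsub>M\<^esub> y) = h x \<oplus>\<^bsub>N\<^esub> h y"
    and "\<And>c x. x \<in> carrier M \<Longrightarrow> h (c \<odot>\<^bsub>M\<^esub> x) = c \<odot>\<^bsub>N\<^esub> h x"
  using assms by (auto simp: linear_maps_def hom_def)

lemma linear_maps_comp:
  assumes "h \<in> linear_maps M N" "k \<in> linear_maps N K"
  shows "(\<lambda>x. k (h x)) \<in> linear_maps M K"
  by (intro linear_mapsI) (auto simp: linear_mapsD[OF assms(1)] linear_mapsD[OF assms(2)])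

lemma linear_maps_zero:
  assumes "module rat_field M" "module rat_field N" "h \<in> linear_maps M N"
  shows "h \<zero>\<^bsub>M\<^esub> = \<zero>\<^bsub>N\<^esub>"
proof -
  interpret M: module rat_field M by fact
  interpret N: module rat_field N by fact
  have "h \<zero>\<^bsub>M\<^esub> = h (0 \<odot>\<^bsub>M\<^esub> \<zero>\<^bsub>M\<^esub>)"
    using M.smult_l_null[of "\<zero>\<^bsub>M\<^esub>"] by simp
  also have "\<dots> = 0 \<odot>\<^bsub>N\<^esub> h \<zero>\<^bsub>M\<^esub>"
    using linear_mapsD(3)[OF assms(3), of "\<zero>\<^bsub>M\<^esub>" 0] by simp
  also have "\<dots> = \<zero>\<^bsub>N\<^esub>"
    using N.smult_l_null[of "h \<zero>\<^bsub>M\<^esub>"] linear_mapsD[OF assms(3)] by simp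
  finally show ?thesis .
qed

lemma a_inv_eq_smult:
  assumes "module rat_field M" "x \<in> carrier M"
  shows "\<ominus>\<^bsub>M\<^esub> x = (-1) \<odot>\<^bsub>M\<^esub> x"
proof -
  interpret M: module rat_field M by fact
  have "(-1) \<odot>\<^bsub>M\<^esub> x \<oplus>\<^bsub>M\<^esub> x = (-1) \<odot>\<^bsub>M\<^esub> x \<oplus>\<^bsub>M\<^esub> 1 \<odot>\<^bsub>M\<^esub> x"
    using M.smult_one[OF assms(2)] by simp
  also have "\<dots> = (-1 + 1) \<odot>\<^bsub>M\<^esub> x"
    using M.smult_l_distr[of "-1" 1 x] assms by simp
  also have "\<dots> = \<zero>\<^bsub>M\<^esub>"
    using M.smult_l_null[of x] assms by simp
  finally show ?thesis
    using assms M.smult_closed[of "-1" x] by (intro M.minus_equality) auto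
qed

text \<open>Negation is multiplication by -1, so closure under scalars already yields the inverses
  that a subgroup must contain.\<close>

lemma submodule_rat_fieldI:
  assumes "module rat_field M" and "H \<subseteq> carrier M" and "\<zero>\<^bsub>M\<^esub> \<in> H"
    and "\<And>a b. a \<in> H \<Longrightarrow> b \<in> H \<Longrightarrow> a \<oplus>\<^bsub>M\<^esub> b \<in> H"
    and "\<And>c x. x \<in> H \<Longrightarrow> c \<odot>\<^bsub>M\<^esub> x \<in> H"
  shows "submodule H rat_field M"
proof -
  interpret M: module rat_field M by fact
  show ?thesis
    using assms by (intro M.submoduleI) (auto simp: a_inv_eq_smult subset_iff)
qed

lemma submoduleD:
  assumes "submodule H rat_field M"
  shows "\<And>x. x \<in> H \<Longrightarrow> x \<in> carrier M" "\<zero>\<^bsub>M\<^esub> \<in> H"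
    "\<And>a b. a \<in> H \<Longrightarrow> b \<in> H \<Longrightarrow> a \<oplus>\<^bsub>M\<^esub> b \<in> H"
    "\<And>c x. x \<in> H \<Longrightarrow> c \<odot>\<^bsub>M\<^esub> x \<in> H"
  using subgroup.subset[OF submodule.axioms(1)[OF assms]]
    subgroup.one_closed[OF submodule.axioms(1)[OF assms]]
    subgroup.m_closed[OF submodule.axioms(1)[OF assms]]
    submodule.smult_closed[OF assms] by auto

section \<open>Subspaces, images and kernels\<close>

lemma subspace_of_simps [simp]:
  "carrier (subspace_of M N) = N" "x \<oplus>\<^bsub>subspace_of M N\<^esub> y = x \<oplus>\<^bsub>M\<^esub> y"
  "\<zero>\<^bsub>subspace_of M N\<^esub> = \<zero>\<^bsub>M\<^esub>" "c \<odot>\<^bsub>subspace_of M N\<^esub> x = c \<odot>\<^bsub>M\<^esub> x"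
  "N' +>\<^bsub>subspace_of M N\<^esub> x = N' +>\<^bsub>M\<^esub> x"
  by (simp_all add: subspace_of_def a_r_coset_def')

lemma module_subspace_of:
  assumes "module rat_field M" "submodule N rat_field M"
  shows "module rat_field (subspace_of M N)"
  using submodule.submodule_is_module[OF assms(2,1)] by (simp add: subspace_of_def)

lemma submodule_subspace_of:
  assumes "module rat_field M" "submodule A rat_field M" "submodule N rat_field M" "N \<subseteq> A"
  shows "submodule N rat_field (subspace_of M A)"
  using submoduleD[OF assms(3)] assms(4)
  by (intro submodule_rat_fieldI module_subspace_of assms) auto

lemma linear_maps_into_subspace_of:
  assumes "h \<in> linear_maps M N" "\<And>x. x \<in> carrier M \<Longrightarrow> h x \<in> A"
  shows "h \<in> linear_maps M (subspace_of N A)"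
  by (intro linear_mapsI) (use linear_mapsD[OF assms(1)] assms(2) in \<open>auto simp: subset_iff\<close>)

lemma submodule_image:
  assumes "module rat_field M" "module rat_field N" "h \<in> linear_maps M N"
  shows "submodule (h ` carrier M) rat_field N"
proof -
  interpret M: module rat_field M by fact
  note h = linear_mapsD[OF assms(3)]
  show ?thesis
  proof (rule submodule_rat_fieldI[OF assms(2)])
    show "\<zero>\<^bsub>N\<^esub> \<in> h ` carrier M"
      using linear_maps_zero[OF assms] M.zero_closed by (metis imageI)
    fix a b c assume "a \<in> h ` carrier M" "b \<in> h ` carrier M"
    then obtain x y where "x \<in> carrier M" "y \<in> carrier M" "a = h x" "b = h y" by auto
    then show "a \<oplus>\<^bsub>N\<^esub> b \<in> h ` carrier M"
      using h(2) M.a_closed by (metis imageI)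
  next
    fix a c assume "a \<in> h ` carrier M"
    then obtain x where "x \<in> carrier M" "a = h x" by auto
    then show "c \<odot>\<^bsub>N\<^esub> a \<in> h ` carrier M"
      using h(3)[of x c] M.smult_closed[of c x] by (metis UNIV_I imageI rat_field_simps(1))
  qed (use h in auto)
qed

lemma submodule_kernel:
  assumes "module rat_field M" "module rat_field N" "h \<in> linear_maps M N"
  shows "submodule {x \<in> carrier M. h x = \<zero>\<^bsub>N\<^esub>} rat_field M"
proof -
  interpret M: module rat_field M by fact
  interpret N: module rat_field N by fact
  note h = linear_mapsD[OF assms(3)]
  show ?thesis
  proof (rule submodule_rat_fieldI[OF assms(1)])
    show "\<zero>\<^bsub>M\<^esub> \<in> {x \<in> carrier M. h x = \<zero>\<^bsub>N\<^esub>}"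
      using linear_maps_zero[OF assms] by simp
  next
    fix x c assume "x \<in> {x \<in> carrier M. h x = \<zero>\<^bsub>N\<^esub>}"
    then show "c \<odot>\<^bsub>M\<^esub> x \<in> {x \<in> carrier M. h x = \<zero>\<^bsub>N\<^esub>}"
      using h(3)[of x c] M.smult_closed[of c x] N.smult_r_null[of c] by simp
  qed (auto simp: h)
qed

section \<open>Cosets and quotient spaces\<close>

context
  fixes M :: "'v qspace" and N :: "'v set"
  assumes M: "module rat_field M" and N: "submodule N rat_field M"
begin

interpretation M: module rat_field M by (rule M)

interpretation N: abelian_subgroup N M
  using submodule.axioms(1)[OF N] M.abelian_group_axioms by (intro abelian_subgroupI3) (auto simp: additive_subgroup_def)

lemma coset_eq_iff:
  assumes "x \<in> carrier M" "y \<in> carrier M"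
  shows "N +>\<^bsub>M\<^esub> x = N +>\<^bsub>M\<^esub> y \<longleftrightarrow> x \<ominus>\<^bsub>M\<^esub> y \<in> N"
proof -
  have "N +>\<^bsub>M\<^esub> x = N +>\<^bsub>M\<^esub> y \<longleftrightarrow> x \<in> N +>\<^bsub>M\<^esub> y"
    using assms N.a_rcos_self[of x] M.a_repr_independence[of x N y] N.a_subgroup by auto
  then show ?thesis
    using N.a_rcos_module[of y x] assms by (simp add: a_minus_def)
qed

lemma coset_eq_subspace_iff:
  assumes "x \<in> carrier M"
  shows "N +>\<^bsub>M\<^esub> x = N \<longleftrightarrow> x \<in> N"
  using assms N.a_rcos_self M.a_coset_join2 N.a_subgroup by metis

lemma coset_self: "x \<in> carrier M \<Longrightarrow> x \<in> N +>\<^bsub>M\<^esub> x"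
  using N.a_rcos_self .

lemma coset_eqI: "y \<in> N +>\<^bsub>M\<^esub> x \<Longrightarrow> x \<in> carrier M \<Longrightarrow> N +>\<^bsub>M\<^esub> y = N +>\<^bsub>M\<^esub> x"
  using M.a_repr_independence N.a_subgroup by metis

text \<open>Scalar multiplication of cosets is given as a union over all representatives. Two
  representatives differ by an element of \<open>N\<close>, whose multiples stay in
  \<open>N\<close>, so all members of that union are the same coset.\<close>

lemma quot_space_simps:
  "carrier (quot_space M N) = (\<lambda>x. N +>\<^bsub>M\<^esub> x) ` carrier M"
  "\<zero>\<^bsub>quot_space M N\<^esub> = N"
  "\<And>x y. x \<in> carrier M \<Longrightarrow> y \<in> carrier M \<Longrightarrow>
     (N +>\<^bsub>M\<^esub> x) \<oplus>\<^bsub>quot_space M N\<^esub> (N +>\<^bsub>M\<^esub> y) = N +>\<^bsub>M\<^esub> (x \<oplus>\<^bsub>M\<^esub> y)"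
  "\<And>c x. x \<in> carrier M \<Longrightarrow>
     c \<odot>\<^bsub>quot_space M N\<^esub> (N +>\<^bsub>M\<^esub> x) = N +>\<^bsub>M\<^esub> (c \<odot>\<^bsub>M\<^esub> x)"
proof -
  fix c x assume x: "x \<in> carrier M"
  have "N +>\<^bsub>M\<^esub> (c \<odot>\<^bsub>M\<^esub> y) = N +>\<^bsub>M\<^esub> (c \<odot>\<^bsub>M\<^esub> x)" if y: "y \<in> N +>\<^bsub>M\<^esub> x" for y
  proof -
    obtain n where n: "n \<in> N" "y = n \<oplus>\<^bsub>M\<^esub> x"
      using y by (auto simp: a_r_coset_def')
    then have [simp]: "n \<in> carrier M" by auto
    have cn: "c \<odot>\<^bsub>M\<^esub> n \<in> N" using n submoduleD(4)[OF N] by simp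
    have "c \<odot>\<^bsub>M\<^esub> y = c \<odot>\<^bsub>M\<^esub> n \<oplus>\<^bsub>M\<^esub> c \<odot>\<^bsub>M\<^esub> x"
      using M.smult_r_distr[of c n x] x n by simp
    then have "c \<odot>\<^bsub>M\<^esub> y \<in> N +>\<^bsub>M\<^esub> (c \<odot>\<^bsub>M\<^esub> x)"
      using cn by (auto simp: a_r_coset_def')
    then show ?thesis
      by (rule coset_eqI) (use x M.smult_closed[of c x] in simp)
  qed
  then have "(\<Union>y\<in>N +>\<^bsub>M\<^esub> x. N +>\<^bsub>M\<^esub> (c \<odot>\<^bsub>M\<^esub> y)) = N +>\<^bsub>M\<^esub> (c \<odot>\<^bsub>M\<^esub> x)"
    using coset_self[OF x] by blast
  then show "c \<odot>\<^bsub>quot_space M N\<^esub> (N +>\<^bsub>M\<^esub> x) = N +>\<^bsub>M\<^esub> (c \<odot>\<^bsub>M\<^esub> x)"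
    by (simp only: quot_space_def module.simps)
qed (auto simp: quot_space_def A_RCOSETS_def' N.a_rcos_sum)

lemma coset_linear: "(\<lambda>x. N +>\<^bsub>M\<^esub> x) \<in> linear_maps M (quot_space M N)"
  by (intro linear_mapsI) (auto simp: quot_space_simps)

lemma module_quot_space: "module rat_field (quot_space M N)"
proof (rule moduleI[OF cring_rat_field])
  note q = quot_space_simps
  have z: "N = N +>\<^bsub>M\<^esub> \<zero>\<^bsub>M\<^esub>"
    using coset_eq_subspace_iff[of "\<zero>\<^bsub>M\<^esub>"] submoduleD(2)[OF N] by simp
  have sc: "c \<odot>\<^bsub>M\<^esub> x \<in> carrier M" if "x \<in> carrier M" for c x
    using M.smult_closed[of c x] that by simp
  show "abelian_group (quot_space M N)"
  proof (rule abelian_groupI)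
    fix X assume "X \<in> carrier (quot_space M N)"
    then obtain x where x: "x \<in> carrier M" "X = N +>\<^bsub>M\<^esub> x" by (auto simp: q)
    show "\<zero>\<^bsub>quot_space M N\<^esub> \<oplus>\<^bsub>quot_space M N\<^esub> X = X"
      using x q(3)[of "\<zero>\<^bsub>M\<^esub>" x] z by (simp add: q)
    have "(N +>\<^bsub>M\<^esub> (\<ominus>\<^bsub>M\<^esub> x)) \<oplus>\<^bsub>quot_space M N\<^esub> X = \<zero>\<^bsub>quot_space M N\<^esub>"
      using x q(3)[of "\<ominus>\<^bsub>M\<^esub> x" x] z by (simp add: q M.l_neg)
    then show "\<exists>Y\<in>carrier (quot_space M N). Y \<oplus>\<^bsub>quot_space M N\<^esub> X = \<zero>\<^bsub>quot_space M N\<^esub>"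
      using x by (auto simp: q)
  next
    show "\<zero>\<^bsub>quot_space M N\<^esub> \<in> carrier (quot_space M N)"
      using z by (auto simp: q)
  qed (auto simp: q M.a_ac)
qed (use M.smult_one M.smult_l_distr M.smult_r_distr M.smult_assoc1 M.smult_closed in \<open>auto simp: quot_space_simps\<close>)

end

text \<open>The kernel is supplied as a membership criterion, and that \<open>K\<close> is a
  subspace is a consequence of it. Page turning, convergence and the identification of the first
  page all reduce to this form: a map on chains, its surjectivity, and a description of the chains
  that it kills.\<close>

lemma first_isomorphism:
  assumes M: "module rat_field M" and Q: "module rat_field Q" and h: "h \<in> linear_maps M Q"
    and onto: "carrier Q \<subseteq> h ` carrier M"
    and ker: "\<And>x. x \<in> carrier M \<Longrightarrow> h x = \<zero>\<^bsub>Q\<^esub> \<longleftrightarrow> x \<in> K"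
    and K: "K \<subseteq> carrier M"
  shows "isomorphic_spaces (quot_space M K) Q"
proof -
  interpret M: module rat_field M by fact
  interpret Q: module rat_field Q by fact
  note hD = linear_mapsD[OF h]
  have K': "K = {x \<in> carrier M. h x = \<zero>\<^bsub>Q\<^esub>}" using ker K by auto
  have sub: "submodule K rat_field M"
    unfolding K' by (rule submodule_kernel[OF M Q h])
  note q = quot_space_simps[OF M sub]
  have hm: "h (x \<ominus>\<^bsub>M\<^esub> y) = h x \<ominus>\<^bsub>Q\<^esub> h y" if "x \<in> carrier M" "y \<in> carrier M" for x y
    using that hD M.smult_closed[of "-1" y]
    by (simp add: a_minus_def a_inv_eq_smult[OF M] a_inv_eq_smult[OF Q])
  have eq: "K +>\<^bsub>M\<^esub> x = K +>\<^bsub>M\<^esub> y \<longleftrightarrow> h x = h y" if "x \<in> carrier M" "y \<in> carrier M" for x y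
    using that coset_eq_iff[OF M sub that] ker[of "x \<ominus>\<^bsub>M\<^esub> y"] hm hD(1) Q.add.inv_solve_right[of "\<zero>\<^bsub>Q\<^esub>" "h x" "h y"]
    by (auto simp: a_minus_def)
  \<comment> \<open>A representative is chosen arbitrarily; \<open>eq\<close> makes the value
    independent of the choice.\<close>
  define H where "H X = h (SOME x. x \<in> carrier M \<and> X = K +>\<^bsub>M\<^esub> x)" for X
  have H: "H (K +>\<^bsub>M\<^esub> x) = h x" if "x \<in> carrier M" for x
  proof -
    have "\<exists>y. y \<in> carrier M \<and> K +>\<^bsub>M\<^esub> x = K +>\<^bsub>M\<^esub> y" using that by auto
    from someI_ex[OF this] show ?thesis unfolding H_def using eq that by metis
  qed
  have "H \<in> linear_maps (quot_space M K) Q"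
    using M.smult_closed by (intro linear_mapsI) (auto simp: q H hD)
  moreover have "bij_betw H (carrier (quot_space M K)) (carrier Q)"
    unfolding bij_betw_def
  proof
    show "inj_on H (carrier (quot_space M K))"
      by (auto simp: inj_on_def q H eq)
    show "H ` carrier (quot_space M K) = carrier Q"
      using onto hD by (auto simp: q H image_iff subset_iff)
  qed
  ultimately show ?thesis by (auto simp: isomorphic_spaces_def)
qed

text \<open>The union over representatives is the shape in which both \<open>gr_boundary\<close> and
  the page differential \<open>d\<close> are defined, so their values and their linearity are read
  off from here.\<close>

lemma induced_map:
  assumes M: "module rat_field M" and N: "submodule N rat_field M"
    and M': "module rat_field M'" and N': "submodule N' rat_field M'"
    and h: "h \<in> linear_maps M M'" and hN: "\<And>x. x \<in> N \<Longrightarrow> h x \<in> N'"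
  defines "H \<equiv> \<lambda>X. \<Union>x\<in>X. N' +>\<^bsub>M'\<^esub> h x"
  shows "\<And>x. x \<in> carrier M \<Longrightarrow> H (N +>\<^bsub>M\<^esub> x) = N' +>\<^bsub>M'\<^esub> h x"
    and "H \<in> linear_maps (quot_space M N) (quot_space M' N')"
proof -
  interpret M: module rat_field M by fact
  note hD = linear_mapsD[OF h]
  show *: "H (N +>\<^bsub>M\<^esub> x) = N' +>\<^bsub>M'\<^esub> h x" if x: "x \<in> carrier M" for x
  proof -
    have "N' +>\<^bsub>M'\<^esub> h y = N' +>\<^bsub>M'\<^esub> h x" if y: "y \<in> N +>\<^bsub>M\<^esub> x" for y
    proof -
      obtain n where n: "n \<in> N" "y = n \<oplus>\<^bsub>M\<^esub> x"
        using y by (auto simp: a_r_coset_def')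
      then have "h y = h n \<oplus>\<^bsub>M'\<^esub> h x"
        using hD(2) x submoduleD(1)[OF N] by simp
      then have "h y \<in> N' +>\<^bsub>M'\<^esub> h x"
        using hN n by (auto simp: a_r_coset_def')
      then show ?thesis
        by (rule coset_eqI[OF M' N']) (use hD x in simp)
    qed
    then show ?thesis
      using coset_self[OF M N x] unfolding H_def by blast
  qed
  show "H \<in> linear_maps (quot_space M N) (quot_space M' N')"
    using M.smult_closed
    by (intro linear_mapsI) (auto simp: quot_space_simps[OF M N] quot_space_simps[OF M' N'] * hD)
qed

section \<open>The spectral sequence of a filtered complex\<close>

text \<open>Addition and zero of chains are the pointwise operations on functions;
  \<open>scale\<close> names the remaining pointwise operation, so that identities of chains can be
  proved by algebra outside the module record.\<close>

definition scale :: "rat \<Rightarrow> ('x \<Rightarrow> rat) \<Rightarrow> 'x \<Rightarrow> rat" where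
  "scale c f = (\<lambda>x. c * f x)"

lemma free_space_simps [simp]:
  "f \<oplus>\<^bsub>free_space X\<^esub> g = f + g" "\<zero>\<^bsub>free_space X\<^esub> = 0" "c \<odot>\<^bsub>free_space X\<^esub> f = scale c f"
  by (simp_all add: free_space_def plus_fun_def zero_fun_def scale_def)

lemma carrier_free_space:
  "finite X \<Longrightarrow> f \<in> carrier (free_space X) \<longleftrightarrow> (\<forall>x. x \<notin> X \<longrightarrow> f x = 0)"
  by (auto simp: free_space_def intro: finite_subset)

lemma module_free_space: "module rat_field (free_space X)"
proof (rule moduleI[OF cring_rat_field])
  have sum: "{x. f x + g x \<noteq> 0} \<subseteq> {x. f x \<noteq> 0} \<union> {x. g x \<noteq> 0}" for f g :: "'a \<Rightarrow> rat"
    by auto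
  have sc: "{x. c * f x \<noteq> 0} \<subseteq> {x. f x \<noteq> 0}" for f :: "'a \<Rightarrow> rat" and c
    by auto
  have scale: "scale c f \<in> carrier (free_space X)" if "f \<in> carrier (free_space X)" for c f
    using that finite_subset[OF sc[of c f]] by (auto simp: free_space_def scale_def)
  then show "c \<odot>\<^bsub>free_space X\<^esub> f \<in> carrier (free_space X)" if "f \<in> carrier (free_space X)" for c f
    using that by simp
  show "abelian_group (free_space X)"
  proof (rule abelian_groupI)
    fix f assume "f \<in> carrier (free_space X)"
    then have "scale (-1) f \<in> carrier (free_space X)" by (rule scale)
    moreover have "scale (-1) f + f = 0" by (auto simp: scale_def fun_eq_iff)
    ultimately show "\<exists>g\<in>carrier (free_space X). g \<oplus>\<^bsub>free_space X\<^esub> f = \<zero>\<^bsub>free_space X\<^esub>"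
      by auto
  next
    fix f g assume "f \<in> carrier (free_space X)" "g \<in> carrier (free_space X)"
    then show "f \<oplus>\<^bsub>free_space X\<^esub> g \<in> carrier (free_space X)"
      using finite_subset[OF sum[of f g]] sum[of f g] unfolding free_space_def plus_fun_def by simp blast
  next
    show "\<zero>\<^bsub>free_space X\<^esub> \<in> carrier (free_space X)" by (simp add: free_space_def)
  qed (auto simp: ac_simps)
qed (auto simp: scale_def fun_eq_iff algebra_simps)

lemma submodule_free_spaceI:
  assumes "H \<subseteq> carrier (free_space X)" "0 \<in> H" "\<And>f g. f \<in> H \<Longrightarrow> g \<in> H \<Longrightarrow> f + g \<in> H"
    "\<And>c f. f \<in> H \<Longrightarrow> scale c f \<in> H"
  shows "submodule H rat_field (free_space X)"
  using assms by (intro submodule_rat_fieldI module_free_space) auto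

lemma submodule_free_spaceD:
  assumes "submodule H rat_field (free_space X)"
  shows "\<And>f. f \<in> H \<Longrightarrow> f \<in> carrier (free_space X)" "0 \<in> H"
    "\<And>f g. f \<in> H \<Longrightarrow> g \<in> H \<Longrightarrow> f + g \<in> H" "\<And>c f. f \<in> H \<Longrightarrow> scale c f \<in> H"
    "\<And>f g. f \<in> H \<Longrightarrow> g \<in> H \<Longrightarrow> f - g \<in> H" "\<And>f. f \<in> H \<Longrightarrow> - f \<in> H"
proof -
  note H = submoduleD[OF assms, simplified]
  show m: "- f \<in> H" if "f \<in> H" for f
  proof -
    have "scale (-1) f = - f" by (auto simp: scale_def fun_eq_iff)
    then show ?thesis using H(4)[OF that, of "-1"] by simp
  qed
  show "f - g \<in> H" if "f \<in> H" "g \<in> H" for f g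
    using H(3)[OF that(1) m[OF that(2)]] by simp
qed (fact submoduleD[OF assms, simplified] | rule submoduleD[OF assms, simplified], assumption+)+

lemma submodule_carrier_free_space:
  "X \<subseteq> Y \<Longrightarrow> submodule (carrier (free_space X)) rat_field (free_space Y)"
proof (rule submodule_free_spaceI)
  note H = submodule_free_spaceD[OF module.carrier_is_submodule[OF module_free_space[of X]]]
  show "0 \<in> carrier (free_space X)" by (rule H(2))
  show "f + g \<in> carrier (free_space X)" if "f \<in> carrier (free_space X)" "g \<in> carrier (free_space X)" for f g
    using that by (rule H(3))
  show "scale k f \<in> carrier (free_space X)" if "f \<in> carrier (free_space X)" for k f
    using that by (rule H(4))
qed (auto simp: free_space_def)

lemma minus_free_subspace:
  assumes "submodule A rat_field (free_space X)" "f \<in> A" "g \<in> A"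
  shows "f \<ominus>\<^bsub>subspace_of (free_space X) A\<^esub> g = f - g"
proof -
  have "module rat_field (subspace_of (free_space X) A)"
    by (rule module_subspace_of[OF module_free_space assms(1)])
  then show ?thesis
    using assms(2,3) by (auto simp: a_minus_def a_inv_eq_smult scale_def fun_eq_iff)
qed

section \<open>Matrices over a finite set of generators\<close>

text \<open>The first index is the source: \<open>c x y\<close> is the coefficient of
  \<open>y\<close> in the image of \<open>x\<close>. The operator acts on all functions, so
  linearity holds without carrier conditions.\<close>

definition apply_matrix :: "'x set \<Rightarrow> ('x \<Rightarrow> 'x \<Rightarrow> rat) \<Rightarrow> ('x \<Rightarrow> rat) \<Rightarrow> 'x \<Rightarrow> rat" where
  "apply_matrix X c f = (\<lambda>y. if y \<in> X then \<Sum>x\<in>X. c x y * f x else 0)"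

lemma apply_matrix_linear:
  "apply_matrix X c (f + g) = apply_matrix X c f + apply_matrix X c g"
  "apply_matrix X c (scale r f) = scale r (apply_matrix X c f)"
  "apply_matrix X c (f - g) = apply_matrix X c f - apply_matrix X c g"
  "apply_matrix X c 0 = 0"
  by (auto simp: apply_matrix_def scale_def fun_eq_iff algebra_simps sum.distrib sum_subtractf sum_distrib_left)

text \<open>When no nonzero entry raises \<open>g\<close>, this submatrix is the differential of the
  associated graded complex, written on the original generators instead of on cosets.\<close>

definition preserving :: "('x \<Rightarrow> 'j) \<Rightarrow> ('x \<Rightarrow> 'x \<Rightarrow> rat) \<Rightarrow> 'x \<Rightarrow> 'x \<Rightarrow> rat" where
  "preserving g c x y = (if g x = g y then c x y else 0)"

text \<open>With \<open>X\<close> the generators of degree exactly \<open>a\<close>, this takes the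
  leading part of a chain of filtration degree \<open>a\<close>.\<close>

definition restrict_chain :: "'x set \<Rightarrow> ('x \<Rightarrow> rat) \<Rightarrow> 'x \<Rightarrow> rat" where
  "restrict_chain X f = (\<lambda>x. if x \<in> X then f x else 0)"

lemma restrict_chain_linear:
  "restrict_chain X (f + g) = restrict_chain X f + restrict_chain X g"
  "restrict_chain X (scale r f) = scale r (restrict_chain X f)"
  "restrict_chain X (f - g) = restrict_chain X f - restrict_chain X g"
  "restrict_chain X 0 = 0"
  by (auto simp: restrict_chain_def scale_def fun_eq_iff)

text \<open>A based complex given by matrix entries. The second index of \<open>st\<close> is the
  quantum degree, which the differential keeps, so each value of \<open>q\<close> carries its own
  complex.\<close>

locale graded_complex =
  fixes Om :: "'x set" and st :: "int \<Rightarrow> int \<Rightarrow> 'x set" and c :: "'x \<Rightarrow> 'x \<Rightarrow> rat"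
  assumes finite_Om: "finite Om"
    and st_subset: "st i q \<subseteq> Om"
    and degree: "x \<in> st i q \<Longrightarrow> y \<in> Om \<Longrightarrow> c x y \<noteq> 0 \<Longrightarrow> y \<in> st (i + 1) q"
    and square: "x \<in> Om \<Longrightarrow> y \<in> Om \<Longrightarrow> (\<Sum>m\<in>Om. c x m * c m y) = 0"
begin

abbreviation bd :: "('x \<Rightarrow> rat) \<Rightarrow> 'x \<Rightarrow> rat" where
  "bd \<equiv> apply_matrix Om c"

lemma finite_st: "finite (st i q)" using finite_subset[OF st_subset finite_Om] .

lemmas carrier_st = carrier_free_space[OF finite_st]

lemma bd_carrier:
  assumes "f \<in> carrier (free_space (st i q))"
  shows "bd f \<in> carrier (free_space (st (i + 1) q))"
  unfolding carrier_st
proof (intro allI impI)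
  fix y assume y: "y \<notin> st (i + 1) q"
  have "c x y * f x = 0" if "y \<in> Om" for x
    using assms y degree that by (cases "x \<in> st i q") (auto simp: carrier_st)
  then show "bd f y = 0" by (auto simp: apply_matrix_def intro!: sum.neutral)
qed

lemma bd_bd: "bd (bd f) = 0"
proof
  fix y
  have "(\<Sum>m\<in>Om. c m y * (\<Sum>x\<in>Om. c x m * f x)) = (\<Sum>x\<in>Om. (\<Sum>m\<in>Om. c x m * c m y) * f x)"
    by (simp add: sum_distrib_left sum_distrib_right, subst sum.swap) (simp add: mult_ac)
  then show "bd (bd f) y = 0 y"
    using square by (auto simp: apply_matrix_def)
qed

lemma bd_linear: "bd \<in> linear_maps (free_space (st i q)) (free_space (st (i + 1) q))"
  by (intro linear_mapsI) (auto simp: bd_carrier apply_matrix_linear)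

end

section \<open>Pages of a filtered complex\<close>

locale filtered_complex = graded_complex Om st c
  for Om :: "'x set" and st :: "int \<Rightarrow> int \<Rightarrow> 'x set" and c :: "'x \<Rightarrow> 'x \<Rightarrow> rat" +
  fixes e :: "'x \<Rightarrow> int"
  assumes filtered: "x \<in> Om \<Longrightarrow> y \<in> Om \<Longrightarrow> c x y \<noteq> 0 \<Longrightarrow> e y \<le> e x"
begin

definition F :: "int \<Rightarrow> int \<Rightarrow> int \<Rightarrow> ('x \<Rightarrow> rat) set" where
  "F a i q = carrier (free_space {x \<in> st i q. e x \<le> a})"

lemma F_iff: "f \<in> F a i q \<longleftrightarrow> (\<forall>x. f x \<noteq> 0 \<longrightarrow> x \<in> st i q \<and> e x \<le> a)"
  using finite_st[of i q] by (auto simp: F_def carrier_free_space)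

lemma F_submodule: "submodule (F a i q) rat_field (free_space (st i q))"
  unfolding F_def by (rule submodule_carrier_free_space) auto

lemmas F_D = submodule_free_spaceD[OF F_submodule]

lemma F_mono: "a \<le> b \<Longrightarrow> f \<in> F a i q \<Longrightarrow> f \<in> F b i q"
  by (fastforce simp: F_iff)

lemma bd_F:
  assumes "f \<in> F a i q"
  shows "bd f \<in> F a (i + 1) q"
  unfolding F_iff
proof (intro allI impI)
  fix y assume y: "bd f y \<noteq> 0"
  then have "(\<Sum>x\<in>Om. c x y * f x) \<noteq> 0" "y \<in> Om" by (auto simp: apply_matrix_def split: if_splits)
  then obtain x where "x \<in> Om" "c x y \<noteq> 0" "f x \<noteq> 0"
    by (metis (mono_tags, lifting) mult_zero_left mult_zero_right sum.neutral)
  then show "y \<in> st (i + 1) q \<and> e y \<le> a"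
    using assms degree filtered \<open>y \<in> Om\<close> by (fastforce simp: F_iff)
qed

text \<open>Approximate cycles: the boundary drops by at least \<open>r\<close> filtration steps.
  For \<open>r = 0\<close> this is all of \<open>F a i q\<close>; for large \<open>r\<close> only
  honest cycles remain, since the basis is finite.\<close>

definition Z :: "nat \<Rightarrow> int \<Rightarrow> int \<Rightarrow> int \<Rightarrow> ('x \<Rightarrow> rat) set" where
  "Z r a i q = {f \<in> F a i q. bd f \<in> F (a - int r) (i + 1) q}"

text \<open>The classical denominator: chains of lower filtration, together with boundaries of
  chains that start up to \<open>r - 1\<close> steps higher. The truncated difference has its
  intended meaning for \<open>r \<ge> 1\<close>, where the pages are considered.\<close>

definition B :: "nat \<Rightarrow> int \<Rightarrow> int \<Rightarrow> int \<Rightarrow> ('x \<Rightarrow> rat) set" where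
  "B r a i q = {u + bd w | u w. u \<in> Z (r - 1) (a - 1) i q \<and> w \<in> Z (r - 1) (a + int r - 1) (i - 1) q}"

definition E :: "nat \<Rightarrow> int \<Rightarrow> int \<Rightarrow> int \<Rightarrow> ('x \<Rightarrow> rat) set qspace" where
  "E r a i q = quot_space (subspace_of (free_space (st i q)) (Z r a i q)) (B r a i q)"

definition d :: "nat \<Rightarrow> int \<Rightarrow> int \<Rightarrow> int \<Rightarrow> ('x \<Rightarrow> rat) set \<Rightarrow> ('x \<Rightarrow> rat) set" where
  "d r a i q X = (\<Union>f\<in>X. B r (a - int r) (i + 1) q +>\<^bsub>subspace_of (free_space (st (i + 1) q)) (Z r (a - int r) (i + 1) q)\<^esub> bd f)"

lemma Z_submodule: "submodule (Z r a i q) rat_field (free_space (st i q))"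
  by (rule submodule_free_spaceI) (auto simp: Z_def F_D apply_matrix_linear)

lemmas Z_D = submodule_free_spaceD[OF Z_submodule]

lemma Z_0: "Z 0 a i q = F a i q"
  by (auto simp: Z_def bd_F)

text \<open>A boundary is a cycle, which is why the target index \<open>r'\<close> is free.\<close>

lemma bd_Z: "f \<in> Z r a i q \<Longrightarrow> bd f \<in> Z r' (a - int r) (i + 1) q"
  by (auto simp: Z_def bd_bd F_D)

lemma bd_Z': "f \<in> Z r (a + int r) (i - 1) q \<Longrightarrow> bd f \<in> Z r' a i q"
  using bd_Z[of f r "a + int r" "i - 1" q r'] by simp

lemma Z_mono: "f \<in> Z r a i q \<Longrightarrow> a \<le> b \<Longrightarrow> a - int r \<le> b - int s \<Longrightarrow> f \<in> Z s b i q"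
  unfolding Z_def using F_mono by blast

text \<open>Index arithmetic for the two summands: \<open>a - 1 - (r - 1) = a - r\<close> for the
  boundary of the lower chain, and \<open>a + r - 1 - (r - 1) = a\<close> for the filtration degree
  of \<open>bd w\<close>.\<close>

lemma B_subset_Z: "r \<ge> 1 \<Longrightarrow> B r a i q \<subseteq> Z r a i q"
proof
  fix f assume r: "r \<ge> 1" "f \<in> B r a i q"
  then obtain u w where "u \<in> Z (r - 1) (a - 1) i q" "w \<in> Z (r - 1) (a + int r - 1) (i - 1) q" "f = u + bd w"
    by (auto simp: B_def)
  moreover have "u \<in> Z r a i q" if "u \<in> Z (r - 1) (a - 1) i q" for u
    by (rule Z_mono[OF that]) (use r in auto)
  moreover have "bd w \<in> Z r a i q" if "w \<in> Z (r - 1) (a + int r - 1) (i - 1) q" for w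
    using bd_Z'[of w "r - 1" a i q r] that r by (simp add: of_nat_diff algebra_simps)
  ultimately show "f \<in> Z r a i q" using Z_D by auto
qed

lemma B_submodule:
  assumes "r \<ge> 1"
  shows "submodule (B r a i q) rat_field (free_space (st i q))"
proof (rule submodule_free_spaceI)
  show "B r a i q \<subseteq> carrier (free_space (st i q))"
    using B_subset_Z[OF assms] Z_D(1) by blast
  show "0 \<in> B r a i q"
    unfolding B_def using Z_D(2) apply_matrix_linear(4)[of Om c] by force
  fix f assume "f \<in> B r a i q"
  then obtain u w where f: "u \<in> Z (r - 1) (a - 1) i q" "w \<in> Z (r - 1) (a + int r - 1) (i - 1) q" "f = u + bd w"
    by (auto simp: B_def)
  have "scale k f = scale k u + bd (scale k w)" for k
    unfolding f(3) apply_matrix_linear by (auto simp: scale_def algebra_simps)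
  then show "scale k f \<in> B r a i q" for k
    unfolding B_def using f(1,2) Z_D(4) by blast
  fix g assume "g \<in> B r a i q"
  then obtain u' w' where g: "u' \<in> Z (r - 1) (a - 1) i q" "w' \<in> Z (r - 1) (a + int r - 1) (i - 1) q" "g = u' + bd w'"
    by (auto simp: B_def)
  have "f + g = (u + u') + bd (w + w')"
    unfolding f(3) g(3) apply_matrix_linear by (simp add: algebra_simps)
  then show "f + g \<in> B r a i q"
    unfolding B_def using f(1,2) g(1,2) Z_D(3) by blast
qed

abbreviation ZZ where "ZZ r a i q \<equiv> subspace_of (free_space (st i q)) (Z r a i q)"

lemma ZZ_module: "module rat_field (ZZ r a i q)"
  by (rule module_subspace_of[OF module_free_space Z_submodule])

lemma B_submodule_ZZ: "r \<ge> 1 \<Longrightarrow> submodule (B r a i q) rat_field (ZZ r a i q)"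
  by (rule submodule_subspace_of[OF module_free_space Z_submodule B_submodule B_subset_Z])

lemmas B_D = submodule_free_spaceD[OF B_submodule]

lemma E_module: "r \<ge> 1 \<Longrightarrow> module rat_field (E r a i q)"
  unfolding E_def by (rule module_quot_space[OF ZZ_module B_submodule_ZZ])

definition cls :: "nat \<Rightarrow> int \<Rightarrow> int \<Rightarrow> int \<Rightarrow> ('x \<Rightarrow> rat) \<Rightarrow> ('x \<Rightarrow> rat) set" where
  "cls r a i q f = B r a i q +>\<^bsub>ZZ r a i q\<^esub> f"

context
  fixes r :: nat assumes r: "r \<ge> 1"
begin

lemma carrier_E: "carrier (E r a i q) = cls r a i q ` Z r a i q"
  unfolding E_def cls_def quot_space_simps(1)[OF ZZ_module B_submodule_ZZ[OF r]] by simp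

lemma zero_E: "\<zero>\<^bsub>E r a i q\<^esub> = B r a i q"
  unfolding E_def quot_space_simps(2)[OF ZZ_module B_submodule_ZZ[OF r]] by simp

lemma cls_linear: "cls r a i q \<in> linear_maps (ZZ r a i q) (E r a i q)"
  unfolding E_def cls_def by (rule coset_linear[OF ZZ_module B_submodule_ZZ[OF r]])

lemma cls_zero_iff: "f \<in> Z r a i q \<Longrightarrow> cls r a i q f = \<zero>\<^bsub>E r a i q\<^esub> \<longleftrightarrow> f \<in> B r a i q"
  unfolding cls_def zero_E using coset_eq_subspace_iff[OF ZZ_module B_submodule_ZZ[OF r, of a i q], of f] by simp

lemma cls_eq_iff: "f \<in> Z r a i q \<Longrightarrow> g \<in> Z r a i q \<Longrightarrow> cls r a i q f = cls r a i q g \<longleftrightarrow> f - g \<in> B r a i q"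
  unfolding cls_def
  using coset_eq_iff[OF ZZ_module B_submodule_ZZ[OF r, of a i q], of f g] minus_free_subspace[OF Z_submodule] by simp

lemma bd_linear_ZZ: "bd \<in> linear_maps (ZZ r a i q) (ZZ r (a - int r) (i + 1) q)"
  by (rule linear_mapsI) (auto simp: apply_matrix_linear bd_Z)

text \<open>Applying the differential to \<open>u + bd w\<close> leaves \<open>bd u\<close>, and the
  index of \<open>u\<close> is exactly the one required in the second summand of the target
  denominator.\<close>

lemma bd_B: "f \<in> B r a i q \<Longrightarrow> bd f \<in> B r (a - int r) (i + 1) q"
proof -
  assume "f \<in> B r a i q"
  then obtain u w where f: "u \<in> Z (r - 1) (a - 1) i q" "w \<in> Z (r - 1) (a + int r - 1) (i - 1) q" "f = u + bd w"
    by (auto simp: B_def)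
  then have "bd f = 0 + bd u"
    by (simp add: apply_matrix_linear bd_bd)
  moreover have "u \<in> Z (r - 1) (a - int r + int r - 1) (i + 1 - 1) q"
    using f by simp
  ultimately show ?thesis
    unfolding B_def using Z_D(2) by blast
qed

lemma d_cls: "f \<in> Z r a i q \<Longrightarrow> d r a i q (cls r a i q f) = cls r (a - int r) (i + 1) q (bd f)"
  unfolding d_def cls_def
  using induced_map(1)[OF ZZ_module B_submodule_ZZ[OF r] ZZ_module B_submodule_ZZ[OF r] bd_linear_ZZ[of i q a] bd_B, of f]
  by simp

lemma d_linear: "d r a i q \<in> linear_maps (E r a i q) (E r (a - int r) (i + 1) q)"
  using induced_map(2)[OF ZZ_module B_submodule_ZZ[OF r] ZZ_module B_submodule_ZZ[OF r] bd_linear_ZZ[of i q a] bd_B]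
  unfolding d_def E_def by simp

lemma d_d:
  assumes "X \<in> carrier (E r a i q)"
  shows "d r (a - int r) (i + 1) q (d r a i q X) = \<zero>\<^bsub>E r (a - 2 * int r) (i + 2) q\<^esub>"
proof -
  obtain f where f: "f \<in> Z r a i q" "X = cls r a i q f"
    using assms carrier_E by auto
  have "d r (a - int r) (i + 1) q (d r a i q X) = cls r (a - int r - int r) (i + 1 + 1) q 0"
    using f d_cls bd_Z[of f r a i q r] bd_bd by simp
  also have "\<dots> = \<zero>\<^bsub>E r (a - int r - int r) (i + 1 + 1) q\<^esub>"
    by (rule cls_zero_iff[THEN iffD2]) (auto simp: Z_D B_D[OF r])
  finally show ?thesis by (simp add: algebra_simps)
qed

lemma d_into: "g \<in> Z r (a + int r) (i - 1) q \<Longrightarrow>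
    d r (a + int r) (i - 1) q (cls r (a + int r) (i - 1) q g) = cls r a i q (bd g)"
  using d_cls[of g "a + int r" "i - 1" q] by simp

text \<open>A chain whose boundary drops by \<open>r + 1\<close> steps defines a class on page
  \<open>r\<close> killed by \<open>d r\<close>, and this assignment induces the isomorphism.
  Surjectivity corrects a representative by an element of \<open>B r\<close>. A chain of
  \<open>Z (Suc r)\<close> is killed when it lies in \<open>B r\<close> up to the boundary of a
  chain in \<open>Z r (a + r)\<close>, which is the same as lying in
  \<open>B (Suc r)\<close>.\<close>

lemma E_Suc:
  "isomorphic_spaces (E (Suc r) a i q)
     (homology_at (E r (a + int r) (i - 1) q) (d r (a + int r) (i - 1) q)
                  (E r a i q) (d r a i q) (E r (a - int r) (i + 1) q))"
proof -
  let ?E = "E r a i q"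
  let ?K = "{X \<in> carrier ?E. d r a i q X = \<zero>\<^bsub>E r (a - int r) (i + 1) q\<^esub>}"
  let ?I = "d r (a + int r) (i - 1) q ` carrier (E r (a + int r) (i - 1) q)"
  have d_in: "d r (a + int r) (i - 1) q \<in> linear_maps (E r (a + int r) (i - 1) q) ?E"
    using d_linear[of "a + int r" "i - 1" q] by simp
  have K: "submodule ?K rat_field ?E"
    by (rule submodule_kernel[OF E_module[OF r] E_module[OF r] d_linear])
  have I: "submodule ?I rat_field ?E"
    by (rule submodule_image[OF E_module[OF r] E_module[OF r] d_in])
  have IK: "?I \<subseteq> ?K"
  proof
    fix X assume "X \<in> ?I"
    then obtain g where g: "g \<in> Z r (a + int r) (i - 1) q" "X = cls r a i q (bd g)"
      using d_into by (auto simp: carrier_E)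
    have "bd g \<in> Z r a i q" using bd_Z'[OF g(1)] .
    moreover have "d r a i q X = cls r (a - int r) (i + 1) q 0"
      using g d_cls calculation bd_bd by simp
    moreover have "cls r (a - int r) (i + 1) q 0 = \<zero>\<^bsub>E r (a - int r) (i + 1) q\<^esub>"
      by (rule cls_zero_iff[THEN iffD2]) (auto simp: Z_D B_D[OF r])
    ultimately show "X \<in> ?K" using g carrier_E by auto
  qed
  let ?S = "subspace_of ?E ?K"
  have S: "module rat_field ?S" by (rule module_subspace_of[OF E_module[OF r] K])
  have I': "submodule ?I rat_field ?S"
    by (rule submodule_subspace_of[OF E_module[OF r] K I IK])
  note q = quot_space_simps[OF S I']
  let ?h = "\<lambda>f. ?I +>\<^bsub>?S\<^esub> cls r a i q f"
  have ZS: "f \<in> Z r a i q" if "f \<in> Z (Suc r) a i q" for f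
    using Z_mono[OF that] by simp
  have clsK: "cls r a i q f \<in> ?K" if f: "f \<in> Z (Suc r) a i q" for f
  proof -
    have b: "bd f \<in> Z r (a - int r) (i + 1) q" using bd_Z[OF ZS[OF f]] .
    \<comment> \<open>A drop by \<open>r + 1\<close> is one more than page \<open>r\<close> records,
      so \<open>bd f\<close> falls into the lower-filtration summand of \<open>B\<close>.\<close>
    have "bd f \<in> Z (r - 1) (a - int (Suc r)) (i + 1) q"
      using bd_Z[OF f] by simp
    then have "bd f \<in> Z (r - 1) (a - int r - 1) (i + 1) q" by (simp add: algebra_simps)
    then have "bd f \<in> B r (a - int r) (i + 1) q"
      unfolding B_def using Z_D(2) apply_matrix_linear(4)[of Om c] by force
    then show ?thesis
      using d_cls[OF ZS[OF f]] cls_zero_iff[OF b] ZS[OF f] carrier_E by auto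
  qed
  show ?thesis
    unfolding homology_at_def E_def[of "Suc r"]
  proof (rule first_isomorphism[OF ZZ_module module_quot_space[OF S I']])
    have "cls r a i q \<in> linear_maps (ZZ (Suc r) a i q) ?S"
      by (intro linear_mapsI) (use clsK ZS linear_mapsD[OF cls_linear[of a i q]] in auto)
    from linear_maps_comp[OF this coset_linear[OF S I']]
    show "?h \<in> linear_maps (ZZ (Suc r) a i q) (quot_space ?S ?I)" .
    show "carrier (quot_space ?S ?I) \<subseteq> ?h ` carrier (ZZ (Suc r) a i q)"
    proof
      fix Y assume "Y \<in> carrier (quot_space ?S ?I)"
      then obtain X where X: "X \<in> ?K" "Y = ?I +>\<^bsub>?S\<^esub> X" by (auto simp: q)
      then obtain f where f: "f \<in> Z r a i q" "X = cls r a i q f" by (auto simp: carrier_E)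
      have "bd f \<in> B r (a - int r) (i + 1) q"
        using X(1) f d_cls cls_zero_iff[OF bd_Z[OF f(1)]] by simp
      then obtain u w where uw: "u \<in> Z (r - 1) (a - int r - 1) (i + 1) q"
          "w \<in> Z (r - 1) (a - int r + int r - 1) (i + 1 - 1) q" "bd f = u + bd w"
        by (auto simp: B_def)
      then have w: "w \<in> Z (r - 1) (a - 1) i q" by simp
      \<comment> \<open>\<open>w\<close> lies in the lower-filtration summand of \<open>B r\<close>,
        so subtracting it keeps the class of \<open>f\<close> while removing \<open>bd w\<close>
        from its boundary.\<close>
      have wB: "w \<in> B r a i q"
        unfolding B_def using w Z_D(2) apply_matrix_linear(4)[of Om c] by force
      have wZ: "w \<in> Z r a i q" using wB B_subset_Z[OF r] by auto
      have "f - w \<in> Z (Suc r) a i q"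
      proof -
        have "f - w \<in> F a i q" using Z_D(5)[OF f(1) wZ] by (simp add: Z_def)
        moreover have "bd (f - w) = u" using uw(3) by (simp add: apply_matrix_linear)
        moreover have "u \<in> F (a - int (Suc r)) (i + 1) q"
          using uw(1) by (simp add: Z_def algebra_simps)
        ultimately show ?thesis by (simp add: Z_def)
      qed
      moreover have "cls r a i q (f - w) = X"
        using cls_eq_iff[OF Z_D(5)[OF f(1) wZ] f(1)] f(2) B_D(6)[OF r wB] by simp
      ultimately show "Y \<in> ?h ` carrier (ZZ (Suc r) a i q)"
        using X by force
    qed
    fix f assume "f \<in> carrier (ZZ (Suc r) a i q)"
    then have f: "f \<in> Z (Suc r) a i q" by simp
    have "?h f = \<zero>\<^bsub>quot_space ?S ?I\<^esub> \<longleftrightarrow> cls r a i q f \<in> ?I"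
      unfolding q(2) using coset_eq_subspace_iff[OF S I', of "cls r a i q f"] clsK[OF f] by simp
    also have "\<dots> \<longleftrightarrow> (\<exists>g\<in>Z r (a + int r) (i - 1) q. cls r a i q f = cls r a i q (bd g))"
      unfolding carrier_E image_image using d_into by (simp add: image_iff)
    also have "\<dots> \<longleftrightarrow> (\<exists>g\<in>Z r (a + int r) (i - 1) q. f - bd g \<in> B r a i q)"
      using cls_eq_iff[OF ZS[OF f]] bd_Z' by blast
    also have "\<dots> \<longleftrightarrow> f \<in> B (Suc r) a i q"
    proof
      assume "\<exists>g\<in>Z r (a + int r) (i - 1) q. f - bd g \<in> B r a i q"
      then obtain g u w where g: "g \<in> Z r (a + int r) (i - 1) q" and u: "u \<in> Z (r - 1) (a - 1) i q"
        and w: "w \<in> Z (r - 1) (a + int r - 1) (i - 1) q" and eq: "f - bd g = u + bd w"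
        by (auto simp: B_def)
      have w': "w \<in> Z r (a + int r) (i - 1) q"
        by (rule Z_mono[OF w]) (use r in auto)
      have eq': "f = u + bd (g + w)" using eq by (simp add: apply_matrix_linear algebra_simps)
      \<comment> \<open>The boundary of \<open>f\<close> has filtration degree
        \<open>a - r - 1\<close>, which is \<open>(a - 1) - r\<close>; having the same boundary,
        \<open>u\<close> gains the extra step that the next page asks for.\<close>
      then have "bd u = bd f" by (simp add: apply_matrix_linear bd_bd)
      then have "u \<in> Z r (a - 1) i q"
        using u f by (simp add: Z_def algebra_simps)
      then show "f \<in> B (Suc r) a i q"
        unfolding B_def using eq' Z_D(3)[OF g w'] by force
    next
      assume "f \<in> B (Suc r) a i q"
      then obtain u w where uw: "u \<in> Z r (a - 1) i q" "w \<in> Z r (a + int r) (i - 1) q" "f = u + bd w"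
        by (auto simp: B_def)
      have "u \<in> Z (r - 1) (a - 1) i q"
        by (rule Z_mono[OF uw(1)]) (use r in auto)
      then have "f - bd w \<in> B r a i q"
        unfolding B_def using uw(3) Z_D(2) apply_matrix_linear(4)[of Om c] by force
      then show "\<exists>g\<in>Z r (a + int r) (i - 1) q. f - bd g \<in> B r a i q"
        using uw(2) by blast
    qed
    finally show "?h f = \<zero>\<^bsub>quot_space ?S ?I\<^esub> \<longleftrightarrow> f \<in> B (Suc r) a i q" .
  qed (use B_subset_Z[of "Suc r"] in auto)
qed

end

theorem spectral_sequence_E: "spectral_sequence E d"
  unfolding spectral_sequence_def using E_module d_linear d_d E_Suc by blast

end

section \<open>Convergence to the homology of the filtered complex\<close>

context graded_complex
begin

definition cycles :: "int \<Rightarrow> int \<Rightarrow> ('x \<Rightarrow> rat) set" where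
  "cycles i q = {f \<in> carrier (free_space (st i q)). bd f = 0}"

lemma cycles_submodule: "submodule (cycles i q) rat_field (free_space (st i q))"
  using submodule_kernel[OF module_free_space module_free_space bd_linear[of i q]]
  by (simp add: cycles_def)

end

context filtered_complex
begin

text \<open>\<open>H\<close> is filtered by the images of the cycles in each filtration step. Since
  the basis is finite, \<open>e\<close> is bounded by some \<open>m\<close>; so for large
  \<open>r\<close> the numerator consists of cycles and the denominator contains every boundary of
  filtration degree \<open>a\<close>. The page is then the quotient of two consecutive
  steps.\<close>

lemma converges_to_homology:
  assumes H: "\<And>i q. module rat_field (H i q)"
    and Psi: "\<And>i q. Psi i q \<in> linear_maps (subspace_of (free_space (st i q)) (cycles i q)) (H i q)"
    and onto: "\<And>i q. carrier (H i q) \<subseteq> Psi i q ` cycles i q"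
    and ker: "\<And>i q f. f \<in> cycles i q \<Longrightarrow>
      Psi i q f = \<zero>\<^bsub>H i q\<^esub> \<longleftrightarrow> f \<in> bd ` carrier (free_space (st (i - 1) q))"
  shows "converges_to E d H"
proof -
  define FC where "FC a i q = cycles i q \<inter> F a i q" for a i q
  define Fil where "Fil a i q = Psi i q ` FC a i q" for a i q
  note cyc = submodule_free_spaceD[OF cycles_submodule]
  note PsiD = linear_mapsD[OF Psi, simplified]
  have FC: "submodule (FC a i q) rat_field (free_space (st i q))" for a i q
    by (rule submodule_free_spaceI) (auto simp: FC_def cyc F_D)
  have FCm: "module rat_field (subspace_of (free_space (st i q)) (FC a i q))" for a i q
    by (rule module_subspace_of[OF module_free_space FC])
  have PsiFC: "Psi i q \<in> linear_maps (subspace_of (free_space (st i q)) (FC a i q)) (H i q)" for a i q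
    by (rule linear_mapsI) (auto simp: PsiD FC_def)
  have cm: "module rat_field (subspace_of (free_space (st i q)) (cycles i q))" for i q
    by (rule module_subspace_of[OF module_free_space cycles_submodule])
  have Psi0: "Psi i q 0 = \<zero>\<^bsub>H i q\<^esub>" for i q
    using linear_maps_zero[OF cm H Psi] by simp
  have Psi_eq: "Psi i q f = Psi i q g \<longleftrightarrow> f - g \<in> bd ` carrier (free_space (st (i - 1) q))"
    if "f \<in> cycles i q" "g \<in> cycles i q" for f g i q
  proof -
    interpret H: module rat_field "H i q" by (rule H)
    have "Psi i q f = Psi i q (f - g) \<oplus>\<^bsub>H i q\<^esub> Psi i q g"
      using PsiD(2)[of "f - g" i q g] cyc that by simp
    then show ?thesis
      using ker[of "f - g" i q] cyc that PsiD(1) by auto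
  qed
  have Fil: "submodule (Fil a i q) rat_field (H i q)" for a i q
    using submodule_image[OF FCm H PsiFC] by (simp add: Fil_def)
  have Fil_mono: "Fil (a - 1) i q \<subseteq> Fil a i q" for a i q
    unfolding Fil_def FC_def using F_mono[of "a - 1" a] by auto
  obtain m where m: "\<bar>e x\<bar> \<le> m" if "x \<in> Om" for x
  proof -
    have "finite ((\<lambda>x. \<bar>e x\<bar>) ` Om)" using finite_Om by simp
    then show ?thesis using that Max_ge[of "(\<lambda>x. \<bar>e x\<bar>) ` Om"] by blast
  qed
  have F_low: "F a i q = {0}" if "a < - m" for a i q
  proof -
    have "f = 0" if "f \<in> F a i q" for f
      using that \<open>a < - m\<close> m st_subset[of i q] by (fastforce simp: F_iff fun_eq_iff)
    then show ?thesis using F_D(2) by auto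
  qed
  have F_high: "F a i q = carrier (free_space (st i q))" if "a \<ge> m" for a i q
  proof -
    have "e x \<le> a" if "x \<in> st i q" for x
      using m[of x] st_subset[of i q] that \<open>a \<ge> m\<close> by auto
    then have "{x \<in> st i q. e x \<le> a} = st i q" by auto
    then show ?thesis by (simp add: F_def)
  qed
  have "finite_filtration H Fil"
    unfolding finite_filtration_def
  proof (rule conjI[OF _ exI[of _ "- m", OF exI[of _ m]]]; intro allI conjI impI)
    show "Fil a i q \<subseteq> Fil (a + 1) i q" for a i q using Fil_mono[of "a + 1"] by simp
    show "Fil a i q = {\<zero>\<^bsub>H i q\<^esub>}" if "a < - m" for a i q
      using F_low[OF that] cyc(2) by (auto simp: Fil_def FC_def Psi0)
    show "Fil a i q = carrier (H i q)" if "m \<le> a" for a i q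
    proof -
      have "FC a i q = cycles i q" using F_high[OF that] cyc(1) by (auto simp: FC_def)
      then show ?thesis using onto[of i q] PsiD(1) by (auto simp: Fil_def)
    qed
  qed (use Fil in auto)
  moreover have "\<exists>R\<ge>1. \<forall>r\<ge>R.
         (\<forall>x\<in>carrier (E r a i q). d r a i q x = \<zero>\<^bsub>E r (a - int r) (i + 1) q\<^esub>) \<and>
         (\<forall>x\<in>carrier (E r (a + int r) (i - 1) q).
            d r (a + int r) (i - 1) q x = \<zero>\<^bsub>E r a i q\<^esub>) \<and>
         isomorphic_spaces (E r a i q)
           (quot_space (subspace_of (H i q) (Fil a i q)) (Fil (a - 1) i q))" for a i q
  \<comment> \<open>From this page on \<open>a - r\<close> is below \<open>- m\<close>, where the
    filtration is zero, and \<open>a + r - 1\<close> is at least \<open>m\<close>, where it is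
    everything. The absolute value of \<open>m\<close> covers an empty basis, for which
    \<open>m\<close> is arbitrary.\<close>
  proof (intro exI[of _ "nat (\<bar>a\<bar> + \<bar>m\<bar>) + 2"] conjI allI impI ballI)
    fix r assume "r \<ge> nat (\<bar>a\<bar> + \<bar>m\<bar>) + 2"
    then have r: "r \<ge> 1" and lo: "a - int r < - m" "a - int r + 1 < - m" and hi: "a + int r - 1 \<ge> m" by linarith+
    have lo1: "a - 1 - int (r - 1) < - m" using r lo by simp
    have Zc: "Z r a i q = FC a i q"
      using F_D(1) by (auto simp: Z_def FC_def F_low[OF lo(1)] cycles_def)
    have Zc1: "Z (r - 1) (a - 1) i q = FC (a - 1) i q"
      unfolding Z_def FC_def F_low[OF lo1] cycles_def using F_D(1) by auto
    \<comment> \<open>The filtration is already full at \<open>a + r - 1\<close>, and the boundary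
      lies in degree \<open>a\<close>, so \<open>w\<close> is admissible in the denominator.\<close>
    have into_B: "bd w \<in> B r a i q" if "w \<in> Z r (a + int r) (i - 1) q" for w
    proof -
      have "w \<in> Z (r - 1) (a + int r - 1) (i - 1) q"
        using that r by (auto simp: Z_def F_high[OF hi] F_D(1) of_nat_diff)
      then show ?thesis
        unfolding B_def using Z_D(2) by force
    qed
    show "d r a i q X = \<zero>\<^bsub>E r (a - int r) (i + 1) q\<^esub>" if X: "X \<in> carrier (E r a i q)" for X
    proof -
      obtain f where f: "f \<in> Z r a i q" "X = cls r a i q f" using X by (auto simp: carrier_E[OF r])
      then have "bd f = 0" by (simp add: Zc FC_def cycles_def)
      then show ?thesis
        using f d_cls[OF r f(1)] cls_zero_iff[OF r, of 0 "a - int r" "i + 1" q] Z_D(2) B_D(2)[OF r] by simp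
    qed
    show "d r (a + int r) (i - 1) q X = \<zero>\<^bsub>E r a i q\<^esub>" if X: "X \<in> carrier (E r (a + int r) (i - 1) q)" for X
    proof -
      obtain f where f: "f \<in> Z r (a + int r) (i - 1) q" "X = cls r (a + int r) (i - 1) q f"
        using X by (auto simp: carrier_E[OF r])
      then show ?thesis
        using d_into[OF r f(1)] cls_zero_iff[OF r bd_Z'[OF f(1)]] into_B[OF f(1)] by simp
    qed
    let ?S = "subspace_of (H i q) (Fil a i q)"
    have S: "module rat_field ?S" by (rule module_subspace_of[OF H Fil])
    have N: "submodule (Fil (a - 1) i q) rat_field ?S"
      by (rule submodule_subspace_of[OF H Fil Fil Fil_mono])
    note qs = quot_space_simps[OF S N]
    let ?h = "\<lambda>f. Fil (a - 1) i q +>\<^bsub>?S\<^esub> Psi i q f"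
    show "isomorphic_spaces (E r a i q) (quot_space ?S (Fil (a - 1) i q))"
      unfolding E_def
    proof (rule first_isomorphism[OF ZZ_module module_quot_space[OF S N]])
      have "Psi i q \<in> linear_maps (ZZ r a i q) ?S"
        unfolding Zc by (rule linear_maps_into_subspace_of[OF PsiFC]) (simp add: Fil_def)
      from linear_maps_comp[OF this coset_linear[OF S N]]
      show "?h \<in> linear_maps (ZZ r a i q) (quot_space ?S (Fil (a - 1) i q))" .
      show "carrier (quot_space ?S (Fil (a - 1) i q)) \<subseteq> ?h ` carrier (ZZ r a i q)"
        unfolding qs Zc by (auto simp: Fil_def)
      fix f assume "f \<in> carrier (ZZ r a i q)"
      then have f: "f \<in> FC a i q" using Zc by simp
      have "?h f = \<zero>\<^bsub>quot_space ?S (Fil (a - 1) i q)\<^esub> \<longleftrightarrow> Psi i q f \<in> Fil (a - 1) i q"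
        unfolding qs using coset_eq_subspace_iff[OF S N, of "Psi i q f"] f by (simp add: Fil_def)
      also have "\<dots> \<longleftrightarrow> (\<exists>u\<in>FC (a - 1) i q. f - u \<in> bd ` carrier (free_space (st (i - 1) q)))"
        using Psi_eq[of f i q] f unfolding Fil_def FC_def image_iff by blast
      also have "\<dots> \<longleftrightarrow> f \<in> B r a i q"
      proof
        assume "\<exists>u\<in>FC (a - 1) i q. f - u \<in> bd ` carrier (free_space (st (i - 1) q))"
        then obtain u w where uw: "u \<in> FC (a - 1) i q" "w \<in> carrier (free_space (st (i - 1) q))" "f - u = bd w"
          by auto
        \<comment> \<open>For a chain \<open>w\<close> bounding \<open>f - u\<close>, the only real
          condition is the degree of its boundary.\<close>
        have "f - u \<in> F a i q"
          using uw(1) f F_D(5)[of f a i q u] F_mono[of "a - 1" a u i q] by (simp add: FC_def)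
        then have "w \<in> Z (r - 1) (a + int r - 1) (i - 1) q"
          using uw(2,3) r by (simp add: Z_def F_high[OF hi])
        moreover have "f = u + bd w" using uw(3) by (metis add.commute diff_add_cancel)
        ultimately show "f \<in> B r a i q"
          unfolding B_def using uw(1) Zc1 by blast
      next
        assume "f \<in> B r a i q"
        then obtain u w where uw: "u \<in> FC (a - 1) i q" "w \<in> Z (r - 1) (a + int r - 1) (i - 1) q" "f = u + bd w"
          unfolding B_def Zc1 by blast
        then show "\<exists>u\<in>FC (a - 1) i q. f - u \<in> bd ` carrier (free_space (st (i - 1) q))"
          using Z_D(1)[OF uw(2)] by (intro bexI[of _ u]) auto
      qed
      finally show "?h f = \<zero>\<^bsub>quot_space ?S (Fil (a - 1) i q)\<^esub> \<longleftrightarrow> f \<in> B r a i q" .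
    qed (use B_subset_Z[OF r] in auto)
  qed auto
  ultimately show ?thesis unfolding converges_to_def by blast
qed

end

section \<open>Leading parts and the first page\<close>

text \<open>A source \<open>x\<close> contributing to a target \<open>y\<close> of degree
  \<open>a\<close> satisfies \<open>a = g y \<le> g x \<le> a\<close>, so antisymmetry forces
  \<open>g x = a\<close>. The argument is valid in any poset of degrees.\<close>

lemma restrict_apply_matrix:
  fixes g :: "'x \<Rightarrow> 'j::order"
  assumes "\<And>x y. x \<in> Om \<Longrightarrow> y \<in> Om \<Longrightarrow> c x y \<noteq> 0 \<Longrightarrow> g y \<le> g x"
    and "\<And>x. f x \<noteq> 0 \<Longrightarrow> g x \<le> a"
  shows "restrict_chain {x. g x = a} (apply_matrix Om c f) =
         apply_matrix Om (preserving g c) (restrict_chain {x. g x = a} f)"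
proof
  fix y
  have "c x y * f x = preserving g c x y * restrict_chain {x. g x = a} f x" if "x \<in> Om" "y \<in> Om" "g y = a" for x
    using assms(1)[OF that(1,2)] assms(2)[of x] that(3)
    by (cases "c x y = 0") (auto simp: preserving_def restrict_chain_def)
  then show "restrict_chain {x. g x = a} (apply_matrix Om c f) y =
      apply_matrix Om (preserving g c) (restrict_chain {x. g x = a} f) y"
    by (auto simp: restrict_chain_def apply_matrix_def preserving_def intro!: sum.cong sum.neutral)
qed

lemma restrict_preserving:
  "restrict_chain {x. g x = a} (apply_matrix Om (preserving g c) f) =
   apply_matrix Om (preserving g c) (restrict_chain {x. g x = a} f)"
  by (auto simp: fun_eq_iff restrict_chain_def apply_matrix_def preserving_def intro!: sum.cong sum.neutral)

context filtered_complex
begin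

text \<open>Passing to the part of degree exactly \<open>a\<close> kills \<open>F (a - 1)\<close>
  and turns the differential into its degree-preserving part, which identifies the first page with
  cycles modulo boundaries of that part. The target is described by a presentation
  \<open>Phi\<close>, so that a direct sum of homologies can be inserted for
  \<open>Q\<close>.\<close>

lemma E_one:
  assumes Q: "module rat_field Q"
    and Phi: "Phi \<in> linear_maps (subspace_of (free_space {x \<in> st i q. e x = a})
       {f \<in> carrier (free_space {x \<in> st i q. e x = a}). apply_matrix Om (preserving e c) f = 0}) Q"
    and onto: "carrier Q \<subseteq> Phi `
       {f \<in> carrier (free_space {x \<in> st i q. e x = a}). apply_matrix Om (preserving e c) f = 0}"
    and ker: "\<And>f. f \<in> carrier (free_space {x \<in> st i q. e x = a}) \<Longrightarrow> apply_matrix Om (preserving e c) f = 0 \<Longrightarrow>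
      Phi f = \<zero>\<^bsub>Q\<^esub> \<longleftrightarrow>
      f \<in> apply_matrix Om (preserving e c) ` carrier (free_space {x \<in> st (i - 1) q. e x = a})"
  shows "isomorphic_spaces (E 1 a i q) Q"
proof -
  define R where "R = restrict_chain {x. e x = a}"
  define bd0 where "bd0 = apply_matrix Om (preserving e c)"
  define T where "T i = {x \<in> st i q. e x = a}" for i
  have T_iff: "f \<in> carrier (free_space (T i)) \<longleftrightarrow> (\<forall>x. f x \<noteq> 0 \<longrightarrow> x \<in> st i q \<and> e x = a)" for f i
    unfolding T_def using finite_st[of i q] by (auto simp: carrier_free_space)
  note Phi = Phi[folded bd0_def, folded T_def]
  note onto = onto[folded bd0_def, folded T_def]
  note ker = ker[folded bd0_def, folded T_def]
  note PhiD = linear_mapsD[OF Phi, simplified]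
  have R_bd: "R (bd f) = bd0 (R f)" if "f \<in> F a i q" for f i
    unfolding R_def bd0_def by (rule restrict_apply_matrix) (use that filtered in \<open>auto simp: F_iff\<close>)
  have R_zero: "R f = 0 \<longleftrightarrow> f \<in> F (a - 1) i q" if "f \<in> F a i q" for f i
  proof -
    have "R f = 0 \<longleftrightarrow> (\<forall>x. f x \<noteq> 0 \<longrightarrow> e x \<noteq> a)"
      by (auto simp: R_def restrict_chain_def fun_eq_iff)
    then show ?thesis using that unfolding F_iff by force
  qed
  have R_T: "R f \<in> carrier (free_space (T i))" if "f \<in> F a i q" for f i
    using that by (auto simp: T_iff R_def restrict_chain_def F_iff)
  have R_id: "R f = f" if "f \<in> carrier (free_space (T i))" for f i
    using that by (auto simp: T_iff R_def restrict_chain_def fun_eq_iff)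
  have T_F: "f \<in> F a i q" if "f \<in> carrier (free_space (T i))" for f i
    using that by (auto simp: T_iff F_iff)
  have R_lin: "R (f + g) = R f + R g" "R (scale k f) = scale k (R f)" "R (f - g) = R f - R g" for f g k
    by (auto simp: R_def restrict_chain_linear)
  have Z1: "f \<in> Z 1 a i q \<longleftrightarrow> f \<in> F a i q \<and> bd0 (R f) = 0" for f
    using R_zero[OF bd_F, of f i] R_bd by (auto simp: Z_def)
  have B1: "f \<in> B 1 a i q \<longleftrightarrow> (\<exists>u w. u \<in> F (a - 1) i q \<and> w \<in> F a (i - 1) q \<and> f = u + bd w)" for f
    by (auto simp: B_def Z_0)
  show ?thesis
    unfolding E_def
  proof (rule first_isomorphism[OF ZZ_module Q])
    show "(\<lambda>f. Phi (R f)) \<in> linear_maps (ZZ 1 a i q) Q"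
      by (rule linear_mapsI) (auto simp: Z1 R_lin R_T PhiD simp flip: One_nat_def)
    show "carrier Q \<subseteq> (\<lambda>f. Phi (R f)) ` carrier (ZZ 1 a i q)"
    proof
      fix X assume "X \<in> carrier Q"
      then obtain f where "f \<in> carrier (free_space (T i))" "bd0 f = 0" "X = Phi f" using onto by auto
      then show "X \<in> (\<lambda>f. Phi (R f)) ` carrier (ZZ 1 a i q)"
        using R_id T_F by (auto simp: Z1 simp flip: One_nat_def intro!: image_eqI[of _ _ f])
    qed
    fix f assume "f \<in> carrier (ZZ 1 a i q)"
    then have f: "f \<in> F a i q" "bd0 (R f) = 0" by (auto simp: Z1 simp flip: One_nat_def)
    have "Phi (R f) = \<zero>\<^bsub>Q\<^esub> \<longleftrightarrow> (\<exists>w\<in>carrier (free_space (T (i - 1))). R f = bd0 w)"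
      using ker[OF R_T[OF f(1)] f(2)] by auto
    also have "\<dots> \<longleftrightarrow> f \<in> B 1 a i q"
    proof
      assume "\<exists>w\<in>carrier (free_space (T (i - 1))). R f = bd0 w"
      then obtain w where w: "w \<in> carrier (free_space (T (i - 1)))" "R f = bd0 w" by blast
      have bw: "bd w \<in> F a i q" using bd_F[OF T_F[OF w(1)]] by simp
      have "R (f - bd w) = 0"
        using w R_bd[OF T_F[OF w(1)]] R_id[OF w(1)] by (simp add: R_lin)
      then have "f - bd w \<in> F (a - 1) i q"
        using R_zero[OF F_D(5)[OF f(1) bw]] by simp
      then show "f \<in> B 1 a i q"
        unfolding B1 using T_F[OF w(1)] by (metis diff_add_cancel)
    next
      assume "f \<in> B 1 a i q"
      then obtain u w where uw: "u \<in> F (a - 1) i q" "w \<in> F a (i - 1) q" "f = u + bd w" unfolding B1 by blast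
      have "R u = 0" using R_zero[OF F_mono[OF _ uw(1)]] uw(1) by simp
      then have "R f = bd0 (R w)" using uw R_bd by (simp add: R_lin)
      then show "\<exists>w\<in>carrier (free_space (T (i - 1))). R f = bd0 w"
        using R_T[OF uw(2)] by blast
    qed
    finally show "Phi (R f) = \<zero>\<^bsub>Q\<^esub> \<longleftrightarrow> f \<in> B 1 a i q" .
  qed (use B_subset_Z[of 1] in auto)
qed

end

section \<open>Homology of associated graded complexes\<close>

lemma direct_sum_simps:
  "carrier (direct_sum J M) = {f \<in> (\<Pi>\<^sub>E j\<in>J. carrier (M j)). finite {j\<in>J. f j \<noteq> \<zero>\<^bsub>M j\<^esub>}}"
  "\<zero>\<^bsub>direct_sum J M\<^esub> = (\<lambda>j\<in>J. \<zero>\<^bsub>M j\<^esub>)"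
  "f \<oplus>\<^bsub>direct_sum J M\<^esub> g = (\<lambda>j\<in>J. f j \<oplus>\<^bsub>M j\<^esub> g j)"
  "k \<odot>\<^bsub>direct_sum J M\<^esub> f = (\<lambda>j\<in>J. k \<odot>\<^bsub>M j\<^esub> f j)"
  by (simp_all add: direct_sum_def)

lemma module_direct_sum:
  assumes "\<And>j. j \<in> J \<Longrightarrow> module rat_field (M j)"
  shows "module rat_field (direct_sum J M)"
proof -
  have ag: "abelian_group (M j)" if "j \<in> J" for j
    using assms[OF that] by (simp add: module_def)
  have am: "abelian_monoid (M j)" if "j \<in> J" for j
    using ag[OF that] by (simp add: abelian_group_def)
  have smc: "k \<odot>\<^bsub>M j\<^esub> x \<in> carrier (M j)" if "j \<in> J" "x \<in> carrier (M j)" for j k x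
    using module.smult_closed[OF assms[OF that(1)], of k x] that by simp
  have sm0: "k \<odot>\<^bsub>M j\<^esub> \<zero>\<^bsub>M j\<^esub> = \<zero>\<^bsub>M j\<^esub>" if "j \<in> J" for j k
    using module.smult_r_null[OF assms[OF that(1)], of k] by simp
  have scarr: "k \<odot>\<^bsub>direct_sum J M\<^esub> f \<in> carrier (direct_sum J M)" if f: "f \<in> carrier (direct_sum J M)" for k f
  proof -
    have "{j \<in> J. k \<odot>\<^bsub>M j\<^esub> f j \<noteq> \<zero>\<^bsub>M j\<^esub>} \<subseteq> {j \<in> J. f j \<noteq> \<zero>\<^bsub>M j\<^esub>}"
      using sm0 by auto
    from finite_subset[OF this] have "finite {j \<in> J. k \<odot>\<^bsub>M j\<^esub> f j \<noteq> \<zero>\<^bsub>M j\<^esub>}"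
      using f by (simp add: direct_sum_simps)
    moreover have "{j \<in> J. (\<lambda>j\<in>J. k \<odot>\<^bsub>M j\<^esub> f j) j \<noteq> \<zero>\<^bsub>M j\<^esub>} = {j \<in> J. k \<odot>\<^bsub>M j\<^esub> f j \<noteq> \<zero>\<^bsub>M j\<^esub>}" by auto
    ultimately show ?thesis using f smc by (auto simp: direct_sum_simps PiE_iff)
  qed
  show ?thesis
  proof (rule moduleI[OF cring_rat_field])
    show "abelian_group (direct_sum J M)"
    proof (rule abelian_groupI)
      fix f g assume f: "f \<in> carrier (direct_sum J M)" and g: "g \<in> carrier (direct_sum J M)"
      have "{j \<in> J. f j \<oplus>\<^bsub>M j\<^esub> g j \<noteq> \<zero>\<^bsub>M j\<^esub>} \<subseteq> {j \<in> J. f j \<noteq> \<zero>\<^bsub>M j\<^esub>} \<union> {j \<in> J. g j \<noteq> \<zero>\<^bsub>M j\<^esub>}"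
        using abelian_monoid.l_zero[OF am] abelian_monoid.zero_closed[OF am] by auto
      from finite_subset[OF this] have "finite {j \<in> J. f j \<oplus>\<^bsub>M j\<^esub> g j \<noteq> \<zero>\<^bsub>M j\<^esub>}"
        using f g by (simp add: direct_sum_simps)
      moreover have "{j \<in> J. (\<lambda>j\<in>J. f j \<oplus>\<^bsub>M j\<^esub> g j) j \<noteq> \<zero>\<^bsub>M j\<^esub>} = {j \<in> J. f j \<oplus>\<^bsub>M j\<^esub> g j \<noteq> \<zero>\<^bsub>M j\<^esub>}" by auto
      ultimately show "f \<oplus>\<^bsub>direct_sum J M\<^esub> g \<in> carrier (direct_sum J M)"
        using f g abelian_monoid.a_closed[OF am] by (auto simp: direct_sum_simps PiE_iff)
      show "f \<oplus>\<^bsub>direct_sum J M\<^esub> g = g \<oplus>\<^bsub>direct_sum J M\<^esub> f"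
        using f g by (auto simp: direct_sum_simps PiE_iff intro!: restrict_ext abelian_monoid.a_comm[OF am])
      fix h assume h: "h \<in> carrier (direct_sum J M)"
      show "f \<oplus>\<^bsub>direct_sum J M\<^esub> g \<oplus>\<^bsub>direct_sum J M\<^esub> h = f \<oplus>\<^bsub>direct_sum J M\<^esub> (g \<oplus>\<^bsub>direct_sum J M\<^esub> h)"
        using f g h by (auto simp: direct_sum_simps PiE_iff intro!: restrict_ext abelian_monoid.a_assoc[OF am])
    next
      have "{j \<in> J. (\<lambda>j\<in>J. \<zero>\<^bsub>M j\<^esub>) j \<noteq> \<zero>\<^bsub>M j\<^esub>} = {}" by auto
      then show "\<zero>\<^bsub>direct_sum J M\<^esub> \<in> carrier (direct_sum J M)"
        using abelian_monoid.zero_closed[OF am] unfolding direct_sum_simps by (simp add: PiE_iff)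
    next
      fix f assume f: "f \<in> carrier (direct_sum J M)"
      then have fx: "f \<in> extensional J" by (auto simp: direct_sum_simps PiE_iff)
      have "(\<lambda>j\<in>J. \<zero>\<^bsub>M j\<^esub> \<oplus>\<^bsub>M j\<^esub> f j) = restrict f J"
        using f by (auto simp: direct_sum_simps PiE_iff intro!: restrict_ext abelian_monoid.l_zero[OF am])
      moreover have "(\<lambda>j\<in>J. (\<lambda>j\<in>J. \<zero>\<^bsub>M j\<^esub>) j \<oplus>\<^bsub>M j\<^esub> f j) = (\<lambda>j\<in>J. \<zero>\<^bsub>M j\<^esub> \<oplus>\<^bsub>M j\<^esub> f j)"
        by (rule restrict_ext) simp
      ultimately show "\<zero>\<^bsub>direct_sum J M\<^esub> \<oplus>\<^bsub>direct_sum J M\<^esub> f = f"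
        using extensional_restrict[OF fx] by (simp add: direct_sum_simps(2,3))
      have "(\<lambda>j\<in>J. (\<lambda>j\<in>J. (-1) \<odot>\<^bsub>M j\<^esub> f j) j \<oplus>\<^bsub>M j\<^esub> f j) = (\<lambda>j\<in>J. \<zero>\<^bsub>M j\<^esub>)"
      proof (rule restrict_ext)
        fix j assume j: "j \<in> J"
        then have fj: "f j \<in> carrier (M j)" using f by (auto simp: direct_sum_simps PiE_iff)
        show "(\<lambda>j\<in>J. (-1) \<odot>\<^bsub>M j\<^esub> f j) j \<oplus>\<^bsub>M j\<^esub> f j = \<zero>\<^bsub>M j\<^esub>"
          using abelian_group.l_neg[OF ag[OF j] fj] j a_inv_eq_smult[OF assms[OF j] fj] by simp
      qed
      then have "((-1) \<odot>\<^bsub>direct_sum J M\<^esub> f) \<oplus>\<^bsub>direct_sum J M\<^esub> f = \<zero>\<^bsub>direct_sum J M\<^esub>"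
        by (simp add: direct_sum_simps)
      then show "\<exists>g\<in>carrier (direct_sum J M). g \<oplus>\<^bsub>direct_sum J M\<^esub> f = \<zero>\<^bsub>direct_sum J M\<^esub>"
        using scarr[OF f] by blast
    qed
    fix a b :: rat and f g assume f: "f \<in> carrier (direct_sum J M)"
    then have fj: "f j \<in> carrier (M j)" if "j \<in> J" for j using that by (auto simp: direct_sum_simps PiE_iff)
    show "a \<odot>\<^bsub>direct_sum J M\<^esub> f \<in> carrier (direct_sum J M)" by (rule scarr[OF f])
    show "(a \<oplus>\<^bsub>rat_field\<^esub> b) \<odot>\<^bsub>direct_sum J M\<^esub> f = a \<odot>\<^bsub>direct_sum J M\<^esub> f \<oplus>\<^bsub>direct_sum J M\<^esub> b \<odot>\<^bsub>direct_sum J M\<^esub> f"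
      unfolding direct_sum_simps using module.smult_l_distr[OF assms _ _ fj, of _ a b]
      by (intro restrict_ext) simp
    show "(a \<otimes>\<^bsub>rat_field\<^esub> b) \<odot>\<^bsub>direct_sum J M\<^esub> f = a \<odot>\<^bsub>direct_sum J M\<^esub> (b \<odot>\<^bsub>direct_sum J M\<^esub> f)"
      unfolding direct_sum_simps using module.smult_assoc1[OF assms _ _ fj, of _ a b]
      by (intro restrict_ext) simp
    have "\<one>\<^bsub>rat_field\<^esub> \<odot>\<^bsub>direct_sum J M\<^esub> f = restrict f J"
      unfolding direct_sum_simps using module.smult_one[OF assms fj]
      by (intro restrict_ext) simp
    then show "\<one>\<^bsub>rat_field\<^esub> \<odot>\<^bsub>direct_sum J M\<^esub> f = f"
      using f by (auto simp: direct_sum_simps PiE_iff extensional_restrict)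
    assume g: "g \<in> carrier (direct_sum J M)"
    then have gj: "g j \<in> carrier (M j)" if "j \<in> J" for j using that by (auto simp: direct_sum_simps PiE_iff)
    show "a \<odot>\<^bsub>direct_sum J M\<^esub> (f \<oplus>\<^bsub>direct_sum J M\<^esub> g) = a \<odot>\<^bsub>direct_sum J M\<^esub> f \<oplus>\<^bsub>direct_sum J M\<^esub> a \<odot>\<^bsub>direct_sum J M\<^esub> g"
      unfolding direct_sum_simps using module.smult_r_distr[OF assms _ fj gj, of _ a]
      by (intro restrict_ext) simp
  qed
qed

lemma boundary_apply_matrix: "boundary D = apply_matrix (enhanced_states D) (boundary_coeff D)"
  by (auto simp: boundary_def apply_matrix_def fun_eq_iff)

lemma scale_zero: "scale k 0 = 0"
  by (auto simp: scale_def)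

text \<open>Induction splits off one generator at a time. It serves to place a free space inside
  every subspace of the intersection that defines \<open>span_in\<close>.\<close>

lemma free_space_subset_submodule:
  assumes N: "submodule N rat_field (free_space Y)"
    and "finite X" "X \<subseteq> Y" "\<And>x. x \<in> X \<Longrightarrow> carrier (free_space {x}) \<subseteq> N"
  shows "carrier (free_space X) \<subseteq> N"
  using assms(2-)
proof (induction X rule: finite_induct)
  case empty
  have "f = 0" if "f \<in> carrier (free_space {})" for f :: "'a \<Rightarrow> rat"
    using that by (auto simp: carrier_free_space fun_eq_iff)
  then show ?case using submodule_free_spaceD(2)[OF N] by auto
next
  case (insert x X)
  show ?case
  proof
    fix f assume f: "f \<in> carrier (free_space (insert x X))"
    have "restrict_chain X f \<in> carrier (free_space X)" "restrict_chain {x} f \<in> carrier (free_space {x})"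
      using insert(1) by (auto simp: carrier_free_space restrict_chain_def)
    then have "restrict_chain X f \<in> N" "restrict_chain {x} f \<in> N"
      using insert.IH insert.prems by blast+
    moreover have "f = restrict_chain {x} f + restrict_chain X f"
      using f insert(1,2) by (auto simp: carrier_free_space restrict_chain_def fun_eq_iff)
    ultimately show "f \<in> N" using submodule_free_spaceD(3)[OF N] by metis
  qed
qed

section \<open>The Khovanov complex filtered by a degree in a poset\<close>

text \<open>Used twice, with the annular degree in the integers and with the multidegree in
  \<open>Z_punctures P\<close>. By \<open>g_J\<close> the filtration step at the degree of a
  generator is among those over which \<open>lower_filtration\<close> ranges.\<close>

locale filtered_CKh =
  C: graded_complex "enhanced_states D" "states_in_degree D" "boundary_coeff D" for D +
  fixes g :: "state \<Rightarrow> 'j::order" and J :: "'j set"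
  assumes filtered: "x \<in> enhanced_states D \<Longrightarrow> y \<in> enhanced_states D \<Longrightarrow> boundary_coeff D x y \<noteq> 0 \<Longrightarrow> g y \<le> g x"
    and g_J: "x \<in> enhanced_states D \<Longrightarrow> g x \<in> J"
begin

abbreviation bd0 :: "chain \<Rightarrow> chain" where
  "bd0 \<equiv> apply_matrix (enhanced_states D) (preserving g (boundary_coeff D))"

abbreviation C :: "int \<Rightarrow> int \<Rightarrow> chain qspace" where
  "C i q \<equiv> free_space (states_in_degree D i q)"

abbreviation F :: "'j \<Rightarrow> int \<Rightarrow> int \<Rightarrow> chain set" where
  "F a i q \<equiv> filtration D g a i q"

abbreviation L :: "'j \<Rightarrow> int \<Rightarrow> int \<Rightarrow> chain set" where
  "L a i q \<equiv> lower_filtration D J g a i q"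

lemma F_submodule: "submodule (F a i q) rat_field (C i q)"
  unfolding filtration_def by (rule submodule_carrier_free_space) auto

lemma F_iff: "f \<in> F a i q \<longleftrightarrow> (\<forall>x. f x \<noteq> 0 \<longrightarrow> x \<in> states_in_degree D i q \<and> g x \<le> a)"
  using C.finite_st[of i q] unfolding filtration_def by (auto simp: carrier_free_space)

text \<open>A generator with \<open>g x < a\<close> lies in the step at \<open>g x\<close> itself,
  which is one of those spanning \<open>L a i q\<close>; conversely these steps involve only such
  generators. So the span over a poset is still free on generators.\<close>

lemma lower_filtration_eq: "L a i q = carrier (free_space {x \<in> states_in_degree D i q. g x < a})"
proof
  let ?U = "\<Union>b\<in>{b\<in>J. b < a}. F b i q"
  let ?S = "{x \<in> states_in_degree D i q. g x < a}"
  have fin: "finite {x \<in> states_in_degree D i q. Q x}" for Q using C.finite_st[of i q] by auto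
  have "submodule (carrier (free_space ?S)) rat_field (C i q)"
    by (rule submodule_carrier_free_space) auto
  moreover have "?U \<subseteq> carrier (free_space ?S)"
  proof
    fix f assume "f \<in> ?U"
    then obtain b where b: "b < a" "f \<in> F b i q" by blast
    then have "x \<in> ?S" if "f x \<noteq> 0" for x
      using that le_less_trans[of "g x" b a] unfolding F_iff by blast
    then show "f \<in> carrier (free_space ?S)"
      unfolding carrier_free_space[OF fin] by blast
  qed
  ultimately show "L a i q \<subseteq> carrier (free_space ?S)"
    unfolding lower_filtration_def span_in_def CKh_def by blast
  have "carrier (free_space ?S) \<subseteq> N" if N: "submodule N rat_field (C i q)" "?U \<subseteq> N" for N
  proof (rule free_space_subset_submodule[OF N(1)])
    fix x assume x: "x \<in> ?S"
    have "carrier (free_space {x}) \<subseteq> F (g x) i q"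
    proof (rule subsetI)
      fix f assume "f \<in> carrier (free_space {x})"
      then have "y = x" if "f y \<noteq> 0" for y
        using that unfolding carrier_free_space[OF finite.insertI[OF finite.emptyI]] by blast
      then show "f \<in> F (g x) i q" unfolding F_iff using x by blast
    qed
    moreover have "g x \<in> J" using x g_J[of x] C.st_subset[of i q] by blast
    ultimately show "carrier (free_space {x}) \<subseteq> N" using N(2) x by blast
  qed (use fin in auto)
  then show "carrier (free_space ?S) \<subseteq> L a i q"
    unfolding lower_filtration_def span_in_def CKh_def by blast
qed

lemma L_iff: "f \<in> L a i q \<longleftrightarrow> (\<forall>x. f x \<noteq> 0 \<longrightarrow> x \<in> states_in_degree D i q \<and> g x < a)"
  using C.finite_st[of i q] unfolding lower_filtration_eq by (auto simp: carrier_free_space)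

lemma L_submodule: "submodule (L a i q) rat_field (C i q)"
  unfolding lower_filtration_eq by (rule submodule_carrier_free_space) auto

lemma L_F: "L a i q \<subseteq> F a i q"
  by (auto simp: F_iff L_iff less_imp_le)

lemma bd_F:
  assumes "f \<in> F a i q"
  shows "C.bd f \<in> F a (i + 1) q"
  unfolding F_iff
proof (intro allI impI)
  fix y assume y: "C.bd f y \<noteq> 0"
  then have "(\<Sum>x\<in>enhanced_states D. boundary_coeff D x y * f x) \<noteq> 0" "y \<in> enhanced_states D"
    by (auto simp: apply_matrix_def split: if_splits)
  then obtain x where "x \<in> enhanced_states D" "boundary_coeff D x y \<noteq> 0" "f x \<noteq> 0"
    by (metis (mono_tags, lifting) mult_zero_left mult_zero_right sum.neutral)
  then show "y \<in> states_in_degree D (i + 1) q \<and> g y \<le> a"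
    using assms C.degree filtered[of x y] \<open>y \<in> enhanced_states D\<close> unfolding F_iff by (meson order.trans)
qed

lemma bd_L:
  assumes "f \<in> L a i q"
  shows "C.bd f \<in> L a (i + 1) q"
  unfolding L_iff
proof (intro allI impI)
  fix y assume y: "C.bd f y \<noteq> 0"
  then have "(\<Sum>x\<in>enhanced_states D. boundary_coeff D x y * f x) \<noteq> 0" "y \<in> enhanced_states D"
    by (auto simp: apply_matrix_def split: if_splits)
  then obtain x where "x \<in> enhanced_states D" "boundary_coeff D x y \<noteq> 0" "f x \<noteq> 0"
    by (metis (mono_tags, lifting) mult_zero_left mult_zero_right sum.neutral)
  then show "y \<in> states_in_degree D (i + 1) q \<and> g y < a"
    using assms C.degree filtered[of x y] \<open>y \<in> enhanced_states D\<close> unfolding L_iff by (meson le_less_trans)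
qed

abbreviation FF where "FF a i q \<equiv> subspace_of (C i q) (F a i q)"

lemma FF_module: "module rat_field (FF a i q)"
  by (rule module_subspace_of[OF module_free_space F_submodule])

lemma L_submodule_FF: "submodule (L a i q) rat_field (FF a i q)"
  by (rule submodule_subspace_of[OF module_free_space F_submodule L_submodule L_F])

lemma gr_eq: "gr D J g a i q = quot_space (FF a i q) (L a i q)"
  by (simp add: gr_def CKh_def)

lemma gr_module: "module rat_field (gr D J g a i q)"
  unfolding gr_eq by (rule module_quot_space[OF FF_module L_submodule_FF])

lemma bd_linear_FF: "C.bd \<in> linear_maps (FF a i q) (FF a (i + 1) q)"
  by (rule linear_mapsI) (auto simp: apply_matrix_linear bd_F)

definition gr_class :: "'j \<Rightarrow> int \<Rightarrow> int \<Rightarrow> chain \<Rightarrow> chain set" where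
  "gr_class a i q f = L a i q +>\<^bsub>C i q\<^esub> f"

lemma carrier_gr: "carrier (gr D J g a i q) = gr_class a i q ` F a i q"
  unfolding gr_eq gr_class_def quot_space_simps(1)[OF FF_module L_submodule_FF] by simp

lemma zero_gr: "\<zero>\<^bsub>gr D J g a i q\<^esub> = L a i q"
  unfolding gr_eq quot_space_simps(2)[OF FF_module L_submodule_FF] by simp

lemma gr_class_linear: "gr_class a i q \<in> linear_maps (FF a i q) (gr D J g a i q)"
  using coset_linear[OF FF_module L_submodule_FF[where a = a and i = i and q = q]] unfolding gr_eq gr_class_def by simp

lemma gr_class_zero_iff: "f \<in> F a i q \<Longrightarrow> gr_class a i q f = \<zero>\<^bsub>gr D J g a i q\<^esub> \<longleftrightarrow> f \<in> L a i q"
  unfolding gr_class_def zero_gr using coset_eq_subspace_iff[OF FF_module L_submodule_FF[where a = a and i = i and q = q], of f] by simp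

lemma gr_class_eq_iff: "f \<in> F a i q \<Longrightarrow> h \<in> F a i q \<Longrightarrow> gr_class a i q f = gr_class a i q h \<longleftrightarrow> f - h \<in> L a i q"
  unfolding gr_class_def
  using coset_eq_iff[OF FF_module L_submodule_FF[where a = a and i = i and q = q], of f h] minus_free_subspace[OF F_submodule] by simp

lemma gr_boundary_grc: "f \<in> F a i q \<Longrightarrow> gr_boundary D J g a i q (gr_class a i q f) = gr_class a (i + 1) q (C.bd f)"
  unfolding gr_boundary_def gr_class_def CKh_def boundary_apply_matrix
  using induced_map(1)[OF FF_module L_submodule_FF FF_module L_submodule_FF bd_linear_FF[where a = a and i = i and q = q] bd_L, of f]
  by simp

lemma gr_boundary_linear: "gr_boundary D J g a i q \<in> linear_maps (gr D J g a i q) (gr D J g a (i + 1) q)"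
  using induced_map(2)[OF FF_module L_submodule_FF FF_module L_submodule_FF bd_linear_FF[where a = a and i = i and q = q] bd_L]
  unfolding gr_eq gr_boundary_def[abs_def] CKh_def boundary_apply_matrix by simp

text \<open>\<open>Bs\<close> is a single degree for one graded piece, a fibre of the coordinate sum
  for the flattened grading, and \<open>UNIV\<close> for the total complex.\<close>

definition part :: "'j set \<Rightarrow> int \<Rightarrow> int \<Rightarrow> chain set" where
  "part Bs i q = carrier (free_space {x \<in> states_in_degree D i q. g x \<in> Bs})"

lemma part_iff: "f \<in> part Bs i q \<longleftrightarrow> (\<forall>x. f x \<noteq> 0 \<longrightarrow> x \<in> states_in_degree D i q \<and> g x \<in> Bs)"
  using C.finite_st[of i q] unfolding part_def by (auto simp: carrier_free_space)

definition part_cycles :: "'j set \<Rightarrow> int \<Rightarrow> int \<Rightarrow> chain set" where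
  "part_cycles Bs i q = {f \<in> part Bs i q. bd0 f = 0}"

abbreviation R :: "'j \<Rightarrow> chain \<Rightarrow> chain" where
  "R a \<equiv> restrict_chain {x. g x = a}"

lemma part_submodule: "submodule (part Bs i q) rat_field (C i q)"
  unfolding part_def by (rule submodule_carrier_free_space) auto

lemma part_cycles_submodule: "submodule (part_cycles Bs i q) rat_field (C i q)"
  using submodule_free_spaceD[OF part_submodule[of Bs i q]]
  by (intro submodule_free_spaceI) (auto simp: part_cycles_def apply_matrix_linear scale_zero)

lemma R_bd: "f \<in> F a i q \<Longrightarrow> R a (C.bd f) = bd0 (R a f)"
  by (rule restrict_apply_matrix) (use filtered in \<open>auto simp: F_iff\<close>)

lemma R_zero: "f \<in> F a i q \<Longrightarrow> R a f = 0 \<longleftrightarrow> f \<in> L a i q"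
proof -
  assume f: "f \<in> F a i q"
  have "R a f = 0 \<longleftrightarrow> (\<forall>x. f x \<noteq> 0 \<longrightarrow> g x \<noteq> a)"
    by (auto simp: restrict_chain_def fun_eq_iff)
  then show ?thesis using f unfolding F_iff L_iff less_le by blast
qed

lemma R_part: "f \<in> F a i q \<Longrightarrow> R a f \<in> part {a} i q"
  by (auto simp: part_iff restrict_chain_def F_iff)

lemma R_id: "f \<in> part {a} i q \<Longrightarrow> R a f = f"
  by (auto simp: part_iff restrict_chain_def fun_eq_iff)

lemma part_F: "f \<in> part {a} i q \<Longrightarrow> f \<in> F a i q"
  by (auto simp: part_iff F_iff)

text \<open>Each coset in the graded piece has exactly one representative of pure degree
  \<open>a\<close>, and on these the induced differential is \<open>bd0\<close>. The nested quotient
  is thereby described by honest chains.\<close>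

lemma gr_homology_presentation:
  obtains eta where
    "module rat_field (gr_homology D J g a i q)"
    "eta \<in> linear_maps (subspace_of (C i q) (part_cycles {a} i q)) (gr_homology D J g a i q)"
    "carrier (gr_homology D J g a i q) \<subseteq> eta ` part_cycles {a} i q"
    "\<And>f. f \<in> part_cycles {a} i q \<Longrightarrow> eta f = \<zero>\<^bsub>gr_homology D J g a i q\<^esub> \<longleftrightarrow> f \<in> bd0 ` part {a} (i - 1) q"
proof -
  let ?E = "gr D J g a i q"
  let ?d = "gr_boundary D J g a i q"
  let ?d' = "gr_boundary D J g a (i - 1) q"
  let ?K = "{X \<in> carrier ?E. ?d X = \<zero>\<^bsub>gr D J g a (i + 1) q\<^esub>}"
  let ?I = "?d' ` carrier (gr D J g a (i - 1) q)"
  have d_in: "?d' \<in> linear_maps (gr D J g a (i - 1) q) ?E"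
    using gr_boundary_linear[of a "i - 1" q] by simp
  have d_into: "?d' (gr_class a (i - 1) q w) = gr_class a i q (C.bd w)" "C.bd w \<in> F a i q" if "w \<in> F a (i - 1) q" for w
    using gr_boundary_grc[OF that] bd_F[OF that] by simp_all
  have K: "submodule ?K rat_field ?E"
    by (rule submodule_kernel[OF gr_module gr_module gr_boundary_linear])
  have I: "submodule ?I rat_field ?E"
    by (rule submodule_image[OF gr_module gr_module d_in])
  have d_zero: "?d (gr_class a i q f) = \<zero>\<^bsub>gr D J g a (i + 1) q\<^esub> \<longleftrightarrow> bd0 (R a f) = 0" if "f \<in> F a i q" for f
    using gr_boundary_grc[OF that] gr_class_zero_iff[OF bd_F[OF that]] R_zero[OF bd_F[OF that]] R_bd[OF that] by simp
  have IK: "?I \<subseteq> ?K"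
  proof
    fix X assume "X \<in> ?I"
    then obtain w where w: "w \<in> F a (i - 1) q" "X = gr_class a i q (C.bd w)"
      using d_into by (auto simp: carrier_gr)
    have "gr_class a (i + 1) q 0 = \<zero>\<^bsub>gr D J g a (i + 1) q\<^esub>"
      by (rule gr_class_zero_iff[THEN iffD2]) (auto simp: F_iff L_iff)
    then show "X \<in> ?K"
      using d_into(2)[OF w(1)] w(2) gr_boundary_grc[of "C.bd w" a i q] by (auto simp: carrier_gr C.bd_bd)
  qed
  let ?S = "subspace_of ?E ?K"
  have S: "module rat_field ?S" by (rule module_subspace_of[OF gr_module K])
  have I': "submodule ?I rat_field ?S"
    by (rule submodule_subspace_of[OF gr_module K I IK])
  note q = quot_space_simps[OF S I']
  have H: "gr_homology D J g a i q = quot_space ?S ?I"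
    by (simp add: gr_homology_def homology_at_def)
  let ?eta = "\<lambda>f. ?I +>\<^bsub>?S\<^esub> gr_class a i q f"
  have gK: "gr_class a i q f \<in> ?K" if "f \<in> part_cycles {a} i q" for f
  proof -
    have f: "f \<in> F a i q" "R a f = f" "bd0 f = 0" using that part_F R_id by (auto simp: part_cycles_def)
    then show ?thesis using d_zero[OF f(1)] by (auto simp: carrier_gr)
  qed
  show thesis
  proof (rule that[of ?eta])
    show "module rat_field (gr_homology D J g a i q)"
      unfolding H by (rule module_quot_space[OF S I'])
    have "gr_class a i q \<in> linear_maps (subspace_of (C i q) (part_cycles {a} i q)) ?S"
    proof (rule linear_mapsI)
      note gl = linear_mapsD[OF gr_class_linear[of a i q], simplified]
      show "gr_class a i q x \<in> carrier ?S" if "x \<in> carrier (subspace_of (C i q) (part_cycles {a} i q))" for x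
        using gK that by simp
      show "gr_class a i q (x \<oplus>\<^bsub>subspace_of (C i q) (part_cycles {a} i q)\<^esub> y) = gr_class a i q x \<oplus>\<^bsub>?S\<^esub> gr_class a i q y"
        if "x \<in> carrier (subspace_of (C i q) (part_cycles {a} i q))" "y \<in> carrier (subspace_of (C i q) (part_cycles {a} i q))" for x y
        using gl(2) that part_F by (simp add: part_cycles_def)
      show "gr_class a i q (k \<odot>\<^bsub>subspace_of (C i q) (part_cycles {a} i q)\<^esub> x) = k \<odot>\<^bsub>?S\<^esub> gr_class a i q x"
        if "x \<in> carrier (subspace_of (C i q) (part_cycles {a} i q))" for x k
        using gl(3) that part_F by (simp add: part_cycles_def)
    qed
    from linear_maps_comp[OF this coset_linear[OF S I']]
    show "?eta \<in> linear_maps (subspace_of (C i q) (part_cycles {a} i q)) (gr_homology D J g a i q)"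
      unfolding H .
    show "carrier (gr_homology D J g a i q) \<subseteq> ?eta ` part_cycles {a} i q"
    proof
      fix Y assume "Y \<in> carrier (gr_homology D J g a i q)"
      then obtain f where f: "f \<in> F a i q" "gr_class a i q f \<in> ?K" "Y = ?eta f"
        unfolding H q by (auto simp: carrier_gr)
      have Rf: "R a f \<in> part {a} i q" "R a f \<in> F a i q" "R a (R a f) = R a f"
        using R_part[OF f(1)] part_F R_id by auto
      \<comment> \<open>What remains of \<open>f\<close> has degree strictly below \<open>a\<close>,
        so replacing \<open>f\<close> by its leading part does not move the coset.\<close>
      have "f - R a f \<in> F a i q"
        using submodule_free_spaceD(5)[OF F_submodule f(1) Rf(2)] .
      moreover have "R a (f - R a f) = 0" using Rf(3) by (simp add: restrict_chain_linear)
      ultimately have "gr_class a i q f = gr_class a i q (R a f)"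
        using gr_class_eq_iff[OF f(1) Rf(2)] R_zero by simp
      moreover have "R a f \<in> part_cycles {a} i q"
        using Rf d_zero[OF f(1)] f(2) by (simp add: part_cycles_def)
      ultimately show "Y \<in> ?eta ` part_cycles {a} i q" using f(3) by auto
    qed
    fix f assume f0: "f \<in> part_cycles {a} i q"
    then have fT: "f \<in> part {a} i q" "f \<in> F a i q" "R a f = f" using part_F R_id by (auto simp: part_cycles_def)
    have "?eta f = \<zero>\<^bsub>gr_homology D J g a i q\<^esub> \<longleftrightarrow> gr_class a i q f \<in> ?I"
      unfolding H q(2) using coset_eq_subspace_iff[OF S I', of "gr_class a i q f"] gK[OF f0] by simp
    also have "\<dots> \<longleftrightarrow> (\<exists>w\<in>F a (i - 1) q. gr_class a i q f = gr_class a i q (C.bd w))"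
      unfolding carrier_gr image_image using d_into by (simp add: image_iff)
    also have "\<dots> \<longleftrightarrow> (\<exists>w\<in>F a (i - 1) q. f - C.bd w \<in> L a i q)"
      using gr_class_eq_iff[OF fT(2)] d_into(2) by blast
    also have "\<dots> \<longleftrightarrow> (\<exists>w\<in>F a (i - 1) q. f = bd0 (R a w))"
    proof (rule bex_cong[OF refl])
      fix w assume w: "w \<in> F a (i - 1) q"
      have "f - C.bd w \<in> F a i q"
        using submodule_free_spaceD(5)[OF F_submodule fT(2) d_into(2)[OF w]] .
      then have "f - C.bd w \<in> L a i q \<longleftrightarrow> R a (f - C.bd w) = 0" using R_zero by simp
      also have "\<dots> \<longleftrightarrow> f = bd0 (R a w)"
        using R_bd[OF w] fT(3) by (simp add: restrict_chain_linear)
      finally show "f - C.bd w \<in> L a i q \<longleftrightarrow> f = bd0 (R a w)" .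
    qed
    also have "\<dots> \<longleftrightarrow> f \<in> bd0 ` part {a} (i - 1) q"
    proof
      assume "\<exists>w\<in>F a (i - 1) q. f = bd0 (R a w)"
      then show "f \<in> bd0 ` part {a} (i - 1) q" using R_part by blast
    next
      assume "f \<in> bd0 ` part {a} (i - 1) q"
      then obtain w where w: "w \<in> part {a} (i - 1) q" "f = bd0 w" by blast
      then have "f = bd0 (R a w)" using R_id[OF w(1)] by simp
      then show "\<exists>w\<in>F a (i - 1) q. f = bd0 (R a w)" using part_F[OF w(1)] by blast
    qed
    finally show "?eta f = \<zero>\<^bsub>gr_homology D J g a i q\<^esub> \<longleftrightarrow> f \<in> bd0 ` part {a} (i - 1) q" .
  qed
qed

lemma module_gr_homology: "module rat_field (gr_homology D J g a i q)"
  using gr_homology_presentation[of a i q] by blast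

lemma R_ext: "(\<And>a. R a f = R a h) \<Longrightarrow> f = h"
proof
  fix x assume "\<And>a. R a f = R a h"
  from fun_cong[OF this[of "g x"], of x] show "f x = h x" by (simp add: restrict_chain_def)
qed

lemma R_outside: "f \<in> part Bs i q \<Longrightarrow> a \<notin> Bs \<Longrightarrow> R a f = 0"
  by (auto simp: part_iff restrict_chain_def fun_eq_iff)

lemma R_part_sing: "f \<in> part Bs i q \<Longrightarrow> R a f \<in> part {a} i q"
  by (auto simp: part_iff restrict_chain_def)

text \<open>The chain with prescribed degree parts: each generator reads its coefficient from the
  part of its own degree.\<close>

definition glue :: "'j set \<Rightarrow> ('j \<Rightarrow> chain) \<Rightarrow> chain" where
  "glue Bs w = (\<lambda>x. if g x \<in> Bs then w (g x) x else 0)"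

lemma glue:
  assumes "\<And>b. b \<in> Bs \<Longrightarrow> w b \<in> part {b} i q"
  shows "glue Bs w \<in> part Bs i q" and "b \<in> Bs \<Longrightarrow> R b (glue Bs w) = w b"
proof -
  show "glue Bs w \<in> part Bs i q"
    unfolding part_iff
  proof (intro allI impI)
    fix x assume "glue Bs w x \<noteq> 0"
    then have "g x \<in> Bs" "w (g x) x \<noteq> 0" by (auto simp: glue_def split: if_splits)
    then show "x \<in> states_in_degree D i q \<and> g x \<in> Bs"
      using assms[of "g x"] unfolding part_iff by blast
  qed
  show "R b (glue Bs w) = w b" if "b \<in> Bs"
  proof
    fix x show "R b (glue Bs w) x = w b x"
    proof (cases "g x = b")
      case False
      then have "w b x = 0" using assms[OF that] unfolding part_iff by blast
      then show ?thesis using False by (simp add: restrict_chain_def)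
    qed (simp add: glue_def restrict_chain_def that)
  qed
qed

text \<open>\<open>bd0\<close> preserves the degree, so a chain is a cycle or a boundary exactly
  when each of its degree parts is. \<open>R b\<close> extracts the parts and \<open>glue\<close>
  reassembles them.\<close>

lemma direct_sum_presentation:
  obtains Phi where
    "Phi \<in> linear_maps (subspace_of (C i q) (part_cycles Bs i q)) (direct_sum Bs (\<lambda>b. gr_homology D J g b i q))"
    "carrier (direct_sum Bs (\<lambda>b. gr_homology D J g b i q)) \<subseteq> Phi ` part_cycles Bs i q"
    "\<And>f. f \<in> part_cycles Bs i q \<Longrightarrow>
       Phi f = \<zero>\<^bsub>direct_sum Bs (\<lambda>b. gr_homology D J g b i q)\<^esub> \<longleftrightarrow> f \<in> bd0 ` part Bs (i - 1) q"
proof -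
  let ?H = "\<lambda>b. gr_homology D J g b i q"
  have "\<forall>b. \<exists>eta. eta \<in> linear_maps (subspace_of (C i q) (part_cycles {b} i q)) (?H b) \<and>
      carrier (?H b) \<subseteq> eta ` part_cycles {b} i q \<and>
      (\<forall>f \<in> part_cycles {b} i q. eta f = \<zero>\<^bsub>?H b\<^esub> \<longleftrightarrow> f \<in> bd0 ` part {b} (i - 1) q)"
    using gr_homology_presentation[of _ i q] by (metis (no_types, lifting))
  then obtain eta where lin: "eta b \<in> linear_maps (subspace_of (C i q) (part_cycles {b} i q)) (?H b)"
    and onto: "carrier (?H b) \<subseteq> eta b ` part_cycles {b} i q"
    and ker: "f \<in> part_cycles {b} i q \<Longrightarrow> eta b f = \<zero>\<^bsub>?H b\<^esub> \<longleftrightarrow> f \<in> bd0 ` part {b} (i - 1) q" for b f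
    by metis
  note linD = linear_mapsD[OF lin, simplified]
  have R_part_cycles: "R b f \<in> part_cycles {b} i q" if "f \<in> part_cycles Bs i q" for f b
    using that R_part_sing restrict_preserving[of g b "enhanced_states D" "boundary_coeff D" f]
    by (auto simp: part_cycles_def restrict_chain_linear)
  have eta0: "eta b 0 = \<zero>\<^bsub>?H b\<^esub>" for b
    using linear_maps_zero[OF module_subspace_of[OF module_free_space part_cycles_submodule] module_gr_homology lin] by simp
  define Phi where "Phi f = (\<lambda>b\<in>Bs. eta b (R b f))" for f
  show thesis
  proof (rule that[of Phi])
    show "Phi \<in> linear_maps (subspace_of (C i q) (part_cycles Bs i q)) (direct_sum Bs ?H)"
    proof (rule linear_mapsI)
      fix f assume "f \<in> carrier (subspace_of (C i q) (part_cycles Bs i q))"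
      then have f: "f \<in> part_cycles Bs i q" by simp
      \<comment> \<open>Only degrees attained by one of the finitely many states occur, which gives
        the finite support required in the direct sum even for infinite \<open>Bs\<close>.\<close>
      have "{b \<in> Bs. Phi f b \<noteq> \<zero>\<^bsub>?H b\<^esub>} \<subseteq> g ` enhanced_states D"
      proof
        fix b assume "b \<in> {b \<in> Bs. Phi f b \<noteq> \<zero>\<^bsub>?H b\<^esub>}"
        then have "R b f \<noteq> 0" using eta0 by (auto simp: Phi_def)
        then show "b \<in> g ` enhanced_states D"
        proof -
          from \<open>R b f \<noteq> 0\<close> obtain x where "f x \<noteq> 0" "g x = b"
            by (auto simp: restrict_chain_def fun_eq_iff split: if_splits)
          then have "x \<in> enhanced_states D" using f C.st_subset[of i q] unfolding part_cycles_def part_iff by blast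
          then show ?thesis using \<open>g x = b\<close> by blast
        qed
      qed
      then have "finite {b \<in> Bs. Phi f b \<noteq> \<zero>\<^bsub>?H b\<^esub>}"
        using finite_subset C.finite_Om by blast
      then show "Phi f \<in> carrier (direct_sum Bs ?H)"
        using linD(1) R_part_cycles[OF f] by (auto simp: direct_sum_simps Phi_def)
      show "Phi (k \<odot>\<^bsub>subspace_of (C i q) (part_cycles Bs i q)\<^esub> f) = k \<odot>\<^bsub>direct_sum Bs ?H\<^esub> Phi f" for k
        using linD(3)[OF R_part_cycles[OF f]] by (auto simp: direct_sum_simps Phi_def restrict_chain_linear intro!: restrict_ext)
      fix h assume "h \<in> carrier (subspace_of (C i q) (part_cycles Bs i q))"
      then show "Phi (f \<oplus>\<^bsub>subspace_of (C i q) (part_cycles Bs i q)\<^esub> h) = Phi f \<oplus>\<^bsub>direct_sum Bs ?H\<^esub> Phi h"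
        using linD(2)[OF R_part_cycles[OF f] R_part_cycles] by (auto simp: direct_sum_simps Phi_def restrict_chain_linear intro!: restrict_ext)
    qed
    show "carrier (direct_sum Bs ?H) \<subseteq> Phi ` part_cycles Bs i q"
    proof
      fix phi assume phi: "phi \<in> carrier (direct_sum Bs ?H)"
      have "\<forall>b\<in>Bs. \<exists>w. w \<in> part_cycles {b} i q \<and> phi b = eta b w"
      proof
        fix b assume "b \<in> Bs"
        then have "phi b \<in> eta b ` part_cycles {b} i q"
          using onto[of b] phi by (auto simp: direct_sum_simps PiE_iff)
        then show "\<exists>w. w \<in> part_cycles {b} i q \<and> phi b = eta b w" by blast
      qed
      then obtain w where w: "\<And>b. b \<in> Bs \<Longrightarrow> w b \<in> part_cycles {b} i q \<and> phi b = eta b (w b)" by metis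
      define f where "f = glue Bs w"
      have f: "f \<in> part Bs i q" "\<And>b. b \<in> Bs \<Longrightarrow> R b f = w b"
        unfolding f_def using glue[of Bs w i q] w by (auto simp: part_cycles_def)
      have "bd0 f = 0"
      proof (rule R_ext)
        fix b show "R b (bd0 f) = R b 0"
          using R_outside[OF f(1), of b] f(2)[of b] w[of b]
          by (cases "b \<in> Bs") (auto simp: restrict_preserving restrict_chain_linear apply_matrix_linear part_cycles_def)
      qed
      then have "f \<in> part_cycles Bs i q" using f by (simp add: part_cycles_def)
      moreover have "Phi f = phi"
      proof -
        have "Phi f = restrict phi Bs" unfolding Phi_def by (rule restrict_ext) (use f(2) w in auto)
        then show ?thesis using phi by (auto simp: direct_sum_simps PiE_iff extensional_restrict)
      qed
      ultimately show "phi \<in> Phi ` part_cycles Bs i q" by blast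
    qed
    fix f assume f: "f \<in> part_cycles Bs i q"
    have "Phi f = \<zero>\<^bsub>direct_sum Bs ?H\<^esub> \<longleftrightarrow> (\<forall>b\<in>Bs. eta b (R b f) = \<zero>\<^bsub>?H b\<^esub>)"
      unfolding Phi_def direct_sum_simps(2) fun_eq_iff restrict_apply by meson
    also have "\<dots> \<longleftrightarrow> (\<forall>b\<in>Bs. R b f \<in> bd0 ` part {b} (i - 1) q)"
      using ker[OF R_part_cycles[OF f]] by simp
    also have "\<dots> \<longleftrightarrow> f \<in> bd0 ` part Bs (i - 1) q"
    proof
      assume "\<forall>b\<in>Bs. R b f \<in> bd0 ` part {b} (i - 1) q"
      then have "\<forall>b\<in>Bs. \<exists>w. w \<in> part {b} (i - 1) q \<and> R b f = bd0 w" by blast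
      then obtain w where w: "\<And>b. b \<in> Bs \<Longrightarrow> w b \<in> part {b} (i - 1) q \<and> R b f = bd0 (w b)" by metis
      note gl = glue[of Bs w "i - 1" q]
      have "f = bd0 (glue Bs w)"
      proof (rule R_ext)
        fix b show "R b f = R b (bd0 (glue Bs w))"
        proof (cases "b \<in> Bs")
          case True
          then show ?thesis using gl(2)[of b] w by (simp add: restrict_preserving)
        next
          case False
          have "R b f = 0" using f R_outside[OF _ False] by (auto simp: part_cycles_def)
          moreover have "R b (glue Bs w) = 0" using gl(1) w R_outside[OF _ False] by blast
          ultimately show ?thesis by (simp add: restrict_preserving apply_matrix_linear)
        qed
      qed
      then show "f \<in> bd0 ` part Bs (i - 1) q" using gl(1) w by blast
    next
      assume "f \<in> bd0 ` part Bs (i - 1) q"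
      then show "\<forall>b\<in>Bs. R b f \<in> bd0 ` part {b} (i - 1) q"
        using R_part_sing by (auto simp: restrict_preserving)
    qed
    finally show "Phi f = \<zero>\<^bsub>direct_sum Bs ?H\<^esub> \<longleftrightarrow> f \<in> bd0 ` part Bs (i - 1) q" .
  qed
qed

end

section \<open>From the multidegree to the spectral sequence\<close>

lemma apply_matrix_cong:
  "(\<And>x y. x \<in> X \<Longrightarrow> y \<in> X \<Longrightarrow> c x y = c' x y) \<Longrightarrow> apply_matrix X c = apply_matrix X c'"
  by (auto simp: apply_matrix_def fun_eq_iff intro!: sum.cong)

text \<open>The operations are pointwise and the carrier is overwritten by \<open>N\<close>, so the
  generating set leaves no trace. This matches the domains of presentations that come from different
  generating sets.\<close>

lemma subspace_of_free_space: "subspace_of (free_space X) N = subspace_of (free_space Y) N"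
  by (simp add: subspace_of_def free_space_def)

text \<open>One space of chains carries three matrices: all entries, those keeping the annular
  degree \<open>k\<close>, and those keeping the full degree \<open>g\<close>. The pages come from
  the second, filtered by the coordinate sum \<open>e\<close>; its homology is \<open>AKh\<close>,
  and its \<open>e\<close>-preserving part is the third, whose homology is
  \<open>MKh\<close>.\<close>

lemma spectral_sequence_of_filtered_complex:
  assumes C: "graded_complex (enhanced_states D) (states_in_degree D) (boundary_coeff D)"
    and filt: "\<And>x y. x \<in> enhanced_states D \<Longrightarrow> y \<in> enhanced_states D \<Longrightarrow> boundary_coeff D x y \<noteq> 0 \<Longrightarrow>
      g_degree P D y \<le> g_degree P D x"
    and P: "finite P" "p \<in> P"
  shows "\<exists>(E :: nat \<Rightarrow> int \<Rightarrow> int \<Rightarrow> int \<Rightarrow> chain set qspace) d.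
           spectral_sequence E d \<and>
           (\<forall>a i q. isomorphic_spaces (E 1 a i q) (MKh_flat P D a i q)) \<and>
           converges_to E d (AKh p D)"
proof -
  interpret C: graded_complex "enhanced_states D" "states_in_degree D" "boundary_coeff D" by (rule C)
  define Om where "Om = enhanced_states D"
  define g where "g = g_degree P D"
  define k where "k = k_degree p D"
  define c where "c = boundary_coeff D"
  define e where "e x = (\<Sum>z\<in>P. g x z)" for x
  have k_g: "k x = g x p" for x using P by (simp add: k_def g_def k_degree_def g_degree_def)
  have filt_g: "g y \<le> g x" if "x \<in> Om" "y \<in> Om" "c x y \<noteq> 0" for x y
    using filt that by (simp add: Om_def g_def c_def)
  have filt_k: "k y \<le> k x" if "x \<in> Om" "y \<in> Om" "c x y \<noteq> 0" for x y
    using filt_g[OF that] by (simp add: k_g le_fun_def)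
  have filt_e: "e y \<le> e x" if "x \<in> Om" "y \<in> Om" "c x y \<noteq> 0" for x y
    using filt_g[OF that] by (auto simp: e_def le_fun_def intro: sum_mono)
  \<comment> \<open>Along a nonzero entry no coordinate rises, so a strict drop at one puncture
    could not be compensated elsewhere.\<close>
  have e_g: "e x = e y \<longleftrightarrow> g x = g y" if "x \<in> Om" "y \<in> Om" "c x y \<noteq> 0" for x y
  proof
    assume "e x = e y"
    show "g x = g y"
    proof (rule ccontr)
      assume "g x \<noteq> g y"
      then obtain z where z: "g x z \<noteq> g y z" by (auto simp: fun_eq_iff)
      then have "z \<in> P" by (auto simp: g_def g_degree_def split: if_splits)
      moreover have "g y z < g x z" using filt_g[OF that] z by (simp add: le_fun_def less_le)
      ultimately have "e y < e x"
        unfolding e_def using filt_g[OF that] P(1) by (intro sum_strict_mono_ex1) (auto simp: le_fun_def)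
      then show False using \<open>e x = e y\<close> by simp
    qed
  qed (simp add: e_def)
  interpret K: filtered_CKh D k UNIV
    by unfold_locales (use filt_k in \<open>auto simp: Om_def c_def\<close>)
  interpret G: filtered_CKh D g "Z_punctures P"
    by unfold_locales (use filt_g in \<open>auto simp: Om_def c_def g_def g_degree_def Z_punctures_def\<close>)
  interpret S: filtered_complex Om "states_in_degree D" "preserving k c" e
  proof unfold_locales
    show "finite Om" "states_in_degree D i q \<subseteq> Om" for i q
      using C.finite_Om C.st_subset by (auto simp: Om_def)
    show "y \<in> states_in_degree D (i + 1) q"
      if "x \<in> states_in_degree D i q" "y \<in> Om" "preserving k c x y \<noteq> 0" for x y i q
      using C.degree that by (auto simp: Om_def preserving_def c_def split: if_splits)
    show "e y \<le> e x" if "x \<in> Om" "y \<in> Om" "preserving k c x y \<noteq> 0" for x y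
      using filt_e that by (auto simp: preserving_def split: if_splits)
    fix x y assume xy: "x \<in> Om" "y \<in> Om"
    show "(\<Sum>m\<in>Om. preserving k c x m * preserving k c m y) = 0"
    proof (cases "k x = k y")
      case True
      \<comment> \<open>An intermediate generator has \<open>k y \<le> k m \<le> k x\<close>; with
        equal ends both edges keep \<open>k\<close>, so the square of the submatrix agrees with the
        square of the full matrix.\<close>
      have "preserving k c x m * preserving k c m y = c x m * c m y" if "m \<in> Om" for m
      proof (cases "c x m \<noteq> 0 \<and> c m y \<noteq> 0")
        case t: True
        then have "k m = k x" using filt_k[of x m] filt_k[of m y] xy that True by simp
        then show ?thesis using True by (simp add: preserving_def)
      qed (auto simp: preserving_def)
      then show ?thesis using C.square xy by (simp add: Om_def c_def)
    next
      case False
      then show ?thesis by (auto simp: preserving_def intro: sum.neutral)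
    qed
  qed
  \<comment> \<open>\<open>k\<close> is the coordinate of \<open>g\<close> at \<open>p\<close>, so
    an entry that keeps \<open>g\<close> also keeps \<open>k\<close>.\<close>
  have bd0: "apply_matrix Om (preserving e (preserving k c)) = apply_matrix Om (preserving g c)"
  proof (rule apply_matrix_cong)
    fix x y assume xy: "x \<in> Om" "y \<in> Om"
    show "preserving e (preserving k c) x y = preserving g c x y"
      using e_g[OF xy] by (cases "c x y = 0") (auto simp: preserving_def k_g)
  qed
  have "isomorphic_spaces (S.E 1 a i q) (MKh_flat P D a i q)" for a i q
  proof -
    define Bs where "Bs = {b \<in> Z_punctures P. (\<Sum>z\<in>P. b z) = a}"
    have MKh: "MKh_flat P D a i q = direct_sum Bs (\<lambda>b. gr_homology D (Z_punctures P) g b i q)"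
      by (simp add: MKh_flat_def MKh_def Bs_def g_def)
    have "g x \<in> Z_punctures P" for x by (simp add: g_def g_degree_def Z_punctures_def)
    then have part: "{x \<in> states_in_degree D i q. e x = a} = {x \<in> states_in_degree D i q. g x \<in> Bs}" for i
      by (auto simp: Bs_def e_def)
    have cyc: "{f \<in> carrier (free_space {x \<in> states_in_degree D i q. e x = a}). apply_matrix Om (preserving e (preserving k c)) f = 0} = G.part_cycles Bs i q"
      unfolding G.part_cycles_def G.part_def part bd0 by (simp add: Om_def c_def)
    obtain Phi where Phi:
      "Phi \<in> linear_maps (subspace_of (G.C i q) (G.part_cycles Bs i q)) (MKh_flat P D a i q)"
      "carrier (MKh_flat P D a i q) \<subseteq> Phi ` G.part_cycles Bs i q"
      "\<And>f. f \<in> G.part_cycles Bs i q \<Longrightarrow> Phi f = \<zero>\<^bsub>MKh_flat P D a i q\<^esub> \<longleftrightarrow> f \<in> G.bd0 ` G.part Bs (i - 1) q"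
      using G.direct_sum_presentation[of i q Bs] unfolding MKh by blast
    show ?thesis
    proof (rule S.E_one[where Phi = Phi])
      show "module rat_field (MKh_flat P D a i q)"
        unfolding MKh by (rule module_direct_sum) (rule G.module_gr_homology)
      fix f assume "f \<in> carrier (free_space {x \<in> states_in_degree D i q. e x = a})"
        "apply_matrix Om (preserving e (preserving k c)) f = 0"
      then have "f \<in> G.part_cycles Bs i q" using cyc by blast
      from Phi(3)[OF this]
      show "Phi f = \<zero>\<^bsub>MKh_flat P D a i q\<^esub> \<longleftrightarrow> f \<in> apply_matrix Om (preserving e (preserving k c)) `
          carrier (free_space {x \<in> states_in_degree D (i - 1) q. e x = a})"
        unfolding G.part_def part bd0 by (simp add: Om_def c_def)
    qed (use Phi in \<open>simp_all only: cyc subspace_of_free_space[of "{x \<in> states_in_degree D i q. e x = a}" _ "states_in_degree D i q"]\<close>)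
  qed
  moreover have "converges_to S.E S.d (AKh p D)"
  proof -
    have AKh: "AKh p D i q = direct_sum UNIV (\<lambda>a. gr_homology D UNIV k a i q)" for i q
      by (simp add: AKh_def k_def)
    have part: "K.part UNIV i q = carrier (free_space (states_in_degree D i q))" for i q
      by (simp add: K.part_def)
    have cyc: "K.part_cycles UNIV i q = S.cycles i q" for i q
      unfolding K.part_cycles_def part S.cycles_def by (simp add: Om_def c_def)
    have "\<exists>Phi. Phi \<in> linear_maps (subspace_of (K.C i q) (S.cycles i q)) (AKh p D i q) \<and>
      carrier (AKh p D i q) \<subseteq> Phi ` S.cycles i q \<and>
      (\<forall>f\<in>S.cycles i q. Phi f = \<zero>\<^bsub>AKh p D i q\<^esub> \<longleftrightarrow> f \<in> S.bd ` carrier (free_space (states_in_degree D (i - 1) q)))" for i q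
    proof -
      have bd: "K.bd0 = S.bd" by (simp add: Om_def c_def)
      obtain Phi where "Phi \<in> linear_maps (subspace_of (K.C i q) (K.part_cycles UNIV i q)) (direct_sum UNIV (\<lambda>a. gr_homology D UNIV k a i q))"
        "carrier (direct_sum UNIV (\<lambda>a. gr_homology D UNIV k a i q)) \<subseteq> Phi ` K.part_cycles UNIV i q"
        "\<And>f. f \<in> K.part_cycles UNIV i q \<Longrightarrow>
          Phi f = \<zero>\<^bsub>direct_sum UNIV (\<lambda>a. gr_homology D UNIV k a i q)\<^esub> \<longleftrightarrow> f \<in> K.bd0 ` K.part UNIV (i - 1) q"
        using K.direct_sum_presentation[of i q UNIV] by blast
      then show ?thesis unfolding AKh cyc part bd by blast
    qed
    then obtain Psi where Psi: "\<And>i q. Psi i q \<in> linear_maps (subspace_of (K.C i q) (S.cycles i q)) (AKh p D i q)"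
      "\<And>i q. carrier (AKh p D i q) \<subseteq> Psi i q ` S.cycles i q"
      "\<And>i q f. f\<in>S.cycles i q \<Longrightarrow> Psi i q f = \<zero>\<^bsub>AKh p D i q\<^esub> \<longleftrightarrow> f \<in> S.bd ` carrier (free_space (states_in_degree D (i - 1) q))"
      by metis
    show ?thesis
    proof (rule S.converges_to_homology[OF _ Psi])
      show "module rat_field (AKh p D i q)" for i q
        unfolding AKh by (rule module_direct_sum) (rule K.module_gr_homology)
    qed
  qed
  ultimately show ?thesis using S.spectral_sequence_E by blast
qed

section \<open>The cube of resolutions\<close>

definition crossing_disk :: "crossing \<Rightarrow> complex set" where
  "crossing_disk c = cball (center c) (radius c)"

text \<open>The affected circles of an edge at \<open>j\<close>, named by where they lie rather than
  by comparing two vertices; this makes them comparable around a square of the cube.\<close>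

definition touching :: "diagram \<Rightarrow> nat \<Rightarrow> nat set \<Rightarrow> complex set set" where
  "touching D j S = {C \<in> circles D S. C \<inter> crossing_disk (crossings D ! j) \<noteq> {}}"

text \<open>What the algebra of the cube needs from the plane to yield a graded complex. The
  condition \<open>merge_or_split\<close> rules out an edge that turns one circle into one circle;
  \<open>same_elsewhere\<close> serves to follow circles through two crossing disks around a
  square.\<close>

locale resolution_cube =
  fixes D :: diagram
  assumes finite_circles: "S \<subseteq> {..<length (crossings D)} \<Longrightarrow> finite (circles D S)"
    and untouched: "S \<subseteq> {..<length (crossings D)} \<Longrightarrow> j < length (crossings D) \<Longrightarrow> j \<notin> S \<Longrightarrow>
      circles D S - touching D j S = circles D (insert j S) - touching D j (insert j S)"
    and touching_disjoint: "S \<subseteq> {..<length (crossings D)} \<Longrightarrow> j < length (crossings D) \<Longrightarrow> j \<notin> S \<Longrightarrow>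
      touching D j S \<inter> touching D j (insert j S) = {}"
    and merge_or_split: "S \<subseteq> {..<length (crossings D)} \<Longrightarrow> j < length (crossings D) \<Longrightarrow> j \<notin> S \<Longrightarrow>
      card (touching D j S) = 2 \<and> card (touching D j (insert j S)) = 1 \<or>
      card (touching D j S) = 1 \<and> card (touching D j (insert j S)) = 2"
    and same_elsewhere: "i < length (crossings D) \<Longrightarrow> j < length (crossings D) \<Longrightarrow> i \<noteq> j \<Longrightarrow>
      resolved D (insert i S) \<inter> crossing_disk (crossings D ! j) = resolved D S \<inter> crossing_disk (crossings D ! j)"
begin

abbreviation n :: nat where "n \<equiv> length (crossings D)"

lemma touching_subset: "touching D j S \<subseteq> circles D S"
  by (auto simp: touching_def)

lemma finite_touching: "S \<subseteq> {..<n} \<Longrightarrow> finite (touching D j S)"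
  by (rule finite_subset[OF touching_subset finite_circles])

lemma circles_Int:
  assumes S: "S \<subseteq> {..<n}" "j < n" "j \<notin> S"
  shows "circles D S \<inter> circles D (insert j S) = circles D S - touching D j S"
    and "circles D S - circles D (insert j S) = touching D j S"
    and "circles D (insert j S) - circles D S = touching D j (insert j S)"
proof -
  have aux: "X \<inter> Y = X - T \<and> X - Y = T \<and> Y - X = T'"
    if "X - T = Y - T'" "T \<inter> T' = {}" "T \<subseteq> X" "T' \<subseteq> Y" for X Y T T' :: "complex set set"
    using that by blast
  show "circles D S \<inter> circles D (insert j S) = circles D S - touching D j S"
    and "circles D S - circles D (insert j S) = touching D j S"
    and "circles D (insert j S) - circles D S = touching D j (insert j S)"
    using aux[OF untouched[OF S] touching_disjoint[OF S] touching_subset touching_subset] by simp_all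
qed

text \<open>Merge and split obey one rule. In a merge, ++ to + counts 0 + 1 and +- to - counts 1 +
  0; in a split, + to +- counts 0 + 1 and - to -- counts 1 + 0. Every other labelling of the three
  circles gives 0, 2 or 3.\<close>

lemma edge_coeff_insert:
  assumes S: "S \<subseteq> {..<n}" "j < n" "j \<notin> S" and X: "X \<subseteq> circles D S" and Y: "Y \<subseteq> circles D (insert j S)"
  shows "edge_coeff D (S, X) (insert j S, Y) =
    of_bool ((\<forall>C \<in> circles D S - touching D j S. C \<in> X \<longleftrightarrow> C \<in> Y) \<and>
      card (touching D j S - X) + card (touching D j (insert j S) \<inter> Y) = 1)"
proof -
  let ?T = "touching D j S" and ?T' = "touching D j (insert j S)"
  have fin: "finite ?T" "finite ?T'" using finite_touching S by auto
  have "card (?T - X) = card ?T - card (?T \<inter> X)"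
    using card_Diff_subset_Int[of ?T X] fin by auto
  moreover have "card (?T \<inter> X) \<le> card ?T" "card (?T' \<inter> Y) \<le> card ?T'"
    using fin by (auto intro: card_mono)
  ultimately have k: "card ?T = 2 \<and> card ?T' = 1 \<Longrightarrow> (card (?T \<inter> X) = 2 \<and> card (?T' \<inter> Y) = 1 \<or>
        card (?T \<inter> X) = 1 \<and> card (?T' \<inter> Y) = 0) = (card (?T - X) + card (?T' \<inter> Y) = 1)"
      "card ?T = 1 \<and> card ?T' = 2 \<Longrightarrow> (card (?T \<inter> X) = 1 \<and> card (?T' \<inter> Y) = 1 \<or>
        card (?T \<inter> X) = 0 \<and> card (?T' \<inter> Y) = 0) = (card (?T - X) + card (?T' \<inter> Y) = 1)"
    by arith+
  have lab: "(\<forall>C\<in>circles D S - ?T. label (S, X) C = label (insert j S, Y) C) \<longleftrightarrow>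
      (\<forall>C\<in>circles D S - ?T. C \<in> X \<longleftrightarrow> C \<in> Y)"
    by (rule ball_cong) (auto simp: label_def)
  show ?thesis
    using merge_or_split[OF S]
  proof (elim disjE)
    assume m: "card ?T = 2 \<and> card ?T' = 1"
    then show ?thesis
      unfolding edge_coeff_def Let_def fst_conv snd_conv circles_Int[OF S] lab k(1)[OF m] by simp
  next
    assume m: "card ?T = 1 \<and> card ?T' = 2"
    then show ?thesis
      unfolding edge_coeff_def Let_def fst_conv snd_conv circles_Int[OF S] lab k(2)[OF m] by simp
  qed
qed

lemma boundary_coeff_insert:
  assumes "j < n" "j \<notin> S"
  shows "boundary_coeff D (S, X) (insert j S, Y) = (- 1) ^ card {i \<in> S. i < j} * edge_coeff D (S, X) (insert j S, Y)"
proof -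
  have "{k. k < n \<and> k \<notin> fst (S, X) \<and> fst (insert j S, Y) = insert k (fst (S, X))} = {j}"
    using assms by auto
  then show ?thesis by (simp add: boundary_coeff_def)
qed

lemma boundary_coeff_nonzero:
  assumes "boundary_coeff D x y \<noteq> 0"
  obtains j where "j < n" "j \<notin> fst x" "fst y = insert j (fst x)" "edge_coeff D x y \<noteq> 0"
proof -
  have "{k. k < n \<and> k \<notin> fst x \<and> fst y = insert k (fst x)} \<noteq> {}"
    using assms unfolding boundary_coeff_def by (metis (no_types, lifting) sum.empty)
  moreover have "edge_coeff D x y \<noteq> 0"
    using assms unfolding boundary_coeff_def by (metis (no_types, lifting) mult_zero_right sum.neutral)
  ultimately show thesis using that by blast
qed

text \<open>Switching the resolution at \<open>i\<close> keeps the diagram inside the disk of another crossing \<open>j\<close>, so a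
  circle through both disks exists before if and only if one exists afterwards.\<close>

lemma touching_both:
  assumes S: "S \<subseteq> {..<n}" "i < n" "i \<notin> S" and j: "j < n" "j \<noteq> i"
  shows "touching D i S \<inter> touching D j S = {} \<longleftrightarrow>
    touching D i (insert i S) \<inter> touching D j (insert i S) = {}"
proof -
  have disj: "C = C'" if "C \<in> circles D R" "C' \<in> circles D R" "p \<in> C" "p \<in> C'" for C C' R p
    using components_eq[of C "resolved D R" C'] that by (auto simp: circles_def)
  have *: "touching D i R \<inter> touching D j R \<noteq> {} \<Longrightarrow> touching D i R' \<inter> touching D j R' \<noteq> {}"
    if u: "circles D R - touching D i R = circles D R' - touching D i R'"
      and a: "resolved D R \<inter> crossing_disk (crossings D ! j) = resolved D R' \<inter> crossing_disk (crossings D ! j)" for R R'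
  proof -
    assume "touching D i R \<inter> touching D j R \<noteq> {}"
    then obtain C p where C: "C \<in> circles D R" "C \<in> touching D i R" "p \<in> C" "p \<in> crossing_disk (crossings D ! j)"
      by (auto simp: touching_def)
    then have "p \<in> resolved D R'"
      using a in_components_subset[of C "resolved D R"] by (auto simp: circles_def)
    then obtain C' where C': "C' \<in> circles D R'" "p \<in> C'"
      unfolding circles_def using Union_components[of "resolved D R'"] by blast
    have "C' \<in> touching D i R'"
    proof (rule ccontr)
      assume "C' \<notin> touching D i R'"
      then have "C' \<in> circles D R - touching D i R" using u C' by blast
      then show False using disj[of C R C' p] C C' by blast
    qed
    moreover have "C' \<in> touching D j R'" using C' C by (auto simp: touching_def)
    ultimately show ?thesis by blast
  qed
  have j': "i \<noteq> j" using j by blast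
  show ?thesis
    using *[OF untouched[OF S], OF same_elsewhere[OF S(2) j(1) j', symmetric]]
      *[OF untouched[OF S, symmetric], OF same_elsewhere[OF S(2) j(1) j']] by blast
qed

section \<open>Squares of the cube\<close>

text \<open>\<open>V\<close> is the set of free circles labelled +. Each free circle counts once, as
  an outgoing + of the first step or as an incoming - of the second, so a nonzero term has
  \<open>a + b + card U = 2\<close>. With two free circles exactly one of them is +, whence the
  factor 2.\<close>

lemma sum_subsets_card:
  assumes "finite U" "card U \<le> 2"
  shows "(\<Sum>V\<in>Pow U. of_bool (a + card V = 1 \<and> b + card (U - V) = 1) :: rat) =
    (if card U = 0 then of_bool (a = 1 \<and> b = 1)
     else if card U = 1 then of_bool (a + b = 1) else 2 * of_bool (a + b = (0::nat)))"
proof -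
  consider "card U = 0" | "card U = 1" | "card U = 2" using assms by linarith
  then show ?thesis
  proof cases
    case 1
    then have "U = {}" using assms by simp
    then show ?thesis by simp
  next
    case 2
    then obtain u where "U = {u}" by (auto simp: card_1_singleton_iff)
    have P: "Pow {u} = {{}, {u}}" by auto
    show ?thesis unfolding \<open>U = {u}\<close> P by (auto simp: of_bool_def)
  next
    case 3
    then obtain u v where uv: "U = {u, v}" "u \<noteq> v" by (auto simp: card_2_iff)
    have P: "Pow {u, v} = {{}, {u}, {v}, {u, v}}" by auto
    have "{u, v} - {u} = {v}" "{u, v} - {v} = {u}" using uv by auto
    then show ?thesis using uv(2) unfolding uv(1) P by (simp add: doubleton_eq_iff)
  qed
qed

text \<open>Only the labels of the intermediate circles \<open>U\<close> that meet both crossing disks are not forced, and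
  \<open>u = card U\<close> because each of the two steps affects three circles in total.\<close>

lemma square_sum:
  assumes S: "S \<subseteq> {..<n}" "i < n" "j < n" "i \<notin> S" "j \<notin> S" "i \<noteq> j"
    and X: "X \<subseteq> circles D S" and Y: "Y \<subseteq> circles D (insert j (insert i S))"
  defines "S'' \<equiv> insert j (insert i S)"
  defines "A \<equiv> touching D i S \<union> touching D j S" and "B \<equiv> touching D i S'' \<union> touching D j S''"
  defines "s \<equiv> card (A - X) + card (B \<inter> Y)"
  defines "u \<equiv> (6 - card A - card B) div 2"
  shows "(\<Sum>M\<in>Pow (circles D (insert i S)). edge_coeff D (S, X) (insert i S, M) * edge_coeff D (insert i S, M) (S'', Y)) =
    of_bool (\<forall>C\<in>circles D S - A. C \<in> X \<longleftrightarrow> C \<in> Y) *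
    (if u = 0 then of_bool (card (touching D i S - X) + card (touching D i S'' \<inter> Y) = 1 \<and>
                            card (touching D j S - X) + card (touching D j S'' \<inter> Y) = 1)
     else if u = 1 then of_bool (s = 1) else 2 * of_bool (s = 0))"
proof -
  define S' where "S' = insert i S"
  have S': "S' \<subseteq> {..<n}" "j \<notin> S'" and S'': "S'' = insert j S'" "S'' \<subseteq> {..<n}"
    using S by (auto simp: S'_def S''_def)
  have e1: "circles D S - touching D i S = circles D S' - touching D i S'"
    using untouched[OF S(1,2,4)] by (simp add: S'_def)
  have e2: "circles D S' - touching D j S' = circles D S'' - touching D j S''"
    using untouched[OF S'(1) S(3) S'(2)] by (simp add: S'')
  define t where "t k C \<longleftrightarrow> C \<inter> crossing_disk (crossings D ! k) \<noteq> {}" for k C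
  have tch: "C \<in> touching D k R \<longleftrightarrow> C \<in> circles D R \<and> t k C" for C k R
    by (auto simp: touching_def t_def)
  have e1': "C \<in> circles D S \<and> \<not> t i C \<longleftrightarrow> C \<in> circles D S' \<and> \<not> t i C" for C
    using e1[THEN eqset_imp_iff, of C] by (simp add: tch) blast
  have e2': "C \<in> circles D S' \<and> \<not> t j C \<longleftrightarrow> C \<in> circles D S'' \<and> \<not> t j C" for C
    using e2[THEN eqset_imp_iff, of C] by (simp add: tch) blast
  define U where "U = touching D i S' \<inter> touching D j S'"
  define T1 where "T1 = touching D i S"
  define N1 where "N1 = touching D i S'"
  define T2 where "T2 = touching D j S'"
  define N2 where "N2 = touching D j S''"
  have fin: "finite U" "finite T1" "finite N1" "finite T2" "finite N2" "finite (circles D S')"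
    using finite_touching finite_circles S(1) S'(1) S''(2) by (auto simp: U_def T1_def N1_def T2_def N2_def)
  \<comment> \<open>A circle off the disk of \<open>i\<close> survives the first step, so the
    circles at \<open>j\<close> but not at \<open>i\<close> are the same for \<open>S\<close> and
    \<open>S'\<close>. The circles \<open>U\<close> through both disks at the middle vertex occur
    neither in \<open>A\<close> nor in \<open>B\<close>.\<close>
  have A: "A = T1 \<union> (T2 - U)" "T1 \<inter> (T2 - U) = {}"
    unfolding A_def T1_def T2_def U_def set_eq_iff Un_iff Int_iff Diff_iff tch using e1' by blast+
  have B: "B = N2 \<union> (N1 - U)" "N2 \<inter> (N1 - U) = {}"
    unfolding B_def N1_def N2_def U_def set_eq_iff Un_iff Int_iff Diff_iff tch using e2' by blast+
  have UN: "U \<subseteq> N1" "U \<subseteq> T2" by (auto simp: U_def N1_def T2_def)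
  have cU: "card U \<le> 2" "card U \<le> card T2" "card U \<le> card N1"
    using card_mono[OF fin(3) UN(1)] card_mono[OF fin(4) UN(2)] merge_or_split[OF S(1,2,4)]
    by (auto simp: N1_def S'_def)
  have "card A = card T1 + (card T2 - card U)"
    unfolding A(1) using A(2) fin UN by (subst card_Un_disjoint) (auto simp: card_Diff_subset)
  moreover have "card B = card N2 + (card N1 - card U)"
    unfolding B(1) using B(2) fin UN by (subst card_Un_disjoint) (auto simp: card_Diff_subset)
  moreover have "card T1 + card N1 = 3" "card T2 + card N2 = 3"
    using merge_or_split[OF S(1,2,4)] merge_or_split[OF S'(1) S(3) S'(2)]
    by (auto simp: T1_def N1_def T2_def N2_def S'_def S''_def)
  ultimately have u: "u = card U" using cU by (simp add: u_def)
  define cons where "cons \<longleftrightarrow> (\<forall>C\<in>circles D S - A. C \<in> X \<longleftrightarrow> C \<in> Y)"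
  define a where "a = card (T1 - X) + card ((N1 - U) \<inter> Y)"
  define b where "b = card ((T2 - U) - X) + card (N2 \<inter> Y)"
  have s: "s = a + b"
  proof -
    have "card (A - X) = card (T1 - X) + card (T2 - U - X)"
      unfolding A(1) Un_Diff using A(2) fin by (subst card_Un_disjoint) auto
    moreover have "card (B \<inter> Y) = card (N2 \<inter> Y) + card ((N1 - U) \<inter> Y)"
      unfolding B(1) Int_Un_distrib2 using B(2) fin by (subst card_Un_disjoint) auto
    ultimately show ?thesis by (simp add: s_def a_def b_def)
  qed
  \<comment> \<open>The forced + labels at the middle vertex: circles off the disk of
    \<open>i\<close> are labelled as in \<open>X\<close>, those at \<open>i\<close> alone as in
    \<open>Y\<close>. Only the labels on \<open>U\<close> remain free.\<close>
  define M0 where "M0 = ((circles D S' - N1) \<inter> X) \<union> ((N1 - U) \<inter> Y)"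
  have W: "circles D S - A = circles D S' - N1 - T2"
    unfolding A_def N1_def T2_def set_eq_iff Un_iff Diff_iff tch using e1' by blast
  let ?f = "\<lambda>M. edge_coeff D (S, X) (S', M) * edge_coeff D (S', M) (S'', Y)"
  have f: "?f M = of_bool ((\<forall>C\<in>circles D S' - N1. C \<in> X \<longleftrightarrow> C \<in> M) \<and> (\<forall>C\<in>circles D S' - T2. C \<in> M \<longleftrightarrow> C \<in> Y) \<and>
      card (T1 - X) + card (N1 \<inter> M) = 1 \<and> card (T2 - M) + card (N2 \<inter> Y) = 1)" if "M \<subseteq> circles D S'" for M
    using edge_coeff_insert[OF S(1,2,4) X, of M] edge_coeff_insert[OF S'(1) S(3) S'(2) that, of Y] that Y e1
    by (auto simp: S'_def[symmetric] S''(1)[symmetric] T1_def N1_def T2_def N2_def)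
  have f0: "?f M = 0" if "M \<subseteq> circles D S'" "M \<notin> (\<lambda>V. M0 \<union> V) ` Pow U \<or> \<not> cons" for M
  proof (rule ccontr)
    assume "?f M \<noteq> 0"
    then have c: "\<forall>C\<in>circles D S' - N1. C \<in> X \<longleftrightarrow> C \<in> M" "\<forall>C\<in>circles D S' - T2. C \<in> M \<longleftrightarrow> C \<in> Y"
      using f[OF that(1)] by (auto split: if_splits)
    have "N1 - U \<subseteq> circles D S' - T2" "N1 \<subseteq> circles D S'"
      by (auto simp: N1_def U_def T2_def tch)
    then have "M = M0 \<union> (M \<inter> U)" using c that(1) UN unfolding M0_def by blast
    moreover have cons using c W unfolding cons_def by blast
    ultimately show False using that(2) by blast
  qed
  have f1: "?f (M0 \<union> V) = of_bool (a + card V = 1 \<and> b + card (U - V) = 1)" if "V \<subseteq> U" cons for V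
  proof -
    have sub: "M0 \<union> V \<subseteq> circles D S'"
      using that(1) UN tch unfolding M0_def N1_def U_def by blast
    have c1: "\<forall>C\<in>circles D S' - N1. C \<in> X \<longleftrightarrow> C \<in> M0 \<union> V"
      using that(1) UN unfolding M0_def by blast
    have c2: "\<forall>C\<in>circles D S' - T2. C \<in> M0 \<union> V \<longleftrightarrow> C \<in> Y"
      using that UN W unfolding M0_def cons_def by blast
    have "N1 \<inter> (M0 \<union> V) = ((N1 - U) \<inter> Y) \<union> V"
      using that(1) UN unfolding M0_def by blast
    then have k1: "card (N1 \<inter> (M0 \<union> V)) = card ((N1 - U) \<inter> Y) + card V"
      using that(1) fin finite_subset[OF that(1)] by (subst \<open>N1 \<inter> (M0 \<union> V) = _\<close>, subst card_Un_disjoint) auto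
    have "T2 - U \<subseteq> circles D S' - N1" by (auto simp: T2_def U_def N1_def tch)
    then have "T2 - (M0 \<union> V) = ((T2 - U) - X) \<union> (U - V)"
      using that(1) UN unfolding M0_def by blast
    then have k2: "card (T2 - (M0 \<union> V)) = card ((T2 - U) - X) + card (U - V)"
      using fin by (subst \<open>T2 - (M0 \<union> V) = _\<close>, subst card_Un_disjoint) auto
    show ?thesis
      using f[OF sub] c1 c2 by (simp add: k1 k2 a_def b_def ac_simps)
  qed
  have inj: "inj_on (\<lambda>V. M0 \<union> V) (Pow U)"
  proof (rule inj_onI)
    have "M0 \<inter> U = {}" using UN unfolding M0_def by blast
    then show "V = V'" if "V \<in> Pow U" "V' \<in> Pow U" "M0 \<union> V = M0 \<union> V'" for V V'
      using that by blast
  qed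
  have img: "(\<lambda>V. M0 \<union> V) ` Pow U \<subseteq> Pow (circles D S')"
    using UN tch unfolding M0_def N1_def U_def by blast
  have "(\<Sum>M\<in>Pow (circles D S'). ?f M) = of_bool cons * (\<Sum>V\<in>Pow U. of_bool (a + card V = 1 \<and> b + card (U - V) = 1))"
  proof (cases cons)
    case True
    have "(\<Sum>M\<in>Pow (circles D S'). ?f M) = (\<Sum>M\<in>(\<lambda>V. M0 \<union> V) ` Pow U. ?f M)"
      by (rule sum.mono_neutral_right) (use fin img f0 in auto)
    also have "\<dots> = (\<Sum>V\<in>Pow U. ?f (M0 \<union> V))" by (rule sum.reindex[OF inj, unfolded o_def])
    also have "\<dots> = (\<Sum>V\<in>Pow U. of_bool (a + card V = 1 \<and> b + card (U - V) = 1))"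
      by (rule sum.cong) (use f1 True in auto)
    finally show ?thesis using True by simp
  next
    case False
    then show ?thesis using f0 by (simp add: sum.neutral)
  qed
  also have "\<dots> = of_bool cons * (if u = 0 then of_bool (a = 1 \<and> b = 1) else if u = 1 then of_bool (s = 1) else 2 * of_bool (s = 0))"
    using sum_subsets_card[OF fin(1) cU(1), of a b] by (simp add: u s)
  finally have sum: "(\<Sum>M\<in>Pow (circles D S'). ?f M) = of_bool cons *
    (if u = 0 then of_bool (a = 1 \<and> b = 1) else if u = 1 then of_bool (s = 1) else 2 * of_bool (s = 0))" .
  \<comment> \<open>For \<open>u = 0\<close> the two conditions stay separate, and \<open>a\<close>
    and \<open>b\<close> must be expressed by the end vertices. No middle circle meets both disks,
    so by \<open>touching_both\<close> none does at \<open>S\<close> or \<open>S''\<close>, and the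
    circles at one disk survive the step at the other.\<close>
  have "a = card (touching D i S - X) + card (touching D i S'' \<inter> Y) \<and>
      b = card (touching D j S - X) + card (touching D j S'' \<inter> Y)" if "u = 0"
  proof -
    have U0: "U = {}" using that u fin by simp
    have U0': "\<not> (C \<in> circles D S' \<and> t i C \<and> t j C)" for C
      using U0 tch unfolding U_def by blast
    have d1: "touching D i S \<inter> touching D j S = {}"
      using touching_both[OF S(1,2,4,3)] S(6) U0 by (auto simp: U_def S'_def)
    have d1': "\<not> (C \<in> circles D S \<and> t i C \<and> t j C)" for C
      using d1 tch by blast
    have "touching D j S = T2 - U"
    proof (rule Set.set_eqI)
      fix C show "C \<in> touching D j S \<longleftrightarrow> C \<in> T2 - U"
        using e1'[of C] d1'[of C] U0'[of C] by (simp add: T2_def U0 tch) blast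
    qed
    moreover have d2: "touching D j S'' \<inter> touching D i S'' = {}"
      using touching_both[OF S'(1) S(3) S'(2) S(2)] S(6) U0 by (auto simp: U_def S'' Int_commute)
    have d2': "\<not> (C \<in> circles D S'' \<and> t i C \<and> t j C)" for C
      using d2 tch by blast
    have "touching D i S'' = N1 - U"
    proof (rule Set.set_eqI)
      fix C show "C \<in> touching D i S'' \<longleftrightarrow> C \<in> N1 - U"
        using e2'[of C] d2'[of C] U0'[of C] by (simp add: N1_def U0 tch) blast
    qed
    ultimately show ?thesis by (simp add: a_def b_def T1_def N2_def)
  qed
  then show ?thesis
    using sum unfolding cons_def S'_def by (cases "u = 0") simp_all
qed

text \<open>The value found in \<open>square_sum\<close> involves only the two end vertices and is
  symmetric in \<open>i\<close> and \<open>j\<close>; in the case \<open>u = 0\<close> the two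
  conditions are merely exchanged.\<close>

lemma square_commutes:
  assumes S: "S \<subseteq> {..<n}" "i < n" "j < n" "i \<notin> S" "j \<notin> S" "i \<noteq> j"
    and X: "X \<subseteq> circles D S" and Y: "Y \<subseteq> circles D (insert j (insert i S))"
  shows "(\<Sum>M\<in>Pow (circles D (insert i S)). edge_coeff D (S, X) (insert i S, M) * edge_coeff D (insert i S, M) (insert j (insert i S), Y)) =
    (\<Sum>M\<in>Pow (circles D (insert j S)). edge_coeff D (S, X) (insert j S, M) * edge_coeff D (insert j S, M) (insert j (insert i S), Y))"
proof -
  have c: "insert j (insert i S) = insert i (insert j S)" by auto
  have Y': "Y \<subseteq> circles D (insert i (insert j S))" using Y c by simp
  show ?thesis
    using square_sum[OF S X Y] square_sum[OF S(1,3,2,5,4) S(6)[symmetric] X Y']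
    unfolding c by (simp add: Un_commute conj_commute add.commute diff_commute)
qed

lemma finite_enhanced_states: "finite (enhanced_states D)"
proof -
  have "enhanced_states D = Sigma (Pow {..<n}) (\<lambda>S. Pow (circles D S))"
    by (auto simp: enhanced_states_def)
  then show ?thesis using finite_circles by auto
qed

text \<open>A two-step path exists only between vertices that differ by two crossings
  \<open>i < j\<close>, and it passes through one of two middle vertices. The unsigned contributions
  of these agree by \<open>square_commutes\<close>, and their signs are opposite.\<close>

lemma boundary_square:
  assumes x: "x \<in> enhanced_states D" and y: "y \<in> enhanced_states D"
  shows "(\<Sum>m\<in>enhanced_states D. boundary_coeff D x m * boundary_coeff D m y) = 0"
proof (cases "\<exists>i j. i < n \<and> j < n \<and> i \<notin> fst x \<and> j \<notin> fst x \<and> i < j \<and> fst y = insert j (insert i (fst x))")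
  case False
  have "boundary_coeff D x m * boundary_coeff D m y = 0" for m
  proof (rule ccontr)
    assume nz: "boundary_coeff D x m * boundary_coeff D m y \<noteq> 0"
    obtain i where i: "i < n" "i \<notin> fst x" "fst m = insert i (fst x)"
      using boundary_coeff_nonzero[of x m] nz by auto
    obtain j where j: "j < n" "j \<notin> fst m" "fst y = insert j (fst m)"
      using boundary_coeff_nonzero[of m y] nz by auto
    show False
    proof (cases "i < j")
      case True
      have "fst y = insert j (insert i (fst x))" "j \<notin> fst x" using i j by auto
      then show ?thesis using False True i(1,2) j(1) by blast
    next
      case f: False
      then have "j < i" using i j by auto
      moreover have "fst y = insert i (insert j (fst x))" "j \<notin> fst x" using i j by auto
      ultimately show ?thesis using False i(1,2) j(1) by blast
    qed
  qed
  then show ?thesis by (simp add: sum.neutral)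
next
  case True
  then obtain i j where ij: "i < n" "j < n" "i \<notin> fst x" "j \<notin> fst x" "i < j" "fst y = insert j (insert i (fst x))" by blast
  obtain S X Y where xy: "x = (S, X)" "y = (insert j (insert i S), Y)"
    using ij(6) by (metis prod.collapse)
  have S: "S \<subseteq> {..<n}" "X \<subseteq> circles D S" "Y \<subseteq> circles D (insert j (insert i S))" "i \<notin> S" "j \<notin> S" "i \<noteq> j"
    using x y ij by (auto simp: xy enhanced_states_def)
  let ?h = "\<lambda>m. boundary_coeff D x m * boundary_coeff D m y"
  let ?Mi = "Pair (insert i S) ` Pow (circles D (insert i S))"
  let ?Mj = "Pair (insert j S) ` Pow (circles D (insert j S))"
  have sub: "?Mi \<union> ?Mj \<subseteq> enhanced_states D" using S ij by (auto simp: enhanced_states_def)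
  have zero: "?h m = 0" if m: "m \<in> enhanced_states D - (?Mi \<union> ?Mj)" for m
  proof (rule ccontr)
    assume nz: "?h m \<noteq> 0"
    obtain k where k: "k < n" "k \<notin> S" "fst m = insert k S"
      using boundary_coeff_nonzero[of x m] nz by (auto simp: xy)
    obtain l where l: "l < n" "l \<notin> fst m" "insert j (insert i S) = insert l (fst m)"
      using boundary_coeff_nonzero[of m y] nz by (auto simp: xy)
    have "k = i \<or> k = j" using k l by auto
    then show False using m k by (cases m) (auto simp: enhanced_states_def)
  qed
  have disj: "?Mi \<inter> ?Mj = {}" using S by auto
  have "insert i S \<noteq> insert j S" using S by auto
  define GG where "GG k = (\<Sum>M\<in>Pow (circles D (insert k S)). edge_coeff D x (insert k S, M) * edge_coeff D (insert k S, M) y)" for k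
  have part: "(\<Sum>m\<in>Pair (insert k S) ` Pow (circles D (insert k S)). ?h m) =
      (- 1) ^ (card {a \<in> S. a < k} + card {a \<in> insert k S. a < l}) * GG k"
    if kl: "k < n" "k \<notin> S" "l < n" "l \<notin> S" "k \<noteq> l" "insert j (insert i S) = insert l (insert k S)" for k l
  proof -
    have "(\<Sum>m\<in>Pair (insert k S) ` Pow (circles D (insert k S)). ?h m) = (\<Sum>M\<in>Pow (circles D (insert k S)). ?h (insert k S, M))"
      by (subst sum.reindex) (auto simp: inj_on_def)
    also have "\<dots> = (\<Sum>M\<in>Pow (circles D (insert k S)). (- 1) ^ (card {a \<in> S. a < k} + card {a \<in> insert k S. a < l}) *
        (edge_coeff D x (insert k S, M) * edge_coeff D (insert k S, M) y))"
    proof (rule sum.cong[OF refl])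
      fix M
      have "l \<notin> insert k S" using kl by auto
      then show "?h (insert k S, M) = (- 1) ^ (card {a \<in> S. a < k} + card {a \<in> insert k S. a < l}) *
        (edge_coeff D x (insert k S, M) * edge_coeff D (insert k S, M) y)"
        unfolding xy kl(6) by (simp add: boundary_coeff_insert kl(1-4) power_add)
    qed
    finally show ?thesis by (simp add: GG_def sum_distrib_left)
  qed
  have fS: "finite S" using S(1) finite_subset by blast
  \<comment> \<open>Switching \<open>i\<close> first adds one to the count of smaller 1-resolved
    crossings at \<open>j\<close>, while switching \<open>j\<close> first does not affect the count
    at \<open>i\<close>. This unit is the sign.\<close>
  have "{a \<in> insert i S. a < j} = insert i {a \<in> S. a < j}" using ij(5) by auto
  then have ci: "card {a \<in> insert i S. a < j} = Suc (card {a \<in> S. a < j})" using fS S by simp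
  have "{a \<in> insert j S. a < i} = {a \<in> S. a < i}" using ij(5) by auto
  then have cj: "card {a \<in> insert j S. a < i} = card {a \<in> S. a < i}" by simp
  have "(\<Sum>m\<in>enhanced_states D. ?h m) = (\<Sum>m\<in>?Mi \<union> ?Mj. ?h m)"
    by (rule sum.mono_neutral_right) (use finite_enhanced_states sub zero in auto)
  also have "\<dots> = (\<Sum>m\<in>?Mi. ?h m) + (\<Sum>m\<in>?Mj. ?h m)"
    using finite_subset[OF sub finite_enhanced_states] disj by (intro sum.union_disjoint) auto
  also have "\<dots> = (- 1) ^ (card {a \<in> S. a < i} + Suc (card {a \<in> S. a < j})) * GG i +
      (- 1) ^ (card {a \<in> S. a < j} + card {a \<in> S. a < i}) * GG j"
  proof -
    have "insert j (insert i S) = insert i (insert j S)" by auto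
    then show ?thesis
      using part[OF ij(1) S(4) ij(2) S(5,6) refl] part[OF ij(2) S(5) ij(1) S(4) S(6)[symmetric]]
      unfolding ci cj by simp
  qed
  also have "GG i = GG j"
    using square_commutes[OF S(1) ij(1,2) S(4-6) S(2,3)] by (simp add: GG_def xy)
  finally show ?thesis by (simp add: add.commute)
qed

text \<open>The triangle inequalities are what remains of the additivity of homology classes.\<close>

lemma label_sum:
  assumes x: "x \<in> enhanced_states D" and y: "y \<in> enhanced_states D"
    and j: "j < n" "j \<notin> fst x" "fst y = insert j (fst x)" and nz: "edge_coeff D x y \<noteq> 0"
    and w: "\<And>A B C. {A, B, C} = touching D j (fst x) \<union> touching D j (fst y) \<Longrightarrow> (w C :: int) \<le> w A + w B"
  shows "(\<Sum>C\<in>circles D (fst y). label y C * w C) \<le> (\<Sum>C\<in>circles D (fst x). label x C * w C)"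
    and "(\<Sum>C\<in>circles D (fst y). label y C) + 1 = (\<Sum>C\<in>circles D (fst x). label x C)"
proof -
  obtain S X Y where xy: "x = (S, X)" "y = (insert j S, Y)" using j(3) by (metis prod.collapse)
  have S: "S \<subseteq> {..<n}" "j < n" "j \<notin> S" and X: "X \<subseteq> circles D S" and Y: "Y \<subseteq> circles D (insert j S)"
    using x y j by (auto simp: xy enhanced_states_def)
  let ?T = "touching D j S" and ?T' = "touching D j (insert j S)"
  have c: "\<forall>C \<in> circles D S - ?T. C \<in> X \<longleftrightarrow> C \<in> Y" and k: "card (?T - X) + card (?T' \<inter> Y) = 1"
    using nz edge_coeff_insert[OF S X Y] by (auto simp: xy split: if_splits)
  have S': "insert j S \<subseteq> {..<n}" using S by auto
  have sx: "(\<Sum>C\<in>circles D S. label x C * v C) = (\<Sum>C\<in>circles D S - ?T. label x C * v C) + (\<Sum>C\<in>?T. label x C * v C)" for v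
    using sum.subset_diff[OF touching_subset finite_circles[OF S(1)]] by blast
  have sy: "(\<Sum>C\<in>circles D (insert j S). label y C * v C) = (\<Sum>C\<in>circles D S - ?T. label y C * v C) + (\<Sum>C\<in>?T'. label y C * v C)" for v
    using sum.subset_diff[OF touching_subset finite_circles[OF S']] untouched[OF S] by metis
  have eq: "(\<Sum>C\<in>circles D S - ?T. label x C * v C) = (\<Sum>C\<in>circles D S - ?T. label y C * v C)" for v
    by (rule sum.cong) (use c in \<open>auto simp: label_def xy\<close>)
  have "(\<Sum>C\<in>?T'. label y C * w C) \<le> (\<Sum>C\<in>?T. label x C * w C) \<and>
        (\<Sum>C\<in>?T'. label y C) + 1 = (\<Sum>C\<in>?T. label x C)"
    using merge_or_split[OF S]
  proof (elim disjE conjE)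
    assume "card ?T = 2" "card ?T' = 1"
    then obtain A B C where ABC: "?T = {A, B}" "A \<noteq> B" "?T' = {C}"
      by (auto simp: card_2_iff card_1_singleton_iff)
    \<comment> \<open>The hypothesis on \<open>w\<close> holds for every naming of the three
      circles, so all three inequalities are available.\<close>
    have tri: "w C \<le> w A + w B" "w A \<le> w B + w C" "w B \<le> w A + w C"
      using w[of A B C] w[of B C A] w[of A C B] ABC by (auto simp: xy insert_commute)
    have "card ({A, B} - X) + card ({C} \<inter> Y) = 1" using k ABC by simp
    then have "A \<in> X \<and> B \<in> X \<and> C \<in> Y \<or> A \<notin> X \<and> B \<in> X \<and> C \<notin> Y \<or> A \<in> X \<and> B \<notin> X \<and> C \<notin> Y"
      using ABC(2) by (cases "A \<in> X"; cases "B \<in> X"; cases "C \<in> Y") (simp_all add: insert_Diff_if)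
    then show ?thesis using ABC tri by (auto simp: label_def xy)
  next
    assume "card ?T = 1" "card ?T' = 2"
    then obtain A B C where ABC: "?T' = {A, B}" "A \<noteq> B" "?T = {C}"
      by (auto simp: card_2_iff card_1_singleton_iff)
    have tri: "w C \<le> w A + w B" "w A \<le> w B + w C" "w B \<le> w A + w C"
      using w[of A B C] w[of B C A] w[of A C B] ABC by (auto simp: xy insert_commute)
    have "card ({C} - X) + card ({A, B} \<inter> Y) = 1" using k ABC by simp
    then have "C \<in> X \<and> A \<in> Y \<and> B \<notin> Y \<or> C \<in> X \<and> A \<notin> Y \<and> B \<in> Y \<or> C \<notin> X \<and> A \<notin> Y \<and> B \<notin> Y"
      using ABC(2) by (cases "A \<in> Y"; cases "B \<in> Y"; cases "C \<in> X") (simp_all add: Int_insert_left)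
    then show ?thesis using ABC tri by (auto simp: label_def xy)
  qed
  then show "(\<Sum>C\<in>circles D (fst y). label y C * w C) \<le> (\<Sum>C\<in>circles D (fst x). label x C * w C)"
    and "(\<Sum>C\<in>circles D (fst y). label y C) + 1 = (\<Sum>C\<in>circles D (fst x). label x C)"
    using sx[of w] sy[of w] eq[of w] sx[of "\<lambda>_. 1"] sy[of "\<lambda>_. 1"] eq[of "\<lambda>_. 1"] by (simp_all add: xy)
qed

text \<open>An edge lowers the sum of the labels by one and raises the number of 1-resolutions by
  one, so the quantum degree is kept while the homological degree rises.\<close>

lemma graded_complex_CKh: "graded_complex (enhanced_states D) (states_in_degree D) (boundary_coeff D)"
proof unfold_locales
  show "finite (enhanced_states D)" by (rule finite_enhanced_states)
  show "states_in_degree D i q \<subseteq> enhanced_states D" for i q by (auto simp: states_in_degree_def)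
  show "(\<Sum>m\<in>enhanced_states D. boundary_coeff D x m * boundary_coeff D m y) = 0"
    if "x \<in> enhanced_states D" "y \<in> enhanced_states D" for x y
    by (rule boundary_square[OF that])
  fix x y i q assume x: "x \<in> states_in_degree D i q" and y: "y \<in> enhanced_states D" and nz: "boundary_coeff D x y \<noteq> 0"
  have x': "x \<in> enhanced_states D" using x by (simp add: states_in_degree_def)
  obtain j where j: "j < n" "j \<notin> fst x" "fst y = insert j (fst x)" "edge_coeff D x y \<noteq> 0"
    using boundary_coeff_nonzero[OF nz] .
  have "finite (fst x)" using x' finite_subset[of "fst x" "{..<n}"] by (auto simp: enhanced_states_def)
  then have "card (fst y) = Suc (card (fst x))" using j by simp
  moreover have "(\<Sum>C\<in>circles D (fst y). label y C) + 1 = (\<Sum>C\<in>circles D (fst x). label x C)"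
    by (rule label_sum(2)[OF x' y j, of "\<lambda>_. 1"]) simp
  ultimately show "y \<in> states_in_degree D (i + 1) q"
    using x y by (simp add: states_in_degree_def hom_degree_def q_degree_def)
qed

lemma g_degree_decreasing:
  assumes tri: "\<And>S j A B C z. S \<subseteq> {..<n} \<Longrightarrow> j < n \<Longrightarrow> j \<notin> S \<Longrightarrow>
      {A, B, C} = touching D j S \<union> touching D j (insert j S) \<Longrightarrow> z \<in> P \<Longrightarrow>
      circle_class C z \<le> circle_class A z + circle_class B z"
    and x: "x \<in> enhanced_states D" and y: "y \<in> enhanced_states D" and nz: "boundary_coeff D x y \<noteq> 0"
  shows "g_degree P D y \<le> g_degree P D x"
  unfolding le_fun_def
proof
  fix z
  obtain j where j: "j < n" "j \<notin> fst x" "fst y = insert j (fst x)" "edge_coeff D x y \<noteq> 0"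
    using boundary_coeff_nonzero[OF nz] .
  have S: "fst x \<subseteq> {..<n}" using x by (auto simp: enhanced_states_def)
  show "g_degree P D y z \<le> g_degree P D x z"
    using label_sum(1)[OF x y j, of "\<lambda>C. circle_class C z"] tri[OF S j(1,2), of _ _ _ z] j(3)
    by (auto simp: g_degree_def)
qed

end

section \<open>Plane curves\<close>

definition jordan_curve :: "complex set \<Rightarrow> bool" where
  "jordan_curve C \<longleftrightarrow> (\<exists>\<gamma>. simple_path \<gamma> \<and> pathfinish \<gamma> = pathstart \<gamma> \<and> path_image \<gamma> = C)"

text \<open>Either \<open>\<gamma>\<close> or its reverse is counterclockwise, so the choice in
  \<open>circle_class\<close> succeeds and yields 1 inside and 0 outside. The class forgets the
  direction of \<open>\<gamma>\<close>, hence the sign ambiguity in its winding number.\<close>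

lemma circle_class_cases:
  assumes \<gamma>: "simple_path \<gamma>" "pathfinish \<gamma> = pathstart \<gamma>" and z: "z \<notin> path_image \<gamma>"
  shows "circle_class (path_image \<gamma>) z \<in> {0, 1}"
    and "winding_number \<gamma> z = of_int (circle_class (path_image \<gamma>) z) \<or>
         winding_number \<gamma> z = - of_int (circle_class (path_image \<gamma>) z)"
proof -
  have path: "path \<gamma>" using \<gamma> by (simp add: simple_path_imp_path)
  have "\<exists>\<delta>. counterclockwise_loop (path_image \<gamma>) \<delta>"
  proof (rule simple_closed_path_winding_number_inside[OF \<gamma>(1)])
    assume "\<And>z. z \<in> inside (path_image \<gamma>) \<Longrightarrow> winding_number \<gamma> z = 1"
    then show ?thesis using \<gamma> unfolding counterclockwise_loop_def by blast
  next
    assume m: "\<And>z. z \<in> inside (path_image \<gamma>) \<Longrightarrow> winding_number \<gamma> z = -1"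
    have "winding_number (reversepath \<gamma>) w = 1" if "w \<in> inside (path_image \<gamma>)" for w
    proof -
      have "w \<notin> path_image \<gamma>" using that inside_no_overlap[of "path_image \<gamma>"] by blast
      then show ?thesis using m[OF that] winding_number_reversepath[OF path, of w] by simp
    qed
    then have "counterclockwise_loop (path_image \<gamma>) (reversepath \<gamma>)"
      using \<gamma> by (simp add: counterclockwise_loop_def simple_path_reversepath)
    then show ?thesis by blast
  qed
  then have ccw: "counterclockwise_loop (path_image \<gamma>) (SOME \<delta>. counterclockwise_loop (path_image \<gamma>) \<delta>)"
    by (rule someI_ex)
  define \<delta> where "\<delta> = (SOME \<delta>. counterclockwise_loop (path_image \<gamma>) \<delta>)"
  have \<delta>: "simple_path \<delta>" "pathfinish \<delta> = pathstart \<delta>" "path_image \<delta> = path_image \<gamma>"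
    "\<And>w. w \<in> inside (path_image \<gamma>) \<Longrightarrow> winding_number \<delta> w = 1"
    using ccw by (auto simp: counterclockwise_loop_def \<delta>_def)
  have cc: "circle_class (path_image \<gamma>) z = \<lfloor>Re (winding_number \<delta> z)\<rfloor>"
    by (simp add: circle_class_def \<delta>_def)
  have "z \<in> inside (path_image \<gamma>) \<or> z \<in> outside (path_image \<gamma>)"
    using z inside_Un_outside[of "path_image \<gamma>"] by blast
  then have "circle_class (path_image \<gamma>) z \<in> {0, 1} \<and>
     (winding_number \<gamma> z = of_int (circle_class (path_image \<gamma>) z) \<or>
      winding_number \<gamma> z = - of_int (circle_class (path_image \<gamma>) z))"
  proof
    assume i: "z \<in> inside (path_image \<gamma>)"
    then have "circle_class (path_image \<gamma>) z = 1" using \<delta>(4) cc by simp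
    moreover have "winding_number \<gamma> z = 1 \<or> winding_number \<gamma> z = -1"
      using simple_closed_path_winding_number_inside[OF \<gamma>(1)] i by metis
    ultimately show ?thesis by auto
  next
    assume o: "z \<in> outside (path_image \<gamma>)"
    have "winding_number \<gamma> z = 0" by (rule winding_number_zero_in_outside[OF path \<gamma>(2) o])
    moreover have "winding_number \<delta> z = 0"
      by (rule winding_number_zero_in_outside) (use \<delta> o simple_path_imp_path in auto)
    ultimately show ?thesis using cc by simp
  qed
  then show "circle_class (path_image \<gamma>) z \<in> {0, 1}"
    and "winding_number \<gamma> z = of_int (circle_class (path_image \<gamma>) z) \<or>
         winding_number \<gamma> z = - of_int (circle_class (path_image \<gamma>) z)" by auto
qed

section \<open>Systems of arcs and closed curves\<close>

text \<open>Models a partly resolved diagram: \<open>Q\<close> collects the loose ends, each arc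
  meets \<open>Q\<close> in its two end points only, and the closed curves have no loose
  ends.\<close>

definition curve_family :: "complex set set \<Rightarrow> complex set \<Rightarrow> bool" where
  "curve_family F Q \<longleftrightarrow> finite F \<and> disjoint F \<and> Q \<subseteq> \<Union>F \<and>
    (\<forall>Y\<in>F. jordan_curve Y \<and> Y \<inter> Q = {} \<or>
       (\<exists>\<gamma>. arc \<gamma> \<and> path_image \<gamma> = Y \<and> Y \<inter> Q = {pathstart \<gamma>, pathfinish \<gamma>}))"

lemma curve_family_pieces:
  assumes "curve_family F Q" "Y \<in> F"
  shows "closed Y" "connected Y" "Y \<noteq> {}"
proof -
  obtain \<gamma> where "path \<gamma>" "path_image \<gamma> = Y"
    using assms unfolding curve_family_def jordan_curve_def by (metis arc_imp_path simple_path_imp_path)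
  then show "closed Y" "connected Y" "Y \<noteq> {}"
    by (auto simp: closed_path_image connected_path_image)
qed

text \<open>Finiteness makes the union of the other members closed, so a connected set containing
  \<open>Y\<close> cannot reach into it, and \<open>Y\<close> is maximal.\<close>

lemma components_disjoint_Union:
  fixes F :: "'a::topological_space set set"
  assumes "finite F" "disjoint F" and Y: "\<And>Y. Y \<in> F \<Longrightarrow> closed Y \<and> connected Y \<and> Y \<noteq> {}"
  shows "components (\<Union>F) = F"
proof -
  have sub: "Y \<in> components (\<Union>F)" if "Y \<in> F" for Y
    unfolding in_components_maximal
  proof (intro conjI allI impI)
    show "Y \<noteq> {}" "connected Y" "Y \<subseteq> \<Union>F" using Y that by auto
    fix E assume E: "E \<noteq> {} \<and> Y \<subseteq> E \<and> E \<subseteq> \<Union>F \<and> connected E"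
    have "closed (\<Union>(F - {Y}))" using assms by (intro closed_Union) auto
    moreover have "Y \<inter> \<Union>(F - {Y}) = {}" using assms(2) that by (auto simp: disjoint_def)
    moreover have "E \<subseteq> Y \<union> \<Union>(F - {Y})" using E by auto
    moreover have "Y \<inter> E \<noteq> {}" using E Y that by auto
    ultimately have "\<Union>(F - {Y}) \<inter> E = {}"
      using E Y[OF that] connected_closedD[of E Y "\<Union>(F - {Y})"] by auto
    then show "E = Y" using E by blast
  qed
  moreover have "C \<in> F" if C: "C \<in> components (\<Union>F)" for C
  proof -
    obtain p where "p \<in> C" using in_components_nonempty[OF C] by auto
    then obtain Y where "Y \<in> F" "p \<in> Y" using in_components_subset[OF C] by auto
    then show ?thesis using components_eq[OF C sub] \<open>p \<in> C\<close> by (metis IntI empty_iff)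
  qed
  ultimately show ?thesis by blast
qed

lemma components_curve_family:
  "curve_family F Q \<Longrightarrow> components (\<Union>F) = F"
  using components_disjoint_Union[of F] curve_family_pieces[of F Q] by (auto simp: curve_family_def)

lemma curve_family_arc:
  assumes F: "curve_family F Q" and a: "a \<in> Q"
  obtains Y \<gamma> b where "Y \<in> F" "arc \<gamma>" "path_image \<gamma> = Y" "pathstart \<gamma> = a" "pathfinish \<gamma> = b" "Y \<inter> Q = {a, b}" "a \<noteq> b"
proof -
  obtain Y where Y: "Y \<in> F" "a \<in> Y" using F a by (auto simp: curve_family_def)
  then have "Y \<inter> Q \<noteq> {}" using a by auto
  then obtain \<gamma> where \<gamma>: "arc \<gamma>" "path_image \<gamma> = Y" "Y \<inter> Q = {pathstart \<gamma>, pathfinish \<gamma>}"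
    using F Y unfolding curve_family_def by blast
  have ne: "pathstart \<gamma> \<noteq> pathfinish \<gamma>" using arc_distinct_ends[OF \<gamma>(1)] by auto
  have "a = pathstart \<gamma> \<or> a = pathfinish \<gamma>" using \<gamma>(3) Y a by auto
  then show thesis
  proof
    assume "a = pathstart \<gamma>"
    then show thesis using that[OF Y(1) \<gamma>(1,2)] \<gamma>(3) ne by auto
  next
    assume a: "a = pathfinish \<gamma>"
    show thesis
      by (rule that[OF Y(1), of "reversepath \<gamma>" "pathstart \<gamma>"])
        (use a \<gamma> ne in \<open>auto simp: arc_reversepath insert_commute\<close>)
  qed
qed

lemma jordan_curve_join:
  assumes "arc \<gamma>" "arc h" "pathstart h = pathfinish \<gamma>" "pathfinish h = pathstart \<gamma>"
    and "path_image \<gamma> \<inter> path_image h \<subseteq> {pathstart \<gamma>, pathfinish \<gamma>}"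
  shows "simple_path (\<gamma> +++ h)" and "path_image (\<gamma> +++ h) = path_image \<gamma> \<union> path_image h"
    and "jordan_curve (path_image \<gamma> \<union> path_image h)"
proof -
  show s: "simple_path (\<gamma> +++ h)"
    using assms by (intro simple_path_join_loop) auto
  show p: "path_image (\<gamma> +++ h) = path_image \<gamma> \<union> path_image h"
    using assms by (simp add: path_image_join)
  show "jordan_curve (path_image \<gamma> \<union> path_image h)"
    unfolding jordan_curve_def using s p assms by (intro exI[of _ "\<gamma> +++ h"]) simp
qed

text \<open>The new arc joins two loose ends. If both belong to one member, it closes up to a Jordan
  curve; otherwise two arcs fuse into one. Either way the two ends are used up.\<close>

lemma curve_family_add_arc:
  assumes F: "curve_family F Q" and h: "arc h" "pathstart h = b" "pathfinish h = a"
    and ab: "a \<in> Q" "b \<in> Q" and X: "path_image h \<inter> \<Union>F = {a, b}"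
  shows "\<exists>F'. curve_family F' (Q - {a, b}) \<and> \<Union>F' = \<Union>F \<union> path_image h"
proof -
  have Fd: "finite F" "disjoint F" "Q \<subseteq> \<Union>F"
    and Fp: "\<And>Y. Y \<in> F \<Longrightarrow> jordan_curve Y \<and> Y \<inter> Q = {} \<or> (\<exists>\<gamma>. arc \<gamma> \<and> path_image \<gamma> = Y \<and> Y \<inter> Q = {pathstart \<gamma>, pathfinish \<gamma>})"
    using F by (auto simp: curve_family_def)
  have anb: "a \<noteq> b" using arc_distinct_ends[OF h(1)] h by auto
  have hab: "a \<in> path_image h" "b \<in> path_image h"
    using h pathstart_in_path_image[of h] pathfinish_in_path_image[of h] by auto
  have hQ: "path_image h \<inter> Q \<subseteq> {a, b}" using X Fd(3) by blast
  have dj: "Y = Y'" if "Y \<in> F" "Y' \<in> F" "p \<in> Y" "p \<in> Y'" for Y Y' p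
    using Fd(2) that by (auto simp: disjoint_def)
  obtain Y \<gamma> c where Y: "Y \<in> F" "arc \<gamma>" "path_image \<gamma> = Y" "pathstart \<gamma> = a" "pathfinish \<gamma> = c" "Y \<inter> Q = {a, c}" "a \<noteq> c"
    using curve_family_arc[OF F ab(1)] by metis
  \<comment> \<open>\<open>R\<close> consists of the one or two old members absorbed into the new
    member \<open>Z\<close>.\<close>
  have other: "curve_family (insert Z (F - R)) (Q - {a, b}) \<and> \<Union>(insert Z (F - R)) = \<Union>F \<union> path_image h"
    if R: "R \<subseteq> F" "Z = \<Union>R \<union> path_image h" "a \<in> \<Union>R" "b \<in> \<Union>R"
      and Z: "jordan_curve Z \<and> Z \<inter> (Q - {a, b}) = {} \<or> (\<exists>\<gamma>. arc \<gamma> \<and> path_image \<gamma> = Z \<and> Z \<inter> (Q - {a, b}) = {pathstart \<gamma>, pathfinish \<gamma>})" for R Z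
  proof
    have dZ: "Z \<inter> Y' = {}" if "Y' \<in> F - R" for Y'
    proof -
      have d: "p \<notin> Y'" if "p \<in> \<Union>R" for p using dj \<open>Y' \<in> F - R\<close> R(1) that by blast
      have "p \<in> {a, b}" if "p \<in> path_image h" "p \<in> Y'" for p
        using X \<open>Y' \<in> F - R\<close> that by blast
      then show ?thesis using d R(2-4) by blast
    qed
    have Un: "\<Union>(insert Z (F - R)) = \<Union>F \<union> path_image h"
    proof -
      have "\<Union>F = \<Union>(F - R) \<union> \<Union>R" using R(1) by auto
      then show ?thesis using R(2) by auto
    qed
    then show "\<Union>(insert Z (F - R)) = \<Union>F \<union> path_image h" .
    show "curve_family (insert Z (F - R)) (Q - {a, b})"
      unfolding curve_family_def
    proof (intro conjI ballI)
      show "disjoint (insert Z (F - R))"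
      proof -
        have "disjnt Z Y'" if "Y' \<in> F - R" for Y' using dZ[OF that] by (simp add: disjnt_def)
        moreover have "disjoint (F - R)" using Fd(2) by (auto simp: disjoint_def)
        ultimately show ?thesis by (auto simp: pairwise_insert disjnt_sym)
      qed
      show "Q - {a, b} \<subseteq> \<Union>(insert Z (F - R))" unfolding Un using Fd(3) by blast
      fix Y' assume "Y' \<in> insert Z (F - R)"
      then consider "Y' = Z" | "Y' \<in> F - R" by blast
      then show "jordan_curve Y' \<and> Y' \<inter> (Q - {a, b}) = {} \<or>
         (\<exists>\<gamma>. arc \<gamma> \<and> path_image \<gamma> = Y' \<and> Y' \<inter> (Q - {a, b}) = {pathstart \<gamma>, pathfinish \<gamma>})"
      proof cases
        case 2
        then have "a \<notin> Y'" "b \<notin> Y'" using dZ R by blast+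
        then have "Y' \<inter> (Q - {a, b}) = Y' \<inter> Q" by blast
        then show ?thesis using Fp[of Y'] 2 by simp
      qed (use Z in simp)
    qed (use Fd in auto)
  qed
  show ?thesis
  proof (cases "b = c")
    case True
    have "path_image \<gamma> \<inter> path_image h \<subseteq> {pathstart \<gamma>, pathfinish \<gamma>}"
      using X Y True by blast
    then have "jordan_curve (Y \<union> path_image h)"
      using jordan_curve_join(3)[OF Y(2) h(1)] h Y True by simp
    moreover have "(Y \<union> path_image h) \<inter> (Q - {a, b}) = {}"
      using Y(6) hQ True by blast
    moreover have "a \<in> Y" "b \<in> Y" using Y(6) True by auto
    ultimately have "curve_family (insert (Y \<union> path_image h) (F - {Y})) (Q - {a, b}) \<and>
        \<Union>(insert (Y \<union> path_image h) (F - {Y})) = \<Union>F \<union> path_image h"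
      using Y(1) by (intro other) auto
    then show ?thesis by blast
  next
    case False
    obtain Y' \<delta> e where Y': "Y' \<in> F" "arc \<delta>" "path_image \<delta> = Y'" "pathstart \<delta> = b" "pathfinish \<delta> = e" "Y' \<inter> Q = {b, e}" "b \<noteq> e"
      using curve_family_arc[OF F ab(2)] by metis
    have bY: "b \<notin> Y" using Y(6) ab(2) False anb by auto
    have bY': "b \<in> Y'" and aY: "a \<in> Y" using Y(6) Y'(6) by auto
    have "p \<notin> Y'" if "p \<in> Y" for p using dj[OF Y(1) Y'(1) that] bY bY' by auto
    then have YY'd: "Y \<inter> Y' = {}" by auto
    have aY': "a \<notin> Y'" using YY'd aY by auto
    \<comment> \<open>The fused arc runs from \<open>e\<close> to \<open>b\<close> along the reverse
      of \<open>\<delta>\<close>, to \<open>a\<close> along \<open>h\<close>, and then to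
      \<open>c\<close> along \<open>\<gamma>\<close>.\<close>
    let ?g = "reversepath \<delta> +++ h"
    have g: "arc ?g"
    proof (rule arc_join)
      show "path_image (reversepath \<delta>) \<inter> path_image h \<subseteq> {pathstart h}"
      proof -
        have "path_image h \<inter> Y' \<subseteq> {a, b}" using X Y'(1) by blast
        then show ?thesis using aY' h(2) Y'(3) by auto
      qed
    qed (use Y' h in \<open>auto simp: arc_reversepath\<close>)
    have gi: "path_image ?g = Y' \<union> path_image h"
      using Y' h by (simp add: path_image_join)
    have G: "arc (?g +++ \<gamma>)"
    proof (rule arc_join)
      have "Y \<inter> path_image h \<subseteq> {a, b}" using X Y(1) by auto
      then have "Y \<inter> path_image h \<subseteq> {a}" using bY by auto
      then show "path_image ?g \<inter> path_image \<gamma> \<subseteq> {pathstart \<gamma>}"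
        unfolding gi Y(3,4) using YY'd by auto
    qed (use g Y h in auto)
    have GI: "path_image (?g +++ \<gamma>) = \<Union>{Y, Y'} \<union> path_image h"
      using gi Y h by (subst path_image_join) auto
    have ce: "c \<in> Q" "e \<in> Q" "c \<in> Y" "e \<in> Y'" using Y(6) Y'(6) by auto
    have "(\<Union>{Y, Y'} \<union> path_image h) \<inter> (Q - {a, b}) = {pathstart (?g +++ \<gamma>), pathfinish (?g +++ \<gamma>)}"
      using Y(5,6,7) Y'(5,6,7) hQ bY aY' ce by auto
    then have "\<exists>\<gamma>. arc \<gamma> \<and> path_image \<gamma> = \<Union>{Y, Y'} \<union> path_image h \<and>
        (\<Union>{Y, Y'} \<union> path_image h) \<inter> (Q - {a, b}) = {pathstart \<gamma>, pathfinish \<gamma>}"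
      using G GI by (intro exI[of _ "?g +++ \<gamma>"]) simp
    moreover have "{Y, Y'} \<subseteq> F" "a \<in> \<Union>{Y, Y'}" "b \<in> \<Union>{Y, Y'}" using Y(1) Y'(1) aY bY' by auto
    ultimately show ?thesis
      using other[of "{Y, Y'}" "\<Union>{Y, Y'} \<union> path_image h"] by (meson disjI2)
  qed
qed

section \<open>Separation by a chord\<close>

lemma connected_in_inside_or_outside:
  fixes C :: "complex set"
  assumes "closed C" "connected H" "H \<inter> C = {}"
  shows "H \<subseteq> inside C \<or> H \<subseteq> outside C"
proof -
  have "H \<subseteq> inside C \<union> outside C" using assms(3) inside_Un_outside[of C] by blast
  moreover have "open (inside C)" "open (outside C)"
    using assms(1) by (auto intro: open_inside open_outside)
  ultimately have "inside C \<inter> H = {} \<or> outside C \<inter> H = {}"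
    using connectedD[OF assms(2), of "inside C" "outside C"] inside_Int_outside[of C] by blast
  then show ?thesis using \<open>H \<subseteq> inside C \<union> outside C\<close> by blast
qed

text \<open>The formula of \<open>side_of_over\<close> for an arbitrary directed line: positive to
  the left of the line from \<open>a\<close> to \<open>b\<close>, zero on it. It is affine in
  \<open>z\<close>, so on a segment it interpolates the end values.\<close>

definition side :: "complex \<Rightarrow> complex \<Rightarrow> complex \<Rightarrow> real" where
  "side a b z = Im (cnj (b - a) * (z - a))"

lemma side_ends [simp]: "side a b a = 0" "side a b b = 0"
  by (simp_all add: side_def algebra_simps)

lemma side_convex: "side a b ((1 - u) *\<^sub>R x + u *\<^sub>R y) = (1 - u) * side a b x + u * side a b y"
  by (simp add: side_def algebra_simps)

lemma convex_side: "convex {z. side a b z > 0}" "convex {z. side a b z < 0}"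
proof -
  have s: "side a b z = inner (\<i> * (b - a)) z - inner (\<i> * (b - a)) a" for z
    by (simp add: side_def inner_complex_def algebra_simps)
  have "{z. side a b z > 0} = {z. inner (\<i> * (b - a)) z > inner (\<i> * (b - a)) a}"
    "{z. side a b z < 0} = {z. inner (\<i> * (b - a)) z < inner (\<i> * (b - a)) a}"
    by (auto simp: s)
  then show "convex {z. side a b z > 0}" "convex {z. side a b z < 0}"
    by (simp_all add: convex_halfspace_gt convex_halfspace_lt)
qed

lemma side_segment:
  assumes "z \<in> closed_segment x y"
  obtains u where "0 \<le> u" "u \<le> 1" "z = (1 - u) *\<^sub>R x + u *\<^sub>R y" "side a b z = (1 - u) * side a b x + u * side a b y"
  using assms side_convex[of a b _ x y] by (auto simp: closed_segment_def)

text \<open>The line has empty interior: a point on it can be pushed off in the normal direction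
  \<open>\<i> * (b - a)\<close>.\<close>

lemma side_nonzero_in_open:
  assumes "open U" "z \<in> U" "a \<noteq> b"
  obtains w where "w \<in> U" "side a b w \<noteq> 0"
proof (cases "side a b z = 0")
  case False
  then show ?thesis using assms that by blast
next
  case True
  have ab: "b - a \<noteq> 0" using assms(3) by simp
  obtain e where e: "e > 0" "ball z e \<subseteq> U" using assms openE by blast
  \<comment> \<open>Scaled so that the displacement is half the radius of the ball.\<close>
  define t where "t = e / (2 * norm (b - a))"
  have t: "t > 0" using e ab by (simp add: t_def)
  define w where "w = z + of_real t * (\<i> * (b - a))"
  have "norm (of_real t * (\<i> * (b - a))) = e / 2"
  proof -
    have "norm (of_real t * (\<i> * (b - a))) = t * norm (b - a)"
      using t by (simp add: norm_mult)
    then show ?thesis using ab by (simp add: t_def)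
  qed
  then have "dist z w < e" using e by (simp add: w_def dist_norm norm_minus_commute)
  then have "w \<in> U" using e by auto
  moreover have "side a b w = side a b z + t * (norm (b - a))\<^sup>2"
    unfolding cmod_power2 by (simp add: side_def w_def algebra_simps power2_eq_square)
  moreover have "t * (norm (b - a))\<^sup>2 \<noteq> 0" using t ab by simp
  ultimately show ?thesis using that True by simp
qed

text \<open>The chord from \<open>a\<close> to \<open>b\<close> closes \<open>\<gamma>\<close> to a Jordan curve whose inside and outside locally lie on the
  two sides of the chord; hence \<open>c\<close> and \<open>d\<close> cannot be joined without meeting it.\<close>

lemma no_alternating_arcs:
  fixes z0 :: complex
  assumes \<gamma>: "arc \<gamma>" "pathstart \<gamma> = a" "pathfinish \<gamma> = b" and \<delta>: "path \<delta>" "pathstart \<delta> = c" "pathfinish \<delta> = d"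
    and disj: "path_image \<gamma> \<inter> path_image \<delta> = {}"
    and \<gamma>B: "path_image \<gamma> \<inter> cball z0 r = {a, b}" and \<delta>B: "path_image \<delta> \<inter> cball z0 r = {c, d}"
    and s: "side a b c > 0" "side a b d < 0"
  shows False
proof -
  have ab: "a \<noteq> b" using arc_distinct_ends[OF \<gamma>(1)] \<gamma> by auto
  let ?g = "\<gamma> +++ linepath b a"
  let ?C = "path_image ?g"
  have aB: "a \<in> cball z0 r" "b \<in> cball z0 r" and cB: "c \<in> cball z0 r" "d \<in> cball z0 r"
    using \<gamma>B \<delta>B by auto
  have seg: "closed_segment b a \<subseteq> cball z0 r" using aB by (simp add: closed_segment_subset)
  have seg0: "side a b z = 0" if z: "z \<in> closed_segment b a" for z
    using side_segment[OF z, of a b] by (metis add.right_neutral mult_zero_right side_ends)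
  have C: "?C = path_image \<gamma> \<union> closed_segment b a" using \<gamma> by (simp add: path_image_join)
  have sp: "simple_path ?g" "pathfinish ?g = pathstart ?g"
  proof -
    show "simple_path ?g"
      using \<gamma> ab seg \<gamma>B by (intro simple_path_join_loop arc_linepath) auto
  qed (use \<gamma> in simp)
  have cl: "closed ?C" using sp(1) by (simp add: closed_path_image simple_path_imp_path)
  note J = Jordan_inside_outside[OF sp]
  \<comment> \<open>An interior point of the chord lies in the open ball. Being on the common
    frontier, it is approached within that ball from the inside and from the outside of the
    curve.\<close>
  define m where "m = midpoint b a"
  have m: "m \<in> closed_segment b a" "m \<in> open_segment b a" using ab by (auto simp: m_def)
  have "dist z0 m < r"
    using dist_decreases_open_segment[OF m(2), of z0] aB by auto
  then have mb: "m \<in> ball z0 r" by simp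
  have near: "\<exists>w \<in> U \<inter> ball z0 r. side a b w \<noteq> 0" if "open U" "frontier U = ?C" for U
  proof -
    have "m \<in> closure U" using that(2) m(1) C by (auto simp: frontier_def)
    then obtain p where "p \<in> U \<inter> ball z0 r"
      using mb open_Int_closure_eq_empty[of "ball z0 r" U] by blast
    then show ?thesis
      using side_nonzero_in_open[of "U \<inter> ball z0 r" p a b] that(1) ab by blast
  qed
  \<comment> \<open>The two halves of the disk off the line are convex and miss the curve, which
    meets the disk only in the chord. Each half lies on one side of the curve; as inside and outside
    both have points of nonzero \<open>side\<close> in the disk, the halves lie on different
    sides.\<close>
  define Hp where "Hp = cball z0 r \<inter> {z. side a b z > 0}"
  define Hm where "Hm = cball z0 r \<inter> {z. side a b z < 0}"
  have "connected Hp" "connected Hm"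
    unfolding Hp_def Hm_def by (intro convex_connected convex_Int convex_side convex_cball)+
  moreover have "Hp \<inter> ?C = {}" "Hm \<inter> ?C = {}"
  proof -
    have "side a b z = 0" if "z \<in> ?C" "z \<in> cball z0 r" for z
    proof (cases "z \<in> closed_segment b a")
      case False
      then have "z = a \<or> z = b" using that \<gamma>B unfolding C by blast
      then show ?thesis by auto
    qed (rule seg0)
    then show "Hp \<inter> ?C = {}" "Hm \<inter> ?C = {}" unfolding Hp_def Hm_def by fastforce+
  qed
  ultimately have H: "Hp \<subseteq> inside ?C \<or> Hp \<subseteq> outside ?C" "Hm \<subseteq> inside ?C \<or> Hm \<subseteq> outside ?C"
    using connected_in_inside_or_outside[OF cl] by blast+
  have "\<exists>w \<in> inside ?C. w \<in> Hp \<union> Hm"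
    using near[of "inside ?C"] J unfolding Hp_def Hm_def by force
  moreover have "\<exists>w \<in> outside ?C. w \<in> Hp \<union> Hm"
    using near[of "outside ?C"] J unfolding Hp_def Hm_def by force
  moreover have "c \<in> Hp" "d \<in> Hm" using s cB by (auto simp: Hp_def Hm_def)
  ultimately have cd: "c \<in> inside ?C \<and> d \<in> outside ?C \<or> c \<in> outside ?C \<and> d \<in> inside ?C"
    using H inside_Int_outside[of ?C] by blast
  have "path_image \<delta> \<inter> ?C = {}"
  proof -
    have "z \<notin> closed_segment b a" if "z \<in> path_image \<delta>" for z
    proof
      assume z: "z \<in> closed_segment b a"
      then have "z = c \<or> z = d" using that seg \<delta>B by blast
      then show False using seg0[OF z] s by auto
    qed
    then show ?thesis unfolding C using disj by blast
  qed
  then have "path_image \<delta> \<subseteq> inside ?C \<or> path_image \<delta> \<subseteq> outside ?C"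
    using connected_in_inside_or_outside[OF cl] connected_path_image[OF \<delta>(1)] by blast
  moreover have "c \<in> path_image \<delta>" "d \<in> path_image \<delta>"
    using \<delta> pathstart_in_path_image[of \<delta>] pathfinish_in_path_image[of \<delta>] by auto
  ultimately show False using cd inside_Int_outside[of ?C] by blast
qed

section \<open>Surgery on two arcs\<close>

text \<open>\<open>\<gamma>\<close> and \<open>\<delta>\<close> carry the four points at which
  \<open>F\<close> meets \<open>B\<close>. Chords from \<open>b\<close> to \<open>a\<close> and from
  \<open>d\<close> to \<open>c\<close> close each arc into \<open>C1\<close> and \<open>C2\<close>;
  chords from \<open>b\<close> to \<open>c\<close> and from \<open>d\<close> to \<open>a\<close>
  combine both into \<open>C\<close>.\<close>

locale surgery =
  fixes F :: "complex set set" and B :: "complex set" and a b c d :: complex and \<gamma> \<delta> :: "real \<Rightarrow> complex"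
  assumes F: "curve_family F {a, b, c, d}"
    and distinct: "distinct [a, b, c, d]"
    and \<gamma>: "arc \<gamma>" "pathstart \<gamma> = a" "pathfinish \<gamma> = b" "path_image \<gamma> \<in> F" "path_image \<gamma> \<inter> {a, b, c, d} = {a, b}"
    and \<delta>: "arc \<delta>" "pathstart \<delta> = c" "pathfinish \<delta> = d" "path_image \<delta> \<in> F" "path_image \<delta> \<inter> {a, b, c, d} = {c, d}"
    and B: "convex B" "\<Union>F \<inter> B = {a, b, c, d}"
    and chords_disjoint: "closed_segment b a \<inter> closed_segment d c = {}" "closed_segment b c \<inter> closed_segment d a = {}"
    and chord_ends: "closed_segment b a \<inter> {a, b, c, d} = {a, b}" "closed_segment d c \<inter> {a, b, c, d} = {c, d}"
      "closed_segment b c \<inter> {a, b, c, d} = {b, c}" "closed_segment d a \<inter> {a, b, c, d} = {a, d}"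
begin

definition C1 where "C1 = path_image \<gamma> \<union> closed_segment b a"
definition C2 where "C2 = path_image \<delta> \<union> closed_segment d c"
definition C where "C = (path_image \<gamma> \<union> closed_segment b c) \<union> (path_image \<delta> \<union> closed_segment d a)"
definition G where "G = F - {path_image \<gamma>, path_image \<delta>}"

lemma Fd: "finite F" "disjoint F" using F by (auto simp: curve_family_def)

lemma Union_F: "\<Union>F = path_image \<gamma> \<union> path_image \<delta> \<union> \<Union>G"
  using \<gamma>(4) \<delta>(4) by (auto simp: G_def)

lemma chords_B: "closed_segment b a \<subseteq> B" "closed_segment d c \<subseteq> B" "closed_segment b c \<subseteq> B" "closed_segment d a \<subseteq> B"
proof -
  have "a \<in> B" "b \<in> B" "c \<in> B" "d \<in> B" using B(2) by blast+
  then show "closed_segment b a \<subseteq> B" "closed_segment d c \<subseteq> B" "closed_segment b c \<subseteq> B" "closed_segment d a \<subseteq> B"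
    using B(1) by (simp_all add: closed_segment_subset)
qed

lemma arcs_disjoint: "path_image \<gamma> \<inter> path_image \<delta> = {}"
proof -
  have "path_image \<gamma> \<noteq> path_image \<delta>" using \<gamma>(5) \<delta>(5) distinct by auto
  then show ?thesis using Fd(2) \<gamma>(4) \<delta>(4) by (auto simp: disjoint_def)
qed

lemma arcs_B: "path_image \<gamma> \<inter> B = {a, b}" "path_image \<delta> \<inter> B = {c, d}"
  using B(2) \<gamma>(4,5) \<delta>(4,5) by blast+

lemma G_disjoint: "Z \<in> G \<Longrightarrow> Z \<inter> path_image \<gamma> = {}" "Z \<in> G \<Longrightarrow> Z \<inter> path_image \<delta> = {}"
  using Fd(2) \<gamma>(4) \<delta>(4) by (auto simp: G_def disjoint_def)

lemma G_B: "Z \<in> G \<Longrightarrow> Z \<inter> B = {}"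
proof -
  assume Z: "Z \<in> G"
  then have "Z \<inter> B \<subseteq> {a, b, c, d}" using B(2) by (auto simp: G_def)
  moreover have "{a, b, c, d} \<subseteq> path_image \<gamma> \<union> path_image \<delta>" using \<gamma>(5) \<delta>(5) by blast
  ultimately show ?thesis using G_disjoint[OF Z] by blast
qed

lemma circles_B: "C1 \<inter> B \<noteq> {}" "C2 \<inter> B \<noteq> {}" "C \<inter> B \<noteq> {}"
proof -
  have "a \<in> path_image \<gamma> \<inter> B" "c \<in> path_image \<delta> \<inter> B" unfolding arcs_B by simp_all
  then show "C1 \<inter> B \<noteq> {}" "C2 \<inter> B \<noteq> {}" "C \<inter> B \<noteq> {}" unfolding C1_def C2_def C_def by blast+
qed

text \<open>A chord stays in the convex set \<open>B\<close>, where an arc has only its two ends, so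
  arc and chord can share end points only.\<close>

lemma arc_chord:
  "path_image \<gamma> \<inter> closed_segment b a \<subseteq> {a, b}" "path_image \<gamma> \<inter> closed_segment d c \<subseteq> {}"
  "path_image \<gamma> \<inter> closed_segment b c \<subseteq> {b}" "path_image \<gamma> \<inter> closed_segment d a \<subseteq> {a}"
  "path_image \<delta> \<inter> closed_segment b a \<subseteq> {}" "path_image \<delta> \<inter> closed_segment d c \<subseteq> {c, d}"
  "path_image \<delta> \<inter> closed_segment b c \<subseteq> {c}" "path_image \<delta> \<inter> closed_segment d a \<subseteq> {d}"
proof -
  have *: "path_image g \<inter> K \<subseteq> E \<inter> E'" if "path_image g \<inter> B = E" "K \<inter> {a, b, c, d} = E'" "K \<subseteq> B" "E \<subseteq> {a, b, c, d}" for g K E E'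
    using that by blast
  have sub: "{a, b} \<subseteq> {a, b, c, d}" "{c, d} \<subseteq> {a, b, c, d}" by auto
  show "path_image \<gamma> \<inter> closed_segment b a \<subseteq> {a, b}" "path_image \<gamma> \<inter> closed_segment d c \<subseteq> {}"
    "path_image \<gamma> \<inter> closed_segment b c \<subseteq> {b}" "path_image \<gamma> \<inter> closed_segment d a \<subseteq> {a}"
    using *[OF arcs_B(1) chord_ends(1) chords_B(1) sub(1)] *[OF arcs_B(1) chord_ends(2) chords_B(2) sub(1)]
      *[OF arcs_B(1) chord_ends(3) chords_B(3) sub(1)] *[OF arcs_B(1) chord_ends(4) chords_B(4) sub(1)] distinct
    by auto
  show "path_image \<delta> \<inter> closed_segment b a \<subseteq> {}" "path_image \<delta> \<inter> closed_segment d c \<subseteq> {c, d}"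
    "path_image \<delta> \<inter> closed_segment b c \<subseteq> {c}" "path_image \<delta> \<inter> closed_segment d a \<subseteq> {d}"
    using *[OF arcs_B(2) chord_ends(1) chords_B(1) sub(2)] *[OF arcs_B(2) chord_ends(2) chords_B(2) sub(2)]
      *[OF arcs_B(2) chord_ends(3) chords_B(3) sub(2)] *[OF arcs_B(2) chord_ends(4) chords_B(4) sub(2)] distinct
    by auto
qed

lemma C1_C2: "C1 \<inter> C2 = {}"
  using arc_chord(2,5) arcs_disjoint chords_disjoint(1) unfolding C1_def C2_def by blast

lemma C1_loop: "simple_path (\<gamma> +++ linepath b a)" "path_image (\<gamma> +++ linepath b a) = C1"
proof -
  have "path_image \<gamma> \<inter> path_image (linepath b a) \<subseteq> {pathstart \<gamma>, pathfinish \<gamma>}"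
    using arc_chord(1) \<gamma> by simp
  moreover have "arc (linepath b a)" using distinct by (intro arc_linepath) auto
  ultimately show "simple_path (\<gamma> +++ linepath b a)" "path_image (\<gamma> +++ linepath b a) = C1"
    using jordan_curve_join(1,2)[of \<gamma> "linepath b a"] \<gamma> by (auto simp: C1_def)
qed

lemma C2_loop: "simple_path (\<delta> +++ linepath d c)" "path_image (\<delta> +++ linepath d c) = C2"
proof -
  have "path_image \<delta> \<inter> path_image (linepath d c) \<subseteq> {pathstart \<delta>, pathfinish \<delta>}"
    using arc_chord(6) \<delta> by simp
  moreover have "arc (linepath d c)" using distinct by (intro arc_linepath) auto
  ultimately show "simple_path (\<delta> +++ linepath d c)" "path_image (\<delta> +++ linepath d c) = C2"
    using jordan_curve_join(1,2)[of \<delta> "linepath d c"] \<delta> by (auto simp: C2_def)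
qed

lemma C_loop:
  "simple_path ((\<gamma> +++ linepath b c) +++ (\<delta> +++ linepath d a))"
  "path_image ((\<gamma> +++ linepath b c) +++ (\<delta> +++ linepath d a)) = C"
proof -
  note x = arc_chord(3,8,4,7)
  have 1: "arc (\<gamma> +++ linepath b c)"
    by (rule arc_join) (use x \<gamma> distinct in \<open>auto intro: arc_linepath\<close>)
  have 2: "arc (\<delta> +++ linepath d a)"
    by (rule arc_join) (use x \<delta> distinct in \<open>auto intro: arc_linepath\<close>)
  have p: "path_image (\<gamma> +++ linepath b c) = path_image \<gamma> \<union> closed_segment b c"
    "path_image (\<delta> +++ linepath d a) = path_image \<delta> \<union> closed_segment d a"
    using \<gamma> \<delta> by (simp_all add: path_image_join)
  have "path_image (\<gamma> +++ linepath b c) \<inter> path_image (\<delta> +++ linepath d a) \<subseteq> {a, c}"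
    unfolding p using x arcs_disjoint chords_disjoint(2) by blast
  then show "simple_path ((\<gamma> +++ linepath b c) +++ (\<delta> +++ linepath d a))"
    "path_image ((\<gamma> +++ linepath b c) +++ (\<delta> +++ linepath d a)) = C"
    using jordan_curve_join(1,2)[OF 1 2] \<gamma> \<delta> p by (auto simp: C_def)
qed

lemma G_pieces: "Z \<in> G \<Longrightarrow> closed Z \<and> connected Z \<and> Z \<noteq> {}"
  using curve_family_pieces[OF F, of Z] by (auto simp: G_def)

lemma loop_pieces:
  fixes Z :: "complex set"
  assumes "simple_path g" "path_image g = Z"
  shows "closed Z \<and> connected Z \<and> Z \<noteq> {}"
  using assms closed_path_image[of g] connected_path_image[of g] simple_path_imp_path[of g] path_image_nonempty[of g] by auto

lemma components_split:
  "components (\<Union>F \<union> (closed_segment b a \<union> closed_segment d c)) = insert C1 (insert C2 G)"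
proof -
  have "\<Union>(insert C1 (insert C2 G)) = \<Union>F \<union> (closed_segment b a \<union> closed_segment d c)"
    using Union_F by (simp add: C1_def C2_def Un_ac)
  moreover have "components (\<Union>(insert C1 (insert C2 G))) = insert C1 (insert C2 G)"
  proof (rule components_disjoint_Union)
    show "finite (insert C1 (insert C2 G))" using Fd by (simp add: G_def)
    have "disjnt C1 Z" "disjnt C2 Z" if "Z \<in> G" for Z
      using G_disjoint[OF that] G_B[OF that] chords_B by (auto simp: disjnt_def C1_def C2_def)
    moreover have "disjoint G" using Fd(2) by (auto simp: G_def disjoint_def)
    ultimately show "disjoint (insert C1 (insert C2 G))"
      using C1_C2 by (auto simp: pairwise_insert disjnt_sym disjnt_def)
    show "closed Z \<and> connected Z \<and> Z \<noteq> {}" if "Z \<in> insert C1 (insert C2 G)" for Z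
      using that G_pieces loop_pieces[OF C1_loop] loop_pieces[OF C2_loop] by blast
  qed
  ultimately show ?thesis by simp
qed

lemma components_merge:
  "components (\<Union>F \<union> (closed_segment b c \<union> closed_segment d a)) = insert C G"
proof -
  have "\<Union>(insert C G) = \<Union>F \<union> (closed_segment b c \<union> closed_segment d a)"
    using Union_F by (simp add: C_def Un_ac)
  moreover have "components (\<Union>(insert C G)) = insert C G"
  proof (rule components_disjoint_Union)
    show "finite (insert C G)" using Fd by (simp add: G_def)
    have "disjnt C Z" if "Z \<in> G" for Z
      using G_disjoint[OF that] G_B[OF that] chords_B by (auto simp: disjnt_def C_def)
    moreover have "disjoint G" using Fd(2) by (auto simp: G_def disjoint_def)
    ultimately show "disjoint (insert C G)"
      by (auto simp: pairwise_insert disjnt_sym)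
    show "closed Z \<and> connected Z \<and> Z \<noteq> {}" if "Z \<in> insert C G" for Z
      using that G_pieces loop_pieces[OF C_loop] by blast
  qed
  ultimately show ?thesis by simp
qed

text \<open>\<open>C\<close> contains both arcs, while the disjoint \<open>C1\<close> and
  \<open>C2\<close> contain one each.\<close>

lemma circles_distinct: "C1 \<noteq> C2" "C \<noteq> C1" "C \<noteq> C2"
proof -
  show "C1 \<noteq> C2" using C1_C2 circles_B by blast
  have "path_image \<delta> \<noteq> {}" "path_image \<gamma> \<noteq> {}" by (auto simp: path_image_nonempty)
  then have "\<not> C \<subseteq> C1" "\<not> C \<subseteq> C2" using C1_C2 unfolding C_def C1_def C2_def by blast+
  then show "C \<noteq> C1" "C \<noteq> C2" by auto
qed

text \<open>The two resolutions differ by the boundary of a quadrilateral in the convex set \<open>B\<close>, which does not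
  wind around points outside \<open>B\<close>.\<close>

lemma winding_additive:
  assumes z: "z \<notin> B" "z \<notin> \<Union>F"
  shows "winding_number ((\<gamma> +++ linepath b c) +++ (\<delta> +++ linepath d a)) z =
    winding_number (\<gamma> +++ linepath b a) z + winding_number (\<delta> +++ linepath d c) z"
proof -
  have zs: "z \<notin> closed_segment b a" "z \<notin> closed_segment d c" "z \<notin> closed_segment b c" "z \<notin> closed_segment d a"
    using z chords_B by auto
  have zs': "z \<notin> closed_segment a b" "z \<notin> closed_segment c d" using zs by (auto simp: closed_segment_commute)
  have za: "z \<notin> path_image \<gamma>" "z \<notin> path_image \<delta>" using z \<gamma> \<delta> by auto
  have pa: "path \<gamma>" "path \<delta>" using \<gamma> \<delta> by (auto intro: arc_imp_path)
  \<comment> \<open>The closed quadrilateral \<open>b\<close>, \<open>c\<close>, \<open>d\<close>,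
    \<open>a\<close>: its vanishing winding number trades the chords of \<open>C\<close> for those
    of \<open>C1\<close> and \<open>C2\<close>.\<close>
  let ?q = "linepath b c +++ (linepath c d +++ (linepath d a +++ linepath a b))"
  have sub: "closed_segment a b \<subseteq> B" "closed_segment c d \<subseteq> B" using chords_B by (auto simp: closed_segment_commute)
  have "path_image ?q \<subseteq> B"
    using chords_B sub by (simp add: path_image_join)
  then have "winding_number ?q z = 0"
    by (intro winding_number_zero_outside[OF _ B(1)]) (use z in auto)
  moreover have "winding_number ?q z = winding_number (linepath b c) z + (winding_number (linepath c d) z +
      (winding_number (linepath d a) z + winding_number (linepath a b) z))"
    using zs zs' by (simp add: winding_number_join path_image_join)
  moreover have "winding_number (linepath c d) z = - winding_number (linepath d c) z"
    using winding_number_reversepath[of "linepath d c" z] zs by simp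
  moreover have "winding_number (linepath a b) z = - winding_number (linepath b a) z"
    using winding_number_reversepath[of "linepath b a" z] zs by simp
  ultimately have "winding_number (linepath b c) z + winding_number (linepath d a) z =
      winding_number (linepath b a) z + winding_number (linepath d c) z"
    by (simp add: algebra_simps)
  then show ?thesis
    using zs za pa \<gamma> \<delta> by (simp add: winding_number_join path_image_join algebra_simps)
qed

text \<open>Up to unknown orientation signs the class of \<open>C\<close> is the sum of the other
  two. Absolute values remove the signs from these nonnegative numbers, and the resulting three
  inequalities are symmetric in the circles.\<close>

lemma circle_class_triangle:
  assumes z: "z \<notin> B" "z \<notin> \<Union>F" and E: "{X, Y, Z} = {C1, C2, C}"
  shows "circle_class Z z \<le> circle_class X z + circle_class Y z"
proof -
  have zC: "z \<notin> C1" "z \<notin> C2" "z \<notin> C"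
    using z chords_B \<gamma>(4) \<delta>(4) by (auto simp: C1_def C2_def C_def)
  note cc1 = circle_class_cases[OF C1_loop(1), unfolded C1_loop(2), OF _ zC(1)]
  note cc2 = circle_class_cases[OF C2_loop(1), unfolded C2_loop(2), OF _ zC(2)]
  note cc = circle_class_cases[OF C_loop(1), unfolded C_loop(2), OF _ zC(3)]
  let ?x = "circle_class C1 z" and ?y = "circle_class C2 z" and ?w = "circle_class C z"
  have 01: "?x \<in> {0, 1}" "?y \<in> {0, 1}" "?w \<in> {0, 1}"
    using cc1(1) cc2(1) cc(1) \<gamma> \<delta> by simp_all
  obtain r s t :: int where rst: "r \<in> {1, -1}" "s \<in> {1, -1}" "t \<in> {1, -1}"
    "winding_number (\<gamma> +++ linepath b a) z = of_int (r * ?x)"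
    "winding_number (\<delta> +++ linepath d c) z = of_int (s * ?y)"
    "winding_number ((\<gamma> +++ linepath b c) +++ (\<delta> +++ linepath d a)) z = of_int (t * ?w)"
  proof -
    have "\<exists>r::int. r \<in> {1, -1} \<and> winding_number (\<gamma> +++ linepath b a) z = of_int (r * ?x)"
      using cc1(2) \<gamma> by (auto intro: exI[of _ 1] exI[of _ "-1"])
    moreover have "\<exists>r::int. r \<in> {1, -1} \<and> winding_number (\<delta> +++ linepath d c) z = of_int (r * ?y)"
      using cc2(2) \<delta> by (auto intro: exI[of _ 1] exI[of _ "-1"])
    moreover have "\<exists>r::int. r \<in> {1, -1} \<and> winding_number ((\<gamma> +++ linepath b c) +++ (\<delta> +++ linepath d a)) z = of_int (r * ?w)"
      using cc(2) \<gamma> \<delta> by (auto intro: exI[of _ 1] exI[of _ "-1"])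
    ultimately show thesis using that by blast
  qed
  have "(of_int (t * ?w) :: complex) = of_int (r * ?x + s * ?y)"
    using winding_additive[OF z] rst(4-6) by simp
  then have "t * ?w = r * ?x + s * ?y" unfolding of_int_eq_iff .
  then have tri: "?w \<le> ?x + ?y" "?x \<le> ?w + ?y" "?y \<le> ?w + ?x" "0 \<le> ?x" "0 \<le> ?y" "0 \<le> ?w"
  proof -
    have "\<bar>t * ?w\<bar> = ?w" "\<bar>r * ?x\<bar> = ?x" "\<bar>s * ?y\<bar> = ?y" "0 \<le> ?x" "0 \<le> ?y" "0 \<le> ?w"
      using 01 rst(1-3) by (auto simp: abs_mult)
    then show "?w \<le> ?x + ?y" "?x \<le> ?w + ?y" "?y \<le> ?w + ?x" "0 \<le> ?x" "0 \<le> ?y" "0 \<le> ?w"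
      using \<open>t * ?w = r * ?x + s * ?y\<close> by arith+
  qed
  have "card {C1, C2, C} = 3" using circles_distinct by simp
  moreover then have "card {X, Y, Z} = 3" unfolding E .
  ultimately have ne: "X \<noteq> Y" "Y \<noteq> Z" "X \<noteq> Z" "C1 \<noteq> C2" "C \<noteq> C1" "C \<noteq> C2"
    by (auto simp: card_insert_if split: if_splits)
  \<comment> \<open>The claim compares the class of \<open>Z\<close> with the total minus itself, so
    once the total is known only the identity of \<open>Z\<close> matters.\<close>
  have "(\<Sum>K\<in>{X, Y, Z}. circle_class K z) = (\<Sum>K\<in>{C1, C2, C}. circle_class K z)" unfolding E ..
  then have "circle_class X z + circle_class Y z + circle_class Z z = ?x + ?y + ?w"
    using ne by simp
  moreover have "Z = C1 \<or> Z = C2 \<or> Z = C" using E by blast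
  ultimately show ?thesis using tri by auto
qed

end

section \<open>Link diagrams as systems of curves\<close>

lemma Ints_small_diff:
  assumes "(x::real) - y \<in> \<int>" "s \<le> x" "x \<le> t" "s \<le> y" "y \<le> t" "t < s + 1"
  shows "x = y"
proof -
  obtain m :: int where m: "x - y = of_int m" using assms(1) by (auto elim: Ints_cases)
  then have "\<bar>of_int m :: real\<bar> < 1" using assms by linarith
  then have "m = 0" by linarith
  then show ?thesis using m by simp
qed

section \<open>Cutting the link before projecting it\<close>

locale oriented_link =
  fixes M :: "(complex \<times> real) set" and L :: link
  assumes link: "link_in M L"
begin

lemma comp_cont: "k < length L \<Longrightarrow> continuous_on UNIV (L ! k)"
  using link by (auto simp: link_in_def)

lemma comp_eq_iff: "k < length L \<Longrightarrow> (L ! k) s = (L ! k) t \<longleftrightarrow> s - t \<in> \<int>"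
  using link nth_mem by (auto simp: link_in_def)

lemma comp_disjoint: "k < length L \<Longrightarrow> l < length L \<Longrightarrow> (L ! k) s = (L ! l) t \<Longrightarrow> k = l"
proof (rule ccontr)
  assume *: "k < length L" "l < length L" "(L ! k) s = (L ! l) t" "k \<noteq> l"
  then have "range (L ! k) \<inter> range (L ! l) = {}" using link unfolding link_in_def by blast
  moreover have "(L ! k) s \<in> range (L ! k)" "(L ! k) s \<in> range (L ! l)" by (rule rangeI) (simp only: *(3) rangeI)
  ultimately show False by blast
qed

lemma comp_shift: "k < length L \<Longrightarrow> m \<in> \<int> \<Longrightarrow> (L ! k) (s + m) = (L ! k) s"
  by (simp add: comp_eq_iff)

lemma comp_image_shift: "k < length L \<Longrightarrow> m \<in> \<int> \<Longrightarrow> (L ! k) ` ((\<lambda>x. x + m) ` A) = (L ! k) ` A"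
  by (simp add: image_image comp_shift)

text \<open>The counterpart of \<open>curve_family\<close> in space. Here the components are
  embedded and disjoint, so cutting is a matter of parameter intervals, whereas their projections
  may still cross.\<close>

definition strand_family :: "(complex \<times> real) set set \<Rightarrow> (complex \<times> real) set \<Rightarrow> bool" where
  "strand_family F Q \<longleftrightarrow> finite F \<and> disjoint F \<and> Q \<subseteq> \<Union>F \<and>
    (\<forall>Y\<in>F. (\<exists>k<length L. Y = range (L ! k) \<and> Y \<inter> Q = {}) \<or>
      (\<exists>k<length L. \<exists>s t. s < t \<and> t < s + 1 \<and> Y = (L ! k) ` {s..t} \<and> Y \<inter> Q = {(L ! k) s, (L ! k) t}))"

lemma strand_family_cases:
  assumes "strand_family F Q" "Y \<in> F"
  obtains k where "k < length L" "Y = range (L ! k)" "Y \<inter> Q = {}" |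
    k s t where "k < length L" "s < t" "t < s + 1" "Y = (L ! k) ` {s..t}" "Y \<inter> Q = {(L ! k) s, (L ! k) t}"
proof -
  have "(\<exists>k<length L. Y = range (L ! k) \<and> Y \<inter> Q = {}) \<or>
      (\<exists>k<length L. \<exists>s t. s < t \<and> t < s + 1 \<and> Y = (L ! k) ` {s..t} \<and> Y \<inter> Q = {(L ! k) s, (L ! k) t})"
    using assms(1) unfolding strand_family_def by (elim conjE) (rule bspec[OF _ assms(2)])
  then show thesis
    using that by (elim disjE exE conjE) blast+
qed

lemma strand_family_link: "strand_family ((\<lambda>k. range (L ! k)) ` {..<length L}) {}"
proof -
  have "range (L ! k) \<inter> range (L ! l) = {}" if "k < length L" "l < length L" "range (L ! k) \<noteq> range (L ! l)" for k l
  proof (rule ccontr)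
    assume "range (L ! k) \<inter> range (L ! l) \<noteq> {}"
    then obtain p where "p \<in> range (L ! k)" "p \<in> range (L ! l)" by blast
    then obtain x y where "p = (L ! k) x" "p = (L ! l) y" by (elim rangeE)
    then have "(L ! k) x = (L ! l) y" by simp
    then show False using comp_disjoint[OF that(1,2), of x y] that(3) by blast
  qed
  then have "disjoint ((\<lambda>k. range (L ! k)) ` {..<length L})"
    unfolding disjoint_def ball_simps by simp
  then show ?thesis by (auto simp: strand_family_def)
qed

text \<open>The pieces \<open>N\<close> left of one member after a cut take its place; the new ends
  \<open>E\<close> lie in that member, so the other members keep their ends.\<close>

lemma strand_family_replace:
  assumes F: "strand_family F Q" and Y: "Y \<in> F" and N: "finite N" "disjoint N" "\<Union>N \<subseteq> Y"
    and E: "E \<subseteq> \<Union>N" "E \<subseteq> Y" and YQ: "Y \<inter> Q \<subseteq> \<Union>N"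
    and pieces: "\<And>Z. Z \<in> N \<Longrightarrow> \<exists>k<length L. \<exists>s t. s < t \<and> t < s + 1 \<and> Z = (L ! k) ` {s..t} \<and> Z \<inter> (Q \<union> E) = {(L ! k) s, (L ! k) t}"
  shows "strand_family ((F - {Y}) \<union> N) (Q \<union> E)"
  unfolding strand_family_def
proof (intro conjI ballI)
  have Fd: "finite F" "disjoint F" "Q \<subseteq> \<Union>F" using F by (auto simp: strand_family_def)
  show "finite ((F - {Y}) \<union> N)" using Fd N by simp
  have dY: "Z \<inter> Y = {}" if "Z \<in> F - {Y}" for Z using Fd(2) Y that by (auto simp: disjoint_def)
  have dN: "Z \<inter> W = {}" if "Z \<in> F - {Y}" "W \<in> N" for Z W using dY[OF that(1)] N(3) that(2) by blast
  show "disjoint ((F - {Y}) \<union> N)"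
    unfolding disjoint_def
  proof (intro ballI impI)
    fix A B assume AB: "A \<in> F - {Y} \<union> N" "B \<in> F - {Y} \<union> N" "A \<noteq> B"
    then consider "A \<in> F - {Y}" "B \<in> F - {Y}" | "A \<in> F - {Y}" "B \<in> N" | "A \<in> N" "B \<in> F - {Y}" | "A \<in> N" "B \<in> N" by blast
    then show "A \<inter> B = {}"
    proof cases
      case 1 then show ?thesis using Fd(2) AB(3) by (auto simp: disjoint_def)
    next
      case 2 then show ?thesis using dN by simp
    next
      case 3 then show ?thesis using dN[of B A] by auto
    next
      case 4 then show ?thesis using N(2) AB(3) by (auto simp: disjoint_def)
    qed
  qed
  show "Q \<union> E \<subseteq> \<Union>((F - {Y}) \<union> N)"
  proof
    fix p assume "p \<in> Q \<union> E"
    then consider "p \<in> E" | "p \<in> Q" "p \<in> Y" | "p \<in> Q" "p \<notin> Y" by blast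
    then show "p \<in> \<Union>((F - {Y}) \<union> N)"
      using E YQ Fd(3) by cases blast+
  qed
  fix Z assume "Z \<in> (F - {Y}) \<union> N"
  then consider "Z \<in> F - {Y}" | "Z \<in> N" by blast
  then show "(\<exists>k<length L. Z = range (L ! k) \<and> Z \<inter> (Q \<union> E) = {}) \<or>
      (\<exists>k<length L. \<exists>s t. s < t \<and> t < s + 1 \<and> Z = (L ! k) ` {s..t} \<and> Z \<inter> (Q \<union> E) = {(L ! k) s, (L ! k) t})"
  proof cases
    case 1
    then have "Z \<inter> (Q \<union> E) = Z \<inter> Q" using dY E(2) by blast
    then show ?thesis using F 1 unfolding strand_family_def by auto
  qed (use pieces in blast)
qed

text \<open>Cutting out an open passage turns a closed component into one arc, and an arc into two.
  The latter holds because the closed passage avoids the old ends and so sits strictly inside the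
  parameter interval.\<close>

lemma strand_family_remove:
  assumes F: "strand_family F Q" and k: "k < length L" and uv: "u < v" "v < u + 1"
    and sub: "(L ! k) ` {u..v} \<subseteq> \<Union>F" "(L ! k) ` {u..v} \<inter> Q = {}"
  shows "\<exists>F'. strand_family F' (Q \<union> {(L ! k) u, (L ! k) v}) \<and> \<Union>F' = \<Union>F - (L ! k) ` {u<..<v}"
proof -
  let ?K = "L ! k"
  have Fd: "disjoint F" using F by (auto simp: strand_family_def)
  have ku: "?K u \<in> ?K ` {u..v}" using uv by auto
  then obtain Y where Y: "Y \<in> F" "?K u \<in> Y" using sub(1) by blast
  have dj: "p \<notin> Z" if "p \<in> Y" "Z \<in> F - {Y}" for p Z
    using Fd Y(1) that by (auto simp: disjoint_def)
  have Un: "\<Union>((F - {Y}) \<union> N) = \<Union>F - ?K ` {u<..<v}" if "\<Union>N = Y - ?K ` {u<..<v}" "?K ` {u<..<v} \<subseteq> Y" for N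
  proof -
    have aux: "R \<union> N' = (R \<union> Y') - W" if "R \<inter> Y' = {}" "N' = Y' - W" "W \<subseteq> Y'" for R N' Y' W :: "(complex \<times> real) set"
      using that by blast
    have "\<Union>(F - {Y}) \<inter> Y = {}" using dj by blast
    from aux[OF this that] have "\<Union>(F - {Y}) \<union> \<Union>N = (\<Union>(F - {Y}) \<union> Y) - ?K ` {u<..<v}" .
    moreover have "\<Union>(F - {Y}) \<union> Y = \<Union>F" using Y(1) by auto
    ultimately show ?thesis by (simp only: Union_Un_distrib)
  qed
  consider l where "l < length L" "Y = range (L ! l)" "Y \<inter> Q = {}" |
      l s t where "l < length L" "s < t" "t < s + 1" "Y = (L ! l) ` {s..t}" "Y \<inter> Q = {(L ! l) s, (L ! l) t}"
    using strand_family_cases[OF F Y(1)] by metis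
  then show ?thesis
  proof cases
    case 1
    have "l = k" using comp_disjoint[OF 1(1) k] Y(2) 1(2) by (metis rangeE)
    then have Yr: "Y = range ?K" using 1 by simp
    \<comment> \<open>The complement of the passage: from its exit around the component to its
      entrance, one period later.\<close>
    define Z where "Z = ?K ` {v..u + 1}"
    have K1: "?K (u + 1) = ?K u" using comp_shift[OF k, of 1 u] by simp
    have ZY: "Z = Y - ?K ` {u<..<v}"
    proof
      show "Z \<subseteq> Y - ?K ` {u<..<v}"
      proof
        fix p assume "p \<in> Z"
        then obtain x where x: "v \<le> x" "x \<le> u + 1" "p = ?K x" by (auto simp: Z_def)
        have "p \<notin> ?K ` {u<..<v}"
        proof
          assume "p \<in> ?K ` {u<..<v}"
          then obtain y where y: "u < y" "y < v" "?K x = ?K y" using x by auto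
          then have "x - y \<in> \<int>" using comp_eq_iff[OF k] by simp
          then have "x = y" by (rule Ints_small_diff[where s = y and t = "u + 1"]) (use x y in auto)
          then show False using x y by simp
        qed
        then show "p \<in> Y - ?K ` {u<..<v}" using x Yr by auto
      qed
      show "Y - ?K ` {u<..<v} \<subseteq> Z"
      proof
        fix p assume p: "p \<in> Y - ?K ` {u<..<v}"
        then obtain x where x: "p = ?K x" using Yr by auto
        \<comment> \<open>The parameter reduced modulo 1 into the period that starts at
          \<open>u\<close>.\<close>
        define y where "y = x - of_int \<lfloor>x - u\<rfloor>"
        have y: "u \<le> y" "y < u + 1" unfolding y_def by linarith+
        have px: "p = ?K y" unfolding x y_def using comp_eq_iff[OF k] by simp
        show "p \<in> Z"
        proof (cases "y = u")
          case True
          then have "p = ?K (u + 1)" using px K1 by simp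
          then show ?thesis unfolding Z_def using uv by auto
        next
          case False
          then have "v \<le> y" using p px y by (auto simp: not_less[symmetric])
          then show ?thesis unfolding Z_def using px y by auto
        qed
      qed
    qed
    have "strand_family ((F - {Y}) \<union> {Z}) (Q \<union> {?K u, ?K v})"
    proof (rule strand_family_replace[OF F Y(1)])
      have e: "?K v \<in> Z" "?K u \<in> Z" using uv K1[symmetric] unfolding Z_def by auto
      then show "{?K u, ?K v} \<subseteq> \<Union>{Z}" "{?K u, ?K v} \<subseteq> Y" using ZY by auto
      show "\<Union>{Z} \<subseteq> Y" using ZY by auto
      show "Y \<inter> Q \<subseteq> \<Union>{Z}" using 1 by simp
      fix Z' assume "Z' \<in> {Z}"
      moreover have "Z \<inter> (Q \<union> {?K u, ?K v}) = {?K v, ?K (u + 1)}"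
        using e 1(3) ZY K1 by auto
      ultimately show "\<exists>k<length L. \<exists>s t. s < t \<and> t < s + 1 \<and> Z' = (L ! k) ` {s..t} \<and> Z' \<inter> (Q \<union> {?K u, ?K v}) = {(L ! k) s, (L ! k) t}"
        using uv k by (intro exI[of _ k] conjI exI[of _ v] exI[of _ "u + 1"]) (auto simp: Z_def)
    qed (auto simp: disjoint_def)
    moreover have "\<Union>((F - {Y}) \<union> {Z}) = \<Union>F - ?K ` {u<..<v}"
      by (rule Un) (use ZY Yr in auto)
    ultimately show ?thesis by blast
  next
    case 2
    have "l = k" using comp_disjoint[OF 2(1) k] Y(2) 2(4) by (metis imageE)
    then have Yk: "Y = ?K ` {s..t}" "Y \<inter> Q = {?K s, ?K t}" using 2 by auto
    obtain x where x: "s \<le> x" "x \<le> t" "?K u = ?K x" using Y(2) Yk by auto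
    \<comment> \<open>The integer shift that moves the passage into the parameter interval of the
      arc.\<close>
    define m where "m = x - u"
    have m: "m \<in> \<int>" using x(3) comp_eq_iff[OF k, of x u] by (simp add: m_def)
    define y where "y = v + m"
    have xy: "x < y" "y < x + 1" using uv by (auto simp: y_def m_def)
    have xu: "x = u + m" by (simp add: m_def)
    have img: "?K ` {u..v} = ?K ` {x..y}" "?K ` {u<..<v} = ?K ` {x<..<y}"
    proof -
      have "(\<lambda>x. x + m) ` {u..v} = {x..y}" unfolding xu y_def by (rule image_add_atLeastAtMost')
    moreover have "(\<lambda>x. x + m) ` {u<..<v} = {x<..<y}"
      unfolding xu y_def by (auto intro!: image_eqI[of _ _ "z - m" for z])
    ultimately show "?K ` {u..v} = ?K ` {x..y}" "?K ` {u<..<v} = ?K ` {x<..<y}"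
      using comp_image_shift[OF k m, of "{u..v}"] comp_image_shift[OF k m, of "{u<..<v}"] by (simp_all only:)
  qed
    have Kv: "?K v = ?K y" unfolding y_def using comp_shift[OF k m] by simp
    have stQ: "?K s \<in> Q" "?K t \<in> Q" using Yk by auto
    have "x \<noteq> s" "x \<noteq> t" using sub(2) ku x(3) stQ by auto
    then have sxt: "s < x" "x < t" using x by auto
    have yt: "y < t"
    proof (rule ccontr)
      assume "\<not> y < t"
      then have "?K t \<in> ?K ` {x..y}" using sxt by auto
      then show False using sub(2) stQ img by auto
    qed
    have inj: "p = q" if "?K p = ?K q" "s \<le> p" "p \<le> t" "s \<le> q" "q \<le> t" for p q
      using Ints_small_diff[of p q s t] that comp_eq_iff[OF k] 2(3) by simp
    define Z1 where "Z1 = ?K ` {s..x}"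
    define Z2 where "Z2 = ?K ` {y..t}"
    have Z12: "Z1 \<inter> Z2 = {}"
      using inj sxt xy yt by (fastforce simp: Z1_def Z2_def)
    have ZY: "Z1 \<union> Z2 = Y - ?K ` {u<..<v}"
    proof
      show "Z1 \<union> Z2 \<subseteq> Y - ?K ` {u<..<v}"
        using inj sxt xy yt unfolding img Yk Z1_def Z2_def by fastforce
      show "Y - ?K ` {u<..<v} \<subseteq> Z1 \<union> Z2"
      proof
        fix p assume p: "p \<in> Y - ?K ` {u<..<v}"
        then obtain w where w: "s \<le> w" "w \<le> t" "p = ?K w" using Yk by auto
        then have "\<not> (x < w \<and> w < y)" using p img by auto
        then show "p \<in> Z1 \<union> Z2" using w by (auto simp: Z1_def Z2_def)
      qed
    qed
    have n: "?K x \<notin> Z2" "?K y \<notin> Z1" "?K s \<notin> Z2" "?K t \<notin> Z1"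
      using inj sxt xy yt by (fastforce simp: Z1_def Z2_def)+
    have e: "?K s \<in> Z1" "?K x \<in> Z1" "?K y \<in> Z2" "?K t \<in> Z2"
      using sxt yt by (auto simp: Z1_def Z2_def)
    have "strand_family ((F - {Y}) \<union> {Z1, Z2}) (Q \<union> {?K u, ?K v})"
    proof (rule strand_family_replace[OF F Y(1)])
      show "disjoint {Z1, Z2}" using Z12 by (auto simp: disjoint_def)
      show "\<Union>{Z1, Z2} \<subseteq> Y" using ZY by auto
      show "{?K u, ?K v} \<subseteq> \<Union>{Z1, Z2}" using e x(3) Kv by simp
      then show "{?K u, ?K v} \<subseteq> Y" using ZY by auto
      show "Y \<inter> Q \<subseteq> \<Union>{Z1, Z2}" using e Yk by auto
      have ZQ: "Z1 \<inter> Q \<subseteq> {?K s, ?K t}" "Z2 \<inter> Q \<subseteq> {?K s, ?K t}" using ZY Yk(2) by blast+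
      have "Z1 \<inter> (Q \<union> {?K u, ?K v}) = {?K s, ?K x}"
        using ZQ n e stQ x(3) Kv by auto
      moreover have "Z2 \<inter> (Q \<union> {?K u, ?K v}) = {?K y, ?K t}"
        using ZQ n e stQ x(3) Kv by auto
      moreover have "s < x" "x < s + 1" "y < t" "t < y + 1" using sxt xy yt 2(3) by auto
      ultimately show "\<exists>k<length L. \<exists>s t. s < t \<and> t < s + 1 \<and> Z = (L ! k) ` {s..t} \<and> Z \<inter> (Q \<union> {?K u, ?K v}) = {(L ! k) s, (L ! k) t}"
        if "Z \<in> {Z1, Z2}" for Z
        using that k unfolding Z1_def Z2_def by blast
    qed simp
    moreover have "\<Union>((F - {Y}) \<union> {Z1, Z2}) = \<Union>F - ?K ` {u<..<v}"
    proof (rule Un)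
      have "{x<..<y} \<subseteq> {s..t}" using sxt yt by auto
      then show "?K ` {u<..<v} \<subseteq> Y" unfolding img Yk by (rule image_mono)
    qed (use ZY in auto)
    ultimately show ?thesis by blast
  qed
qed

text \<open>Disjointness is required of the closed passages, so that each further cut avoids the
  ends left by the earlier ones.\<close>

lemma strand_family_remove_all:
  assumes "finite Ps"
    and "\<And>k u v. (k, u, v) \<in> Ps \<Longrightarrow> k < length L \<and> u < v \<and> v < u + 1"
    and "\<And>k u v k' u' v'. (k, u, v) \<in> Ps \<Longrightarrow> (k', u', v') \<in> Ps \<Longrightarrow> (k, u, v) \<noteq> (k', u', v') \<Longrightarrow>
      (L ! k) ` {u..v} \<inter> (L ! k') ` {u'..v'} = {}"
  shows "\<exists>F. strand_family F (\<Union>(k, u, v)\<in>Ps. {(L ! k) u, (L ! k) v}) \<and>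
    \<Union>F = (\<Union>k<length L. range (L ! k)) - (\<Union>(k, u, v)\<in>Ps. (L ! k) ` {u<..<v})"
  using assms
proof (induction Ps rule: finite_induct)
  case empty
  then show ?case using strand_family_link by auto
next
  case (insert p Ps)
  obtain k u v where p: "p = (k, u, v)" by (metis prod_cases3)
  let ?K = "L ! k"
  let ?Q = "\<Union>(k, u, v)\<in>Ps. {(L ! k) u, (L ! k) v}"
  let ?U = "(\<Union>k<length L. range (L ! k)) - (\<Union>(k, u, v)\<in>Ps. (L ! k) ` {u<..<v})"
  obtain F where F: "strand_family F ?Q" "\<Union>F = ?U"
    using insert.IH insert.prems by (metis (no_types, lifting) insertCI)
  have k: "k < length L" "u < v" "v < u + 1" using insert.prems(1)[of k u v] p by auto
  have d: "?K ` {u..v} \<inter> (L ! k') ` {u'..v'} = {}" "u' < v'" if "(k', u', v') \<in> Ps" for k' u' v'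
  proof -
    have "(k, u, v) \<noteq> (k', u', v')" using that p insert.hyps(2) by auto
    then show "?K ` {u..v} \<inter> (L ! k') ` {u'..v'} = {}"
      using insert.prems(2)[of k u v k' u' v'] that p by blast
    show "u' < v'" using insert.prems(1)[of k' u' v'] that by blast
  qed
  have in_F: "?K ` {u..v} \<subseteq> \<Union>F"
  proof -
    have "?K ` {u..v} \<inter> (L ! k') ` {u'<..<v'} = {}" if "(k', u', v') \<in> Ps" for k' u' v'
    proof -
      have "(L ! k') ` {u'<..<v'} \<subseteq> (L ! k') ` {u'..v'}" by (rule image_mono) auto
      then show ?thesis using d(1)[OF that] by blast
    qed
    then show ?thesis unfolding F(2) using k(1) by blast
  qed
  have no_Q: "?K ` {u..v} \<inter> ?Q = {}"
  proof -
    have "?K ` {u..v} \<inter> {(L ! k') u', (L ! k') v'} = {}" if "(k', u', v') \<in> Ps" for k' u' v'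
    proof -
      have "(L ! k') u' \<in> (L ! k') ` {u'..v'}" "(L ! k') v' \<in> (L ! k') ` {u'..v'}"
        using d(2)[OF that] by auto
      then have "(L ! k') u' \<notin> ?K ` {u..v}" "(L ! k') v' \<notin> ?K ` {u..v}"
        using d(1)[OF that] unfolding disjoint_iff by blast+
      then show ?thesis unfolding Int_insert_right by (simp only: if_False Int_empty_right)
    qed
    then have "?K ` {u..v} \<inter> (case q of (k, u, v) \<Rightarrow> {(L ! k) u, (L ! k) v}) = {}" if "q \<in> Ps" for q
      using that by (cases q) simp
    then show ?thesis by blast
  qed
  obtain F' where F': "strand_family F' (?Q \<union> {?K u, ?K v})" "\<Union>F' = \<Union>F - ?K ` {u<..<v}"
    using strand_family_remove[OF F(1) k in_F no_Q] by (elim exE conjE) (rule that)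
  have Q: "?Q \<union> {?K u, ?K v} = (\<Union>(k, u, v)\<in>insert p Ps. {(L ! k) u, (L ! k) v})"
    unfolding p by (simp add: Un_commute)
  have U: "\<Union>F - ?K ` {u<..<v} = (\<Union>k<length L. range (L ! k)) - (\<Union>(k, u, v)\<in>insert p Ps. (L ! k) ` {u<..<v})"
    unfolding p F(2) UN_insert prod.case set_diff_eq by (simp only: Un_iff) blast
  show ?case
    unfolding Q[symmetric] U[symmetric] by (intro exI[of _ F'] conjI F')
qed

text \<open>An injective projection commutes with intersections, so disjointness and end points
  carry over. Closed members become simple loops on one period, and arcs are reparametrized
  affinely.\<close>

lemma strand_family_project:
  assumes F: "strand_family F Q" and inj: "inj_on fst (\<Union>F)"
  shows "curve_family ((`) fst ` F) (fst ` Q)"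
  unfolding curve_family_def
proof (intro conjI ballI)
  have Fd: "finite F" "disjoint F" "Q \<subseteq> \<Union>F" using F by (auto simp: strand_family_def)
  show "finite ((`) fst ` F)" using Fd by simp
  show "fst ` Q \<subseteq> \<Union>((`) fst ` F)" using Fd(3) by blast
  have int: "fst ` A \<inter> fst ` B = fst ` (A \<inter> B)" if "A \<subseteq> \<Union>F" "B \<subseteq> \<Union>F" for A B
    using inj_on_image_Int[OF inj that] by simp
  show "disjoint ((`) fst ` F)"
    unfolding disjoint_def
  proof (intro ballI impI)
    fix A B assume "A \<in> (`) fst ` F" "B \<in> (`) fst ` F" "A \<noteq> B"
    then obtain A' B' where AB: "A' \<in> F" "B' \<in> F" "A = fst ` A'" "B = fst ` B'" "A' \<noteq> B'" by auto
    then have "A' \<inter> B' = {}" using Fd(2) by (auto simp: disjoint_def)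
    then show "A \<inter> B = {}" using int[of A' B'] AB by auto
  qed
  fix Z assume "Z \<in> (`) fst ` F"
  then obtain Y where Y: "Y \<in> F" "Z = fst ` Y" by auto
  have ZQ: "Z \<inter> fst ` Q = fst ` (Y \<inter> Q)" using int[of Y Q] Y Fd(3) by auto
  have injY: "inj_on fst Y" using inj Y(1) by (auto intro: inj_on_subset)
  consider k where "k < length L" "Y = range (L ! k)" "Y \<inter> Q = {}" |
      k s t where "k < length L" "s < t" "t < s + 1" "Y = (L ! k) ` {s..t}" "Y \<inter> Q = {(L ! k) s, (L ! k) t}"
    using strand_family_cases[OF F Y(1)] by metis
  then show "jordan_curve Z \<and> Z \<inter> fst ` Q = {} \<or>
      (\<exists>\<gamma>. arc \<gamma> \<and> path_image \<gamma> = Z \<and> Z \<inter> fst ` Q = {pathstart \<gamma>, pathfinish \<gamma>})"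
  proof cases
    case 1
    define g where "g = (\<lambda>x. fst ((L ! k) x))"
    have g: "g x = g y \<longleftrightarrow> x - y \<in> \<int>" for x y
      using inj_onD[OF injY, of "(L ! k) x" "(L ! k) y"] comp_eq_iff[OF 1(1), of x y] 1(2) by (auto simp: g_def)
    have "path g"
      unfolding path_def g_def using comp_cont[OF 1(1)]
      by (intro continuous_on_fst) (auto intro: continuous_on_subset)
    moreover have "loop_free g"
      unfolding loop_free_def
    proof (intro ballI impI)
      fix x y :: real assume xy: "x \<in> {0..1}" "y \<in> {0..1}" "g x = g y"
      then obtain m :: int where m: "x - y = of_int m" using g by (auto elim: Ints_cases)
      then have "\<bar>of_int m :: real\<bar> \<le> 1" using xy by auto
      then have "\<bar>m\<bar> \<le> 1" by linarith
      then have "m = 0 \<or> m = 1 \<or> m = -1" by linarith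
      then show "x = y \<or> x = 0 \<and> y = 1 \<or> x = 1 \<and> y = 0" using m xy by auto
    qed
    ultimately have "simple_path g" by (simp add: simple_path_def)
    moreover have "pathfinish g = pathstart g" using g by (simp add: pathfinish_def pathstart_def)
    moreover have "path_image g = Z"
    proof -
      have "g x \<in> g ` {0..1}" for x
      proof -
        have "g x = g (frac x)" using g by (simp add: frac_def)
        moreover have "frac x \<in> {0..1}" using frac_lt_1[of x] by (simp add: less_imp_le)
        ultimately show ?thesis by blast
      qed
      then have "range g = g ` {0..1}" by auto
      then show ?thesis using Y(2) 1(2) by (auto simp: path_image_def g_def image_image)
    qed
    ultimately have "jordan_curve Z" unfolding jordan_curve_def by blast
    then show ?thesis using ZQ 1(3) by simp
  next
    case 2
    define h where "h = (\<lambda>x. s + (t - s) * x)"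
    define g where "g = (\<lambda>x. fst ((L ! k) (h x)))"
    have h: "h ` {0..1} = {s..t}" "h 0 = s" "h 1 = t"
    proof -
      show "h ` {0..1} = {s..t}"
        using image_affinity_atLeastAtMost[of "t - s" s 0 1] 2(2) by (simp add: h_def add.commute)
    qed (auto simp: h_def)
    have "path g"
    proof -
      have "continuous_on {0..1} ((L ! k) \<circ> h)"
        using comp_cont[OF 2(1)] unfolding h_def
        by (intro continuous_on_compose continuous_intros) (auto intro: continuous_on_subset)
      then show ?thesis unfolding path_def g_def by (auto intro!: continuous_on_fst simp: o_def)
    qed
    moreover have "inj_on g {0..1}"
    proof (rule inj_onI)
      fix x y :: real assume xy: "x \<in> {0..1}" "y \<in> {0..1}" "g x = g y"
      then have hxy: "h x \<in> {s..t}" "h y \<in> {s..t}" using h by blast+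
      then have "(L ! k) (h x) = (L ! k) (h y)"
        using inj_onD[OF injY, of "(L ! k) (h x)" "(L ! k) (h y)"] xy(3) unfolding g_def 2(4) by blast
      then have "h x = h y"
        using Ints_small_diff[of "h x" "h y" s t] hxy 2(3) comp_eq_iff[OF 2(1)] by auto
      then show "x = y" using 2(2) by (simp add: h_def)
    qed
    ultimately have "arc g" by (simp add: arc_def)
    moreover have "path_image g = Z"
      unfolding path_image_def Y(2) 2(4) h(1)[symmetric] by (simp add: g_def image_image)
    moreover have "Z \<inter> fst ` Q = {pathstart g, pathfinish g}"
      using ZQ 2(5) h by (simp add: pathstart_def pathfinish_def g_def)
    ultimately show ?thesis by blast
  qed
qed

end

section \<open>The diagram outside the crossing disks\<close>

definition ports :: "link \<Rightarrow> crossing \<Rightarrow> complex set" where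
  "ports L c = {over_tail L c, over_head L c, under_tail L c, under_head L c}"

definition outside_disks :: "diagram \<Rightarrow> complex set" where
  "outside_disks D = shadow D - (\<Union>c\<in>set (crossings D). ball (center c) (radius c))"

text \<open>Cutting all over and under passages in space removes exactly what lies over the open
  disks. These contain the crossing centres, the only places where distinct points of the link
  project together, so the projection is injective on the rest.\<close>

lemma curve_family_outside_disks:
  assumes D: "diagram_in Surf D"
  shows "\<exists>F. curve_family F (\<Union>c\<in>set (crossings D). ports (dlink D) c) \<and> \<Union>F = outside_disks D"
proof -
  define L where "L = dlink D"
  interpret oriented_link "Surf \<times> {0..1}" L
    using D by unfold_locales (simp add: diagram_in_def L_def)
  have cr: "is_crossing L c" if "c \<in> set (crossings D)" for c
    using D that by (simp add: diagram_in_def L_def)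
  have dj: "cball (center c) (radius c) \<inter> cball (center c') (radius c') = {}"
    if "c \<in> set (crossings D)" "c' \<in> set (crossings D)" "c \<noteq> c'" for c c'
    using D that unfolding diagram_in_def by (metis in_set_conv_nth)
  \<comment> \<open>Triples of component, entry and exit parameter, two for each crossing.\<close>
  define Ps where "Ps = (\<Union>c\<in>set (crossings D). {(over c, over_in c, over_out c), (under c, under_in c, under_out c)})"
  have Pl: "k < length L \<and> u < v \<and> v < u + 1" if "(k, u, v) \<in> Ps" for k u v
    using that cr unfolding Ps_def is_crossing_def by fastforce
  have cballI: "proj_at L k x \<in> cball (center c) (radius c)"
    if "c \<in> set (crossings D)" "(k, u, v) \<in> {(over c, over_in c, over_out c), (under c, under_in c, under_out c)}" "x \<in> {u..v}" for c k u v x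
  proof -
    have "k < length L" using Pl that unfolding Ps_def by blast
    moreover have "x + of_int (0::int) \<in> {u..v}" using that(3) by simp
    ultimately show ?thesis
      using cr[OF that(1)] that(2) unfolding is_crossing_def by blast
  qed
  have ball_iff: "proj_at L k x \<in> ball (center c) (radius c) \<longleftrightarrow>
      (L ! k) x \<in> (L ! over c) ` {over_in c<..<over_out c} \<union> (L ! under c) ` {under_in c<..<under_out c}"
    if "c \<in> set (crossings D)" "k < length L" for c k x
  proof -
    have im: "(L ! k) x \<in> (L ! l) ` {u<..<v} \<longleftrightarrow> k = l \<and> (\<exists>m::int. x + m \<in> {u<..<v})" if l: "l < length L" for l u v
    proof
      assume "(L ! k) x \<in> (L ! l) ` {u<..<v}"
      then obtain y where y: "y \<in> {u<..<v}" "(L ! k) x = (L ! l) y" by auto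
      then have kl: "k = l" using comp_disjoint \<open>k < length L\<close> l by blast
      then have "y - x \<in> \<int>" using y comp_eq_iff[OF l, of y x] by simp
      then obtain m :: int where "y - x = of_int m" by (auto elim: Ints_cases)
      then have "x + of_int m = y" by simp
      then show "k = l \<and> (\<exists>m::int. x + m \<in> {u<..<v})" using kl y by metis
    next
      assume "k = l \<and> (\<exists>m::int. x + m \<in> {u<..<v})"
      then obtain m :: int where m: "k = l" "x + m \<in> {u<..<v}" by blast
      have "(L ! l) (x + m) = (L ! l) x" using comp_shift[OF l] by simp
      then show "(L ! k) x \<in> (L ! l) ` {u<..<v}" using m by (metis imageI)
    qed
    have "over c < length L" "under c < length L" using cr[OF that(1)] by (auto simp: is_crossing_def)
    then show ?thesis
      using cr[OF that(1)] that(2) unfolding is_crossing_def Un_iff by (simp only: im)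
  qed
  have Pd: "(L ! k) ` {u..v} \<inter> (L ! k') ` {u'..v'} = {}"
    if P: "(k, u, v) \<in> Ps" "(k', u', v') \<in> Ps" and ne: "(k, u, v) \<noteq> (k', u', v')" for k u v k' u' v'
  proof -
    obtain c where c: "c \<in> set (crossings D)" "(k, u, v) \<in> {(over c, over_in c, over_out c), (under c, under_in c, under_out c)}"
      using P(1) unfolding Ps_def by blast
    obtain c' where c': "c' \<in> set (crossings D)" "(k', u', v') \<in> {(over c', over_in c', over_out c'), (under c', under_in c', under_out c')}"
      using P(2) unfolding Ps_def by blast
    \<comment> \<open>Passages at different crossings lie over disjoint disks. At one crossing the
      two passages could meet only on a common component, where \<open>is_crossing\<close> keeps
      their parameters from differing by an integer.\<close>
    have False if xy: "x \<in> {u..v}" "y \<in> {u'..v'}" "(L ! k) x = (L ! k') y" for x y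
    proof (cases "c = c'")
      case False
      have "proj_at L k x = proj_at L k' y" using xy(3) by (simp add: proj_at_def)
      then show False using cballI[OF c xy(1)] cballI[OF c' xy(2)] dj[OF c(1) c'(1) False] by (metis IntI empty_iff)
    next
      case True
      have kl: "k < length L" "k' < length L" using Pl P by blast+
      then have "k = k'" using comp_disjoint xy(3) by blast
      then have Z: "x - y \<in> \<int>" "y - x \<in> \<int>" using comp_eq_iff[of k' x y] comp_eq_iff[of k' y x] xy(3) kl by auto
      have ov: "\<forall>s\<in>{over_in c..over_out c}. \<forall>t\<in>{under_in c..under_out c}. s - t \<notin> \<int>" if "over c = under c"
        using cr[OF c(1)] that by (simp add: is_crossing_def)
      show False
        using c(2) c'(2) ne \<open>k = k'\<close> True ov xy(1,2) Z by auto
    qed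
    then show ?thesis by blast
  qed
  have "finite Ps" by (simp add: Ps_def)
  from strand_family_remove_all[OF this Pl Pd]
  obtain F where F: "strand_family F (\<Union>(k, u, v)\<in>Ps. {(L ! k) u, (L ! k) v})"
    "\<Union>F = (\<Union>k<length L. range (L ! k)) - (\<Union>(k, u, v)\<in>Ps. (L ! k) ` {u<..<v})"
    by blast
  have FU: "p \<in> \<Union>F \<longleftrightarrow> (\<exists>k<length L. \<exists>x. p = (L ! k) x \<and> (\<forall>c\<in>set (crossings D). proj_at L k x \<notin> ball (center c) (radius c)))" for p
  proof -
    have "(\<Union>(k, u, v)\<in>Ps. (L ! k) ` {u<..<v}) =
      (\<Union>c\<in>set (crossings D). (L ! over c) ` {over_in c<..<over_out c} \<union> (L ! under c) ` {under_in c<..<under_out c})"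
      by (auto simp: Ps_def)
    then have "p \<in> \<Union>F \<longleftrightarrow> p \<in> (\<Union>k<length L. range (L ! k)) \<and>
        (\<forall>c\<in>set (crossings D). p \<notin> (L ! over c) ` {over_in c<..<over_out c} \<union> (L ! under c) ` {under_in c<..<under_out c})"
      unfolding F(2) by blast
    also have "\<dots> \<longleftrightarrow> (\<exists>k<length L. \<exists>x. p = (L ! k) x \<and>
        (\<forall>c\<in>set (crossings D). p \<notin> (L ! over c) ` {over_in c<..<over_out c} \<union> (L ! under c) ` {under_in c<..<under_out c}))"
      by blast
    also have "\<dots> \<longleftrightarrow> (\<exists>k<length L. \<exists>x. p = (L ! k) x \<and> (\<forall>c\<in>set (crossings D). proj_at L k x \<notin> ball (center c) (radius c)))"
    proof -
      have "(\<forall>c\<in>set (crossings D). (L ! k) x \<notin> (L ! over c) ` {over_in c<..<over_out c} \<union> (L ! under c) ` {under_in c<..<under_out c}) \<longleftrightarrow>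
          (\<forall>c\<in>set (crossings D). proj_at L k x \<notin> ball (center c) (radius c))" if "k < length L" for k x
        using ball_iff[OF _ that] by blast
      then show ?thesis by blast
    qed
    finally show ?thesis .
  qed
  have "inj_on fst (\<Union>F)"
  proof (rule inj_onI)
    fix p q assume pq: "p \<in> \<Union>F" "q \<in> \<Union>F" "fst p = fst q"
    obtain k x where k: "k < length L" "p = (L ! k) x" "\<forall>c\<in>set (crossings D). proj_at L k x \<notin> ball (center c) (radius c)"
      using pq(1) unfolding FU by blast
    obtain l y where l: "l < length L" "q = (L ! l) y"
      using pq(2) unfolding FU by blast
    have "proj_at L k x = proj_at L l y" using pq(3) k l by (simp add: proj_at_def)
    then have "k = l \<and> x - y \<in> \<int> \<or> proj_at L k x \<in> center ` set (crossings D)"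
      using D k(1) l(1) unfolding diagram_in_def L_def by blast
    moreover have "proj_at L k x \<notin> center ` set (crossings D)"
      using k(3) cr by (fastforce simp: is_crossing_def)
    ultimately show "p = q" using k l comp_eq_iff by blast
  qed
  from strand_family_project[OF F(1) this]
  have "curve_family ((`) fst ` F) (fst ` (\<Union>(k, u, v)\<in>Ps. {(L ! k) u, (L ! k) v}))" .
  moreover have "fst ` (\<Union>(k, u, v)\<in>Ps. {(L ! k) u, (L ! k) v}) = (\<Union>c\<in>set (crossings D). ports (dlink D) c)"
    by (auto simp: Ps_def ports_def over_tail_def over_head_def under_tail_def under_head_def proj_at_def L_def image_UN)
  moreover have "\<Union>((`) fst ` F) = outside_disks D"
  proof -
    have "\<Union>((`) fst ` F) = fst ` \<Union>F" by blast
    also have "\<dots> = outside_disks D"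
    proof (rule Set.set_eqI)
      fix z
      have "z \<in> shadow D \<longleftrightarrow> (\<exists>k<length L. \<exists>x. z = proj_at L k x)"
      proof
        assume "z \<in> shadow D"
        then obtain K x where "K \<in> set L" "z = fst (K x)" by (auto simp: shadow_def L_def)
        then show "\<exists>k<length L. \<exists>x. z = proj_at L k x" by (metis in_set_conv_nth proj_at_def)
      next
        assume "\<exists>k<length L. \<exists>x. z = proj_at L k x"
        then obtain k x where kx: "k < length L" "z = fst ((L ! k) x)" by (auto simp: proj_at_def)
        then show "z \<in> shadow D"
          unfolding shadow_def L_def[symmetric] by (intro UN_I[of "L ! k"] nth_mem) simp_all
      qed
      then show "z \<in> fst ` \<Union>F \<longleftrightarrow> z \<in> outside_disks D"
        unfolding outside_disks_def image_iff Bex_def FU Diff_iff UN_iff proj_at_def by blast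
    qed
    finally show ?thesis .
  qed
  ultimately show ?thesis by metis
qed

section \<open>Chords in a crossing disk\<close>

text \<open>Everything follows from signs: on a chord from \<open>a\<close> or \<open>b\<close> to
  \<open>c\<close> the function \<open>side\<close> is positive except at its start, and on one to
  \<open>d\<close> it is negative except there. At a crossing, \<open>a\<close> and \<open>b\<close>
  are the over ends, \<open>c\<close> the left and \<open>d\<close> the right end.\<close>

lemma chord_geometry:
  assumes c: "side a b c > 0" and d: "side a b d < 0"
  shows "distinct [a, b, c, d]"
    and "closed_segment a c \<inter> closed_segment b d = {}"
    and "closed_segment b c \<inter> closed_segment a d = {}"
    and "closed_segment a c \<inter> {a, b, c, d} = {a, c}"
    and "closed_segment b c \<inter> {a, b, c, d} = {b, c}"
    and "closed_segment a d \<inter> {a, b, c, d} = {a, d}"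
    and "closed_segment b d \<inter> {a, b, c, d} = {b, d}"
proof -
  have ab: "a \<noteq> b" using c by (auto simp: side_def)
  then show "distinct [a, b, c, d]" using c d by auto
  have pos: "side a b z \<ge> 0 \<and> (side a b z = 0 \<longrightarrow> z = x)" if z: "z \<in> closed_segment x c" "side a b x = 0" for z x
  proof -
    obtain u where u: "0 \<le> u" "u \<le> 1" "z = (1 - u) *\<^sub>R x + u *\<^sub>R c" "side a b z = (1 - u) * side a b x + u * side a b c"
      using side_segment[OF z(1), of a b] .
    then show ?thesis using z(2) c by auto
  qed
  have neg: "side a b z \<le> 0 \<and> (side a b z = 0 \<longrightarrow> z = x)" if z: "z \<in> closed_segment x d" "side a b x = 0" for z x
  proof -
    obtain u where u: "0 \<le> u" "u \<le> 1" "z = (1 - u) *\<^sub>R x + u *\<^sub>R d" "side a b z = (1 - u) * side a b x + u * side a b d"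
      using side_segment[OF z(1), of a b] .
    then show ?thesis using z(2) d by (auto simp: mult_nonneg_nonpos)
  qed
  have sep: "closed_segment x c \<inter> closed_segment y d = {}" if "side a b x = 0" "side a b y = 0" "x \<noteq> y" for x y
    using pos[OF _ that(1)] neg[OF _ that(2)] that(3) by (metis antisym disjoint_iff)
  show "closed_segment a c \<inter> closed_segment b d = {}" "closed_segment b c \<inter> closed_segment a d = {}"
    using sep[of a b] sep[of b a] ab by auto
  show "closed_segment a c \<inter> {a, b, c, d} = {a, c}"
    using pos[of b a] pos[of d a] d ab by auto
  show "closed_segment b c \<inter> {a, b, c, d} = {b, c}"
    using pos[of a b] pos[of d b] d ab by auto
  show "closed_segment a d \<inter> {a, b, c, d} = {a, d}"
    using neg[of b a] neg[of c a] c ab by auto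
  show "closed_segment b d \<inter> {a, b, c, d} = {b, d}"
    using neg[of a b] neg[of c b] c ab by auto
qed

lemma crossing_sides:
  assumes "is_crossing L c"
  shows "side (over_tail L c) (over_head L c) (left_end L c) > 0"
    and "side (over_tail L c) (over_head L c) (right_end L c) < 0"
proof -
  have "side_of_over L c (under_head L c) * side_of_over L c (under_tail L c) < 0"
    using assms by (simp add: is_crossing_def)
  then show "side (over_tail L c) (over_head L c) (left_end L c) > 0"
    and "side (over_tail L c) (over_head L c) (right_end L c) < 0"
    unfolding side_def[of "over_tail L c"] side_of_over_def[symmetric]
    by (auto simp: left_end_def right_end_def positive_crossing_def mult_less_0_iff)
qed

lemma crossing_cball:
  assumes "is_crossing L c" "k < length L"
  shows "proj_at L k t \<in> cball (center c) (radius c) \<longleftrightarrow>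
       k = over c \<and> (\<exists>m::int. t + m \<in> {over_in c..over_out c}) \<or>
       k = under c \<and> (\<exists>m::int. t + m \<in> {under_in c..under_out c})"
    and "proj_at L k t \<in> ball (center c) (radius c) \<longleftrightarrow>
       k = over c \<and> (\<exists>m::int. t + m \<in> {over_in c<..<over_out c}) \<or>
       k = under c \<and> (\<exists>m::int. t + m \<in> {under_in c<..<under_out c})"
  using assms by (simp_all only: is_crossing_def)

lemma ports_eq: "ports L c = {over_tail L c, over_head L c, left_end L c, right_end L c}"
  by (auto simp: ports_def left_end_def right_end_def)

lemma ports_in_disk:
  assumes c: "is_crossing L c"
  shows "ports L c \<subseteq> crossing_disk c"
proof -
  have in_over: "proj_at L (over c) t \<in> cball (center c) (radius c)" if "t \<in> {over_in c..over_out c}" for t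
    using crossing_cball(1)[OF c, of "over c" t] that c by (auto simp: is_crossing_def intro!: exI[of _ 0])
  have in_under: "proj_at L (under c) t \<in> cball (center c) (radius c)" if "t \<in> {under_in c..under_out c}" for t
    using crossing_cball(1)[OF c, of "under c" t] that c by (auto simp: is_crossing_def intro!: exI[of _ 0])
  have "over_in c < over_out c" "under_in c < under_out c" using c by (auto simp: is_crossing_def)
  then show ?thesis
    unfolding ports_def crossing_disk_def over_tail_def over_head_def under_tail_def under_head_def
    using in_over in_under by simp
qed

section \<open>Resolving the crossings\<close>

definition resolve :: "diagram \<Rightarrow> nat set \<Rightarrow> nat \<Rightarrow> complex set" where
  "resolve D S i = (if i \<in> S then resolution1 (dlink D) (crossings D ! i) else resolution0 (dlink D) (crossings D ! i))"

lemma resolved_eq: "resolved D S = outside_disks D \<union> (\<Union>i<length (crossings D). resolve D S i)"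
  by (simp add: resolved_def outside_disks_def resolve_def)

locale surface_diagram =
  fixes Surf :: "complex set" and D :: diagram
  assumes diagram: "diagram_in Surf D"
begin

abbreviation L :: link where "L \<equiv> dlink D"
abbreviation nc :: nat where "nc \<equiv> length (crossings D)"
abbreviation cr :: "nat \<Rightarrow> crossing" where "cr i \<equiv> crossings D ! i"
abbreviation disk :: "nat \<Rightarrow> complex set" where "disk i \<equiv> crossing_disk (cr i)"

lemma crossing: "i < nc \<Longrightarrow> is_crossing L (cr i)"
  using diagram nth_mem by (auto simp: diagram_in_def)

lemma disk_subset: "i < nc \<Longrightarrow> disk i \<subseteq> Surf"
  using diagram nth_mem unfolding diagram_in_def crossing_disk_def by blast

lemma disks_disjoint: "i < nc \<Longrightarrow> j < nc \<Longrightarrow> i \<noteq> j \<Longrightarrow> disk i \<inter> disk j = {}"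
  using diagram unfolding diagram_in_def crossing_disk_def by blast

lemma shadow_subset: "shadow D \<subseteq> Surf"
proof
  fix z assume "z \<in> shadow D"
  then obtain K t where K: "K \<in> set L" "z = fst (K t)" by (auto simp: shadow_def)
  have "\<forall>K\<in>set L. range K \<subseteq> Surf \<times> {0..1}" using diagram by (simp add: diagram_in_def link_in_def)
  then have "K t \<in> Surf \<times> {0..1}" using K(1) by blast
  then show "z \<in> Surf" using K(2) by auto
qed

lemma resolve_disk: "i < nc \<Longrightarrow> resolve D S i \<subseteq> disk i"
proof -
  assume i: "i < nc"
  have "ports L (cr i) \<subseteq> disk i" using ports_in_disk[OF crossing[OF i]] .
  moreover have "convex (disk i)" by (simp add: crossing_disk_def)
  ultimately show ?thesis
    unfolding resolve_def resolution0_def resolution1_def ports_eq by (auto dest: closed_segment_subset)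
qed

text \<open>A point of the diagram in the closed but not the open disk has its parameter in a closed
  but not the open passage, hence at an end.\<close>

lemma outside_disks_disk:
  assumes i: "i < nc"
  shows "outside_disks D \<inter> disk i = ports L (cr i)"
proof
  have c: "is_crossing L (cr i)" using crossing[OF i] .
  show "outside_disks D \<inter> disk i \<subseteq> ports L (cr i)"
  proof
    fix z assume z: "z \<in> outside_disks D \<inter> disk i"
    then have "z \<in> shadow D" by (simp add: outside_disks_def)
    then obtain K t where "K \<in> set L" "z = fst (K t)" by (auto simp: shadow_def)
    then obtain k where k: "k < length L" "z = proj_at L k t" by (metis in_set_conv_nth proj_at_def)
    have nb: "proj_at L k t \<notin> ball (center (cr i)) (radius (cr i))"
      using z k(2) i by (auto simp: outside_disks_def)
    have cb: "proj_at L k t \<in> cball (center (cr i)) (radius (cr i))"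
      using z k(2) by (simp add: crossing_disk_def)
    have per: "proj_at L l (t + of_int m) = proj_at L l t" if "l < length L" for l m
    proof -
      have "(L ! l) (t + of_int m) = (L ! l) t"
        using diagram that nth_mem[OF that] unfolding diagram_in_def link_in_def by auto
      then show ?thesis by (simp add: proj_at_def)
    qed
    have ends: "t + of_int m \<in> {u, v}" if "t + of_int m \<in> {u..v}" "t + of_int m \<notin> {u<..<v}" for m :: int and u v :: real
      using that by auto
    from cb consider m where "k = over (cr i)" "t + of_int m \<in> {over_in (cr i)..over_out (cr i)}"
      | m where "k = under (cr i)" "t + of_int m \<in> {under_in (cr i)..under_out (cr i)}"
      using crossing_cball(1)[OF c k(1)] by blast
    then show "z \<in> ports L (cr i)"
    proof cases
      case 1
      then have "t + of_int m \<notin> {over_in (cr i)<..<over_out (cr i)}"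
        using nb crossing_cball(2)[OF c k(1)] 1(1) by blast
      from ends[OF 1(2) this] show ?thesis
        using per[OF k(1), of m] k(2) 1(1) by (auto simp: ports_def over_tail_def over_head_def)
    next
      case 2
      then have "t + of_int m \<notin> {under_in (cr i)<..<under_out (cr i)}"
        using nb crossing_cball(2)[OF c k(1)] 2(1) by blast
      from ends[OF 2(2) this] show ?thesis
        using per[OF k(1), of m] k(2) 2(1) by (auto simp: ports_def under_tail_def under_head_def)
    qed
  qed
  \<comment> \<open>The converse is read off from the cut diagram, whose loose ends include all
    ports.\<close>
  obtain F where "curve_family F (\<Union>c\<in>set (crossings D). ports L c)" "\<Union>F = outside_disks D"
    using curve_family_outside_disks[OF diagram] by blast
  then have "ports L (cr i) \<subseteq> outside_disks D"
    using i nth_mem[OF i] unfolding curve_family_def by blast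
  then show "ports L (cr i) \<subseteq> outside_disks D \<inter> disk i"
    using ports_in_disk[OF c] by simp
qed

text \<open>Crossings are resolved one at a time, each by two chords between loose ends, while the
  ports of the other crossings stay loose. Once no crossing is left the system consists of Jordan
  curves alone.\<close>

lemma partial_resolution:
  assumes "finite A" "A \<subseteq> {..<nc}"
  shows "\<exists>F. curve_family F (\<Union>i\<in>{..<nc} - A. ports L (cr i)) \<and> \<Union>F = outside_disks D \<union> (\<Union>i\<in>A. resolve D S i)"
  using assms
proof (induction A rule: finite_induct)
  case empty
  have "(\<Union>i\<in>{..<nc}. ports L (cr i)) = (\<Union>c\<in>set (crossings D). ports L c)"
    by (simp add: set_conv_nth) (auto simp: set_conv_nth)
  then show ?case using curve_family_outside_disks[OF diagram] by simp
next
  case (insert j A)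
  let ?Q = "\<Union>i\<in>{..<nc} - A. ports L (cr i)"
  let ?X = "outside_disks D \<union> (\<Union>i\<in>A. resolve D S i)"
  have j: "j < nc" "j \<notin> A" "A \<subseteq> {..<nc}" using insert by auto
  obtain F where F: "curve_family F ?Q" "\<Union>F = ?X" using insert by auto
  let ?a = "over_tail L (cr j)" and ?b = "over_head L (cr j)" and ?c = "left_end L (cr j)" and ?d = "right_end L (cr j)"
  note geo = chord_geometry[OF crossing_sides[OF crossing[OF j(1)]]]
  have Xj: "?X \<inter> disk j = {?a, ?b, ?c, ?d}"
  proof -
    have "resolve D S i \<inter> disk j = {}" if "i \<in> A" for i
      using resolve_disk[of i S] disks_disjoint[of i j] that j by blast
    then show ?thesis using outside_disks_disk[OF j(1)] unfolding ports_eq by blast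
  qed
  have Q': "?Q = (\<Union>i\<in>{..<nc} - insert j A. ports L (cr i)) \<union> {?a, ?b, ?c, ?d}"
  proof -
    have "{..<nc} - A = insert j ({..<nc} - insert j A)" using j by auto
    then show ?thesis by (simp add: ports_eq Un_commute)
  qed
  have Qj: "(\<Union>i\<in>{..<nc} - insert j A. ports L (cr i)) \<inter> {?a, ?b, ?c, ?d} = {}"
  proof -
    have "ports L (cr i) \<inter> ports L (cr j) = {}" if "i \<in> {..<nc} - insert j A" for i
      using ports_in_disk[OF crossing, of i] ports_in_disk[OF crossing, of j] disks_disjoint[of i j] that j(1) by blast
    then show ?thesis unfolding ports_eq[of L "cr j", symmetric] by blast
  qed
  have disk: "convex (disk j)" "{?a, ?b, ?c, ?d} \<subseteq> disk j"
    using ports_in_disk[OF crossing[OF j(1)]] by (simp_all add: crossing_disk_def ports_eq)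
  \<comment> \<open>The two resolutions differ only in how the four ports are paired, so one
    argument serves both.\<close>
  have add2: "\<exists>F'. curve_family F' (\<Union>i\<in>{..<nc} - insert j A. ports L (cr i)) \<and>
      \<Union>F' = ?X \<union> (closed_segment x y \<union> closed_segment x' y')"
    if e: "{x, y, x', y'} = {?a, ?b, ?c, ?d}" "distinct [x, y, x', y']"
      and s: "closed_segment x y \<inter> {?a, ?b, ?c, ?d} = {x, y}" "closed_segment x' y' \<inter> {?a, ?b, ?c, ?d} = {x', y'}"
      and dj: "closed_segment x y \<inter> closed_segment x' y' = {}" for x y x' y'
  proof -
    have sd: "closed_segment x y \<subseteq> disk j" "closed_segment x' y' \<subseteq> disk j"
    proof -
      have "{x, y, x', y'} \<subseteq> disk j" unfolding e(1) by (rule disk(2))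
      then show "closed_segment x y \<subseteq> disk j" "closed_segment x' y' \<subseteq> disk j"
        using disk(1) by (simp_all add: closed_segment_subset)
    qed
    have arcs: "arc (linepath x y)" "arc (linepath x' y')" using e(2) by (auto intro: arc_linepath)
    have X1: "closed_segment x y \<inter> ?X = {x, y}"
    proof -
      have "closed_segment x y \<inter> ?X = closed_segment x y \<inter> (?X \<inter> disk j)" using sd(1) by blast
      then show ?thesis using s(1) unfolding Xj by simp
    qed
    have X2: "closed_segment x' y' \<inter> ?X = {x', y'}"
    proof -
      have "closed_segment x' y' \<inter> ?X = closed_segment x' y' \<inter> (?X \<inter> disk j)" using sd(2) by blast
      then show ?thesis using s(2) unfolding Xj by simp
    qed
    have "{x, y, x', y'} \<subseteq> ?Q" unfolding e(1) Q' by (rule Un_upper2)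
    then have xQ: "x \<in> ?Q" "y \<in> ?Q" "x' \<in> ?Q" "y' \<in> ?Q" by simp_all
    obtain F1 where F1: "curve_family F1 (?Q - {y, x})" "\<Union>F1 = ?X \<union> closed_segment x y"
      using curve_family_add_arc[OF F(1) arcs(1), of x y] xQ X1 F(2) by (auto simp: insert_commute)
    have "closed_segment x' y' \<inter> \<Union>F1 = {y', x'}"
    proof -
      have "closed_segment x' y' \<inter> \<Union>F1 = (closed_segment x' y' \<inter> ?X) \<union> (closed_segment x y \<inter> closed_segment x' y')"
        unfolding F1(2) by blast
      then show ?thesis unfolding X2 dj by (simp add: insert_commute)
    qed
    then obtain F2 where F2: "curve_family F2 (?Q - {y, x} - {y', x'})" "\<Union>F2 = \<Union>F1 \<union> closed_segment x' y'"
      using curve_family_add_arc[OF F1(1) arcs(2), of x' y'] xQ e(2) by auto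
    have "?Q - {y, x} - {y', x'} = ?Q - {?a, ?b, ?c, ?d}" unfolding e(1)[symmetric] by blast
    also have "\<dots> = (\<Union>i\<in>{..<nc} - insert j A. ports L (cr i))" unfolding Q' using Qj by blast
    finally show ?thesis using F2 F1(2) by (auto simp: Un_assoc)
  qed
  have "\<exists>F'. curve_family F' (\<Union>i\<in>{..<nc} - insert j A. ports L (cr i)) \<and> \<Union>F' = ?X \<union> resolve D S j"
  proof (cases "j \<in> S")
    case True
    then have "resolve D S j = closed_segment ?b ?c \<union> closed_segment ?a ?d"
      by (simp add: resolve_def resolution1_def)
    moreover have "{?b, ?c, ?a, ?d} = {?a, ?b, ?c, ?d}" "distinct [?b, ?c, ?a, ?d]" using geo(1) by auto
    ultimately show ?thesis
      using add2[OF _ _ geo(5,6,3)] by simp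
  next
    case False
    then have "resolve D S j = closed_segment ?a ?c \<union> closed_segment ?b ?d"
      by (simp add: resolve_def resolution0_def)
    moreover have "{?a, ?c, ?b, ?d} = {?a, ?b, ?c, ?d}" "distinct [?a, ?c, ?b, ?d]" using geo(1) by auto
    ultimately show ?thesis
      using add2[OF _ _ geo(4,7,2)] by simp
  qed
  moreover have "?X \<union> resolve D S j = outside_disks D \<union> (\<Union>i\<in>insert j A. resolve D S i)" by auto
  ultimately show ?case by simp
qed

text \<open>With every crossing resolved, the curve family is itself the set of components.\<close>

lemma finite_circles_diagram: "finite (circles D S)"
proof -
  obtain F where F: "curve_family F (\<Union>i\<in>{..<nc} - {..<nc}. ports L (cr i))" "\<Union>F = resolved D S"
    using partial_resolution[of "{..<nc}" S] unfolding resolved_eq by blast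
  have "circles D S = F"
    using components_curve_family[OF F(1)] unfolding circles_def F(2) .
  then show ?thesis using F(1) by (simp add: curve_family_def)
qed

text \<open>Of the three ways in which the two arcs outside the crossing disk can match the four ports,
  \<open>no_alternating_arcs\<close> excludes the one that joins opposite ports; in the other two, one resolution
  closes up each arc separately and the other one joins them.\<close>

lemma crossing_surgery:
  assumes j: "j < nc" "j \<notin> S"
  obtains F a b c d \<gamma> \<delta> where "surgery F (disk j) a b c d \<gamma> \<delta>"
    "\<Union>F \<subseteq> Surf"
    "resolved D S = \<Union>F \<union> (closed_segment b a \<union> closed_segment d c) \<and>
     resolved D (insert j S) = \<Union>F \<union> (closed_segment b c \<union> closed_segment d a) \<or>
     resolved D S = \<Union>F \<union> (closed_segment b c \<union> closed_segment d a) \<and>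
     resolved D (insert j S) = \<Union>F \<union> (closed_segment b a \<union> closed_segment d c)"
proof -
  define X where "X = outside_disks D \<union> (\<Union>i\<in>{..<nc} - {j}. resolve D S i)"
  let ?a = "over_tail L (cr j)" and ?b = "over_head L (cr j)" and ?c = "left_end L (cr j)" and ?d = "right_end L (cr j)"
  note sides = crossing_sides[OF crossing[OF j(1)]]
  note geo = chord_geometry[OF sides]
  have "{..<nc} - ({..<nc} - {j}) = {j}" using j by auto
  then obtain F where F: "curve_family F {?a, ?b, ?c, ?d}" "\<Union>F = X"
    using partial_resolution[of "{..<nc} - {j}" S] unfolding X_def by (auto simp: ports_eq)
  have XB: "\<Union>F \<inter> disk j = {?a, ?b, ?c, ?d}"
  proof -
    have "resolve D S i \<inter> disk j = {}" if "i \<in> {..<nc} - {j}" for i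
      using resolve_disk[of i S] disks_disjoint[of i j] that j by blast
    then show ?thesis using outside_disks_disk[OF j(1)] unfolding ports_eq F(2) X_def by blast
  qed
  have FS: "\<Union>F \<subseteq> Surf"
  proof -
    have "resolve D S i \<subseteq> Surf" if "i < nc" for i using resolve_disk[OF that] disk_subset[OF that] by blast
    then show ?thesis using shadow_subset unfolding F(2) X_def outside_disks_def by blast
  qed
  have R0: "resolved D S = \<Union>F \<union> (closed_segment ?a ?c \<union> closed_segment ?b ?d)"
  proof -
    have "{..<nc} = insert j ({..<nc} - {j})" using j by auto
    then have "resolved D S = X \<union> resolve D S j" unfolding resolved_eq X_def by (metis UN_insert Un_left_commute Un_commute)
    then show ?thesis using j F(2) by (simp add: resolve_def resolution0_def)
  qed
  have R1: "resolved D (insert j S) = \<Union>F \<union> (closed_segment ?b ?c \<union> closed_segment ?a ?d)"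
  proof -
    have "{..<nc} = insert j ({..<nc} - {j})" using j by auto
    then have "resolved D (insert j S) = outside_disks D \<union> (\<Union>i\<in>{..<nc} - {j}. resolve D (insert j S) i) \<union> resolve D (insert j S) j"
      unfolding resolved_eq by (metis UN_insert Un_left_commute Un_commute)
    moreover have "resolve D (insert j S) i = resolve D S i" if "i \<in> {..<nc} - {j}" for i
      using that by (simp add: resolve_def)
    ultimately show ?thesis using F(2) by (simp add: resolve_def resolution1_def X_def)
  qed
  \<comment> \<open>The arc leaving the over tail determines the matching: its other end
    \<open>q\<close> is one of three ports, and the remaining two ports are then joined by a second
    arc.\<close>
  obtain Y \<gamma> q where Y: "Y \<in> F" "arc \<gamma>" "path_image \<gamma> = Y" "pathstart \<gamma> = ?a" "pathfinish \<gamma> = q" "Y \<inter> {?a, ?b, ?c, ?d} = {?a, q}" "?a \<noteq> q"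
    using curve_family_arc[OF F(1), of ?a] by blast
  have "q \<in> {?a, ?b, ?c, ?d}" using Y(6) by blast
  then have "q \<in> {?b, ?c, ?d}" using Y(7) by auto
  have other: "\<exists>\<delta>. path_image \<delta> \<in> F \<and> arc \<delta> \<and> pathstart \<delta> = x \<and> pathfinish \<delta> = y \<and>
      path_image \<delta> \<inter> {?a, ?b, ?c, ?d} = {x, y} \<and> Y \<inter> path_image \<delta> = {}"
    if xy: "{?a, ?b, ?c, ?d} = {?a, q, x, y}" "distinct [?a, q, x, y]" for x y
  proof -
    obtain Y' \<delta> r where Y': "Y' \<in> F" "arc \<delta>" "path_image \<delta> = Y'" "pathstart \<delta> = x" "pathfinish \<delta> = r" "Y' \<inter> {?a, ?b, ?c, ?d} = {x, r}" "x \<noteq> r"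
      using curve_family_arc[OF F(1), of x] xy(1) by blast
    have xQ: "x \<in> {?a, ?b, ?c, ?d}" unfolding xy(1) by simp
    have "x \<in> Y'" using Y'(6) by blast
    moreover have "x \<notin> Y"
    proof
      assume "x \<in> Y"
      then have "x \<in> {?a, q}" using xQ unfolding Y(6)[symmetric] by blast
      then show False using xy(2) by auto
    qed
    ultimately have d: "Y \<inter> Y' = {}" using F(1) Y(1) Y'(1) by (auto simp: curve_family_def disjoint_def)
    have "?a \<in> Y" "q \<in> Y" "r \<in> Y'" using Y(6) Y'(6) by blast+
    then have "r \<noteq> ?a" "r \<noteq> q" using d by blast+
    moreover have "r \<in> {?a, q, x, y}" unfolding xy(1)[symmetric] using Y'(6) by blast
    ultimately have "r = y" using Y'(7) by auto
    then show ?thesis using Y' d by blast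
  qed
  have conv: "convex (disk j)" by (simp add: crossing_disk_def)
  from \<open>q \<in> {?b, ?c, ?d}\<close> consider "q = ?b" | "q = ?c" | "q = ?d" by blast
  then show thesis
  proof cases
    case 1
    have oe: "{?a, ?b, ?c, ?d} = {?a, q, ?c, ?d}" "distinct [?a, q, ?c, ?d]" using 1 geo(1) by auto
    obtain \<delta> where \<delta>: "path_image \<delta> \<in> F" "arc \<delta>" "pathstart \<delta> = ?c" "pathfinish \<delta> = ?d"
      "path_image \<delta> \<inter> {?a, ?b, ?c, ?d} = {?c, ?d}" "Y \<inter> path_image \<delta> = {}"
      using other[OF oe] by (elim exE conjE) (rule that)
    have "path_image \<gamma> \<inter> disk j = {?a, ?b}" "path_image \<delta> \<inter> disk j = {?c, ?d}"
      using XB Y(1,3,6) \<delta>(1,5) 1 by blast+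
    then have False
      using no_alternating_arcs[OF Y(2,4) _ arc_imp_path[OF \<delta>(2)] \<delta>(3,4) _ _ _ sides] Y(3,5) 1 \<delta>(6)
      by (auto simp: crossing_disk_def)
    then show ?thesis ..
  next
    case 2
    have oe: "{?a, ?b, ?c, ?d} = {?a, q, ?b, ?d}" "distinct [?a, q, ?b, ?d]" using 2 geo(1) by auto
    obtain \<delta> where \<delta>: "path_image \<delta> \<in> F" "arc \<delta>" "pathstart \<delta> = ?b" "pathfinish \<delta> = ?d"
      "path_image \<delta> \<inter> {?a, ?b, ?c, ?d} = {?b, ?d}" "Y \<inter> path_image \<delta> = {}"
      using other[OF oe] by (elim exE conjE) (rule that)
    have e: "{?a, ?c, ?b, ?d} = {?a, ?b, ?c, ?d}" by auto
    have ds: "distinct [?a, ?c, ?b, ?d]" using geo(1) by auto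
    \<comment> \<open>The over tail is matched with the left end, so the 0-resolution closes each
      arc and the 1-resolution joins them. When it is matched with the right end, the roles are
      exchanged.\<close>
    have "surgery F (disk j) ?a ?c ?b ?d \<gamma> \<delta>"
      unfolding surgery_def e using ds F(1) Y \<delta> XB conv geo(2-) 2
      by (simp add: closed_segment_commute Int_commute insert_commute)
    then show ?thesis
      by (rule that[OF _ FS]) (use R0 R1 in \<open>simp add: closed_segment_commute\<close>)
  next
    case 3
    have oe: "{?a, ?b, ?c, ?d} = {?a, q, ?b, ?c}" "distinct [?a, q, ?b, ?c]" using 3 geo(1) by auto
    obtain \<delta> where \<delta>: "path_image \<delta> \<in> F" "arc \<delta>" "pathstart \<delta> = ?b" "pathfinish \<delta> = ?c"
      "path_image \<delta> \<inter> {?a, ?b, ?c, ?d} = {?b, ?c}" "Y \<inter> path_image \<delta> = {}"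
      using other[OF oe] by (elim exE conjE) (rule that)
    have e: "{?a, ?d, ?b, ?c} = {?a, ?b, ?c, ?d}" by auto
    have ds: "distinct [?a, ?d, ?b, ?c]" using geo(1) by auto
    have "surgery F (disk j) ?a ?d ?b ?c \<gamma> \<delta>"
      unfolding surgery_def e using ds F(1) Y \<delta> XB conv geo(2-) 3
      by (simp add: closed_segment_commute Int_commute insert_commute)
    then show ?thesis
      by (rule that[OF _ FS]) (use R0 R1 in \<open>simp add: closed_segment_commute Un_commute\<close>)
  qed
qed

text \<open>Both resolutions share the untouched curves \<open>G\<close>; at the crossing disk one
  has \<open>C1\<close> and \<open>C2\<close>, the other \<open>C\<close>. A point outside
  \<open>Surf\<close> avoids the disk and the curves, as the comparison of winding numbers
  requires.\<close>

lemma crossing_circles: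
  assumes j: "j < nc" "j \<notin> S"
  shows "circles D S - touching D j S = circles D (insert j S) - touching D j (insert j S)"
    and "touching D j S \<inter> touching D j (insert j S) = {}"
    and "card (touching D j S) = 2 \<and> card (touching D j (insert j S)) = 1 \<or>
      card (touching D j S) = 1 \<and> card (touching D j (insert j S)) = 2"
    and "{X, Y, W} = touching D j S \<union> touching D j (insert j S) \<Longrightarrow> z \<notin> Surf \<Longrightarrow>
      circle_class W z \<le> circle_class X z + circle_class Y z"
proof -
  obtain F a b c d \<gamma> \<delta> where s: "surgery F (disk j) a b c d \<gamma> \<delta>" and FS: "\<Union>F \<subseteq> Surf" and
    R: "resolved D S = \<Union>F \<union> (closed_segment b a \<union> closed_segment d c) \<and>
     resolved D (insert j S) = \<Union>F \<union> (closed_segment b c \<union> closed_segment d a) \<or>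
     resolved D S = \<Union>F \<union> (closed_segment b c \<union> closed_segment d a) \<and>
     resolved D (insert j S) = \<Union>F \<union> (closed_segment b a \<union> closed_segment d c)"
    using crossing_surgery[OF j] .
  interpret surgery F "disk j" a b c d \<gamma> \<delta> by (rule s)
  have R': "circles D S = insert C1 (insert C2 G) \<and> circles D (insert j S) = insert C G \<or>
      circles D S = insert C G \<and> circles D (insert j S) = insert C1 (insert C2 G)"
    using R components_split components_merge unfolding circles_def by metis
  have T: "{Z \<in> insert C1 (insert C2 G). Z \<inter> disk j \<noteq> {}} = {C1, C2}" "{Z \<in> insert C G. Z \<inter> disk j \<noteq> {}} = {C}"
    using G_B circles_B by auto
  have RT: "circles D S = insert C1 (insert C2 G) \<and> circles D (insert j S) = insert C G \<and>
        touching D j S = {C1, C2} \<and> touching D j (insert j S) = {C} \<or>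
      circles D S = insert C G \<and> circles D (insert j S) = insert C1 (insert C2 G) \<and>
        touching D j S = {C} \<and> touching D j (insert j S) = {C1, C2}"
    using R'
  proof (elim disjE conjE)
    assume "circles D S = insert C1 (insert C2 G)" "circles D (insert j S) = insert C G"
    then show ?thesis unfolding touching_def by (simp only: T simp_thms)
  next
    assume "circles D S = insert C G" "circles D (insert j S) = insert C1 (insert C2 G)"
    then show ?thesis unfolding touching_def by (simp only: T simp_thms)
  qed
  have nG: "C1 \<notin> G" "C2 \<notin> G" "C \<notin> G" using G_B circles_B by auto
  have dist: "C1 \<noteq> C2" "C \<noteq> C1" "C \<noteq> C2" by (rule circles_distinct)+
  have "insert C1 (insert C2 G) - {C1, C2} = G" "insert C G - {C} = G" using nG by auto
  then show "circles D S - touching D j S = circles D (insert j S) - touching D j (insert j S)"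
    using RT by (elim disjE conjE) simp_all
  show "touching D j S \<inter> touching D j (insert j S) = {}"
    using RT dist by (elim disjE conjE) simp_all
  show "card (touching D j S) = 2 \<and> card (touching D j (insert j S)) = 1 \<or>
      card (touching D j S) = 1 \<and> card (touching D j (insert j S)) = 2"
    using RT dist by (elim disjE conjE) simp_all
  assume E: "{X, Y, W} = touching D j S \<union> touching D j (insert j S)" and z: "z \<notin> Surf"
  have "touching D j S \<union> touching D j (insert j S) = {C1, C2, C}"
    using RT by (elim disjE conjE) (simp_all add: insert_commute)
  then have "{X, Y, W} = {C1, C2, C}" using E by simp
  moreover have "z \<notin> disk j" "z \<notin> \<Union>F" using z FS disk_subset[OF j(1)] by blast+
  ultimately show "circle_class W z \<le> circle_class X z + circle_class Y z"
    by (intro circle_class_triangle)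
qed

sublocale resolution_cube D
proof
  show "finite (circles D S)" for S by (rule finite_circles_diagram)
  show "circles D S - touching D j S = circles D (insert j S) - touching D j (insert j S)"
    "touching D j S \<inter> touching D j (insert j S) = {}"
    "card (touching D j S) = 2 \<and> card (touching D j (insert j S)) = 1 \<or>
      card (touching D j S) = 1 \<and> card (touching D j (insert j S)) = 2"
    if "S \<subseteq> {..<nc}" "j < nc" "j \<notin> S" for S j
    using crossing_circles[OF that(2,3)] by blast+
  fix S i j assume ij: "i < nc" "j < nc" "i \<noteq> j"
  \<comment> \<open>Inside one disk the resolved diagram depends only on the choice made at that
    crossing.\<close>
  have "resolved D S' \<inter> disk j = (outside_disks D \<inter> disk j) \<union> resolve D S' j" for S'
  proof -
    have "resolve D S' k \<inter> disk j = {}" if "k < nc" "k \<noteq> j" for k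
      using resolve_disk[OF that(1), of S'] disks_disjoint[OF that(1) ij(2) that(2)] by blast
    then show ?thesis using resolve_disk[OF ij(2), of S'] ij(2) unfolding resolved_eq by blast
  qed
  moreover have "resolve D (insert i S) j = resolve D S j" using ij by (simp add: resolve_def)
  ultimately show "resolved D (insert i S) \<inter> disk j = resolved D S \<inter> disk j" by simp
qed

end

theorem theorem1p4:
  fixes P :: "complex set" and p :: complex and L :: link and D :: diagram
  assumes "finite P" and "P \<subseteq> ball 0 1" and "card P > 1" and "p \<in> P"
    and "link_in (punctured_disk P \<times> {0..1}) L"
    and "diagram_of (punctured_disk P) L D"
  shows "\<exists>(E :: nat \<Rightarrow> int \<Rightarrow> int \<Rightarrow> int \<Rightarrow> chain set qspace) d.
           spectral_sequence E d \<and>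
           (\<forall>a i q. isomorphic_spaces (E 1 a i q) (MKh_flat P D a i q)) \<and>
           converges_to E d (AKh p D)"
proof -
  interpret surface_diagram "punctured_disk P" D
    using assms(6) by unfold_locales (simp add: diagram_of_def)
  show ?thesis
  proof (rule spectral_sequence_of_filtered_complex[OF graded_complex_CKh _ assms(1,4)])
    show "g_degree P D y \<le> g_degree P D x"
      if "x \<in> enhanced_states D" "y \<in> enhanced_states D" "boundary_coeff D x y \<noteq> 0" for x y
    proof (rule g_degree_decreasing[OF _ that])
      fix S j A B C z
      assume "S \<subseteq> {..<n}" "j < n" "j \<notin> S" "{A, B, C} = touching D j S \<union> touching D j (insert j S)" "z \<in> P"
      \<comment> \<open>A puncture is not a point of the surface, so it lies outside every crossing
        disk and off the diagram.\<close>
      then show "circle_class C z \<le> circle_class A z + circle_class B z"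
        using crossing_circles(4)[of j S A B C z] by (simp add: punctured_disk_def)
    qed
  qed
qed

end
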